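(* Let $X=\mathbb C^2\setminus L$ where $L=\{(z_1,z_2)\in\mathbb C^2:\ \operatorname{Re} z_1=0,\ z_2=0\}$ is a real line. Then $\dim_{\mathbb C} H^{1,1}_{BC}(X)\ge 3$ and $\dim_{\mathbb C} H^{1,1}_{A,c}(X)\le 2$. Consequently $H^{1,1}_{A,c}(X)$ and $H^{1,1}_{BC}(X)$ are not topological duals of each other (that is, it is not the case that each is isomorphic to the topological dual of the other).
   Context: For a complex manifold $X$, $\mathcal A^{p,q}(X)$ denotes the space of smooth complex $(p,q)$-forms and $\mathcal A^{p,q}_c(X)$ the subspace of compactly supported ones. Define $$H^{1,1}_{BC}(X)=\frac{\{\alpha\in\mathcal A^{1,1}(X):\partial\alpha=0,\ \bar\partial\alpha=0\}}{\partial\bar\partial\,\mathcal A^{0,0}(X)},\qquad H^{1,1}_{A,c}(X)=\frac{\{\alpha\in\mathcal A^{1,1}_c(X):\partial\bar\partial\alpha=0\}}{\partial\mathcal A^{0,1}_c(X)+\bar\partial\mathcal A^{1,0}_c(X)}.$$ Topologies: $H^{1,1}_{BC}(X)$ carries the quotient topology induced by the natural Fréchet topology on smooth forms; $H^{1,1}_{A,c}(X)$ may equivalently be computed by compactly supported currents and carries the locally convex topology induced from the space of compactly supported currents. *)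

theory Defs
  imports
    "HOL-Analysis.Analysis"
    "HOL-Library.Function_Algebras"
    "HOL-Library.Set_Algebras"
    "HOL-Library.Extended_Nat"
begin

subsection \<open>Complex vector spaces with explicit carrier\<close>

record 'a cspace =
  carr :: "'a set"
  zer :: 'a
  add :: "'a \<Rightarrow> 'a \<Rightarrow> 'a"
  scal :: "complex \<Rightarrow> 'a \<Rightarrow> 'a"

definition complex_line :: "complex cspace" where
  "complex_line = \<lparr>carr = UNIV, zer = 0, add = (+), scal = (*)\<rparr>"

definition linear_map :: "'a cspace \<Rightarrow> 'b cspace \<Rightarrow> ('a \<Rightarrow> 'b) \<Rightarrow> bool" where
  "linear_map V W f \<longleftrightarrow>
     f ` carr V \<subseteq> carr W \<and>
     (\<forall>x\<in>carr V. \<forall>y\<in>carr V. f (add V x y) = add W (f x) (f y)) \<and>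
     (\<forall>c. \<forall>x\<in>carr V. f (scal V c x) = scal W c (f x))"

definition linearly_isomorphic :: "'a cspace \<Rightarrow> 'b cspace \<Rightarrow> bool" where
  "linearly_isomorphic V W \<longleftrightarrow> (\<exists>f. linear_map V W f \<and> bij_betw f (carr V) (carr W))"

primrec lin_comb :: "'a cspace \<Rightarrow> (nat \<Rightarrow> complex) \<Rightarrow> (nat \<Rightarrow> 'a) \<Rightarrow> nat \<Rightarrow> 'a" where
  "lin_comb V c v 0 = zer V"
| "lin_comb V c v (Suc n) = add V (lin_comb V c v n) (scal V (c n) (v n))"

definition lin_independent :: "'a cspace \<Rightarrow> nat \<Rightarrow> (nat \<Rightarrow> 'a) \<Rightarrow> bool" where
  "lin_independent V n v \<longleftrightarrow>
     (\<forall>i<n. v i \<in> carr V) \<and>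
     (\<forall>c. lin_comb V c v n = zer V \<longrightarrow> (\<forall>i<n. c i = 0))"

text \<open>All infinite dimensions are identified with \<open>\<infinity>\<close>.\<close>

definition cdim :: "'a cspace \<Rightarrow> enat" where
  "cdim V = Sup {enat n | n. \<exists>v. lin_independent V n v}"

text \<open>
  Spaces of functions \<open>'i \<Rightarrow> complex\<close> with pointwise operations, and quotients \<open>Z / B\<close> of
  such spaces, whose elements are the cosets \<open>x + B\<close>.  In a quotient \<open>c \<cdot> A\<close> has to be
  \<open>c * A + B\<close>, because \<open>0 * A\<close> alone is not a coset.
\<close>

definition fscale :: "complex \<Rightarrow> ('i \<Rightarrow> complex) \<Rightarrow> 'i \<Rightarrow> complex" where
  "fscale c f = (\<lambda>i. c * f i)"

definition fun_space :: "('i \<Rightarrow> complex) set \<Rightarrow> ('i \<Rightarrow> complex) cspace" where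
  "fun_space V = \<lparr>carr = V, zer = 0, add = (+), scal = fscale\<rparr>"

definition quot_space :: "('i \<Rightarrow> complex) set \<Rightarrow> ('i \<Rightarrow> complex) set \<Rightarrow> ('i \<Rightarrow> complex) set cspace" where
  "quot_space Z B =
     \<lparr>carr = (\<lambda>x. x +o B) ` Z, zer = B, add = (+), scal = (\<lambda>c A. fscale c ` A + B)\<rparr>"

subsection \<open>Topologies and topological duals\<close>

text \<open>The locally convex topology on \<open>V\<close> defined by a family \<open>P\<close> of seminorms.\<close>

definition seminorm_topology :: "'a::ab_group_add set \<Rightarrow> ('a \<Rightarrow> real) set \<Rightarrow> 'a topology" where
  "seminorm_topology V P =
     topology_generated_by
       (insert V {{y \<in> V. p (y - x) < r} | p x r. p \<in> P \<and> x \<in> V \<and> 0 < r})"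

definition quot_topology :: "'a::ab_group_add topology \<Rightarrow> 'a set \<Rightarrow> 'a set topology" where
  "quot_topology T B =
     topology (\<lambda>U. U \<subseteq> (\<lambda>x. x +o B) ` topspace T \<and> openin T {x \<in> topspace T. x +o B \<in> U})"

lemma openin_quot_topology:
  "openin (quot_topology T B) U \<longleftrightarrow>
     U \<subseteq> (\<lambda>x. x +o B) ` topspace T \<and> openin T {x \<in> topspace T. x +o B \<in> U}"
proof -
  let ?P = "\<lambda>U. U \<subseteq> (\<lambda>x. x +o B) ` topspace T \<and> openin T {x \<in> topspace T. x +o B \<in> U}"
  have "istopology ?P"
    unfolding istopology_def
  proof (intro conjI allI impI)
    fix S U assume "?P S" "?P U"
    moreover have "{x \<in> topspace T. x +o B \<in> S \<inter> U} =
        {x \<in> topspace T. x +o B \<in> S} \<inter> {x \<in> topspace T. x +o B \<in> U}" by auto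
    ultimately show "S \<inter> U \<subseteq> (\<lambda>x. x +o B) ` topspace T"
      and "openin T {x \<in> topspace T. x +o B \<in> S \<inter> U}" by auto
  next
    fix \<K> assume K: "\<forall>S\<in>\<K>. ?P S"
    moreover have "{x \<in> topspace T. x +o B \<in> \<Union>\<K>} =
        (\<Union>S\<in>\<K>. {x \<in> topspace T. x +o B \<in> S})" by auto
    ultimately show "\<Union>\<K> \<subseteq> (\<lambda>x. x +o B) ` topspace T"
      and "openin T {x \<in> topspace T. x +o B \<in> \<Union>\<K>}" by auto
  qed
  then show ?thesis
    unfolding quot_topology_def by (simp add: topology_inverse')
qed

text \<open>
  Functionals are extended by \<open>0\<close> off the carrier, so that each functional on \<open>V\<close> is
  represented by exactly one function.
\<close>

definition top_dual :: "'a cspace \<Rightarrow> 'a topology \<Rightarrow> ('a \<Rightarrow> complex) cspace" where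
  "top_dual V T =
     fun_space {l. linear_map V complex_line l \<and> continuous_map T euclidean l \<and>
                   (\<forall>x. x \<notin> carr V \<longrightarrow> l x = 0)}"

subsection \<open>Smooth forms on open subsets of complex n-space\<close>

text \<open>
  A form \<open>\<omega>\<close> is given by its coefficients: \<open>\<omega> (z, I, J)\<close> is the coefficient of
  \<open>dz\<^sub>I \<and> d\<bar>z\<^sub>J\<close> at \<open>z\<close>, where the factors of \<open>dz\<^sub>I\<close> and of \<open>d\<bar>z\<^sub>J\<close> are taken in increasing
  order of their indices.  Forms on \<open>X\<close> are extended by \<open>0\<close> to the complement of \<open>X\<close>.
\<close>

type_synonym 'n form = "(complex ^ 'n) \<times> 'n set \<times> 'n set \<Rightarrow> complex"

primrec iter_deriv :: "'a::real_normed_vector list \<Rightarrow> ('a \<Rightarrow> complex) \<Rightarrow> 'a \<Rightarrow> complex" where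
  "iter_deriv [] f = f"
| "iter_deriv (v # vs) f = (\<lambda>x. frechet_derivative (iter_deriv vs f) (at x) v)"

definition smooth_on :: "'a::real_normed_vector set \<Rightarrow> ('a \<Rightarrow> complex) \<Rightarrow> bool" where
  "smooth_on X f \<longleftrightarrow> (\<forall>vs. \<forall>x\<in>X. iter_deriv vs f differentiable (at x))"

definition forms :: "(complex ^ 'n) set \<Rightarrow> nat \<Rightarrow> nat \<Rightarrow> 'n form set" where
  "forms X p q =
     {\<omega>. (\<forall>I J. smooth_on X (\<lambda>z. \<omega> (z, I, J))) \<and>
         (\<forall>z I J. \<not> (z \<in> X \<and> card I = p \<and> card J = q) \<longrightarrow> \<omega> (z, I, J) = 0)}"

definition compact_forms :: "(complex ^ 'n) set \<Rightarrow> nat \<Rightarrow> nat \<Rightarrow> 'n form set" where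
  "compact_forms X p q =
     {\<omega> \<in> forms X p q. \<exists>K. compact K \<and> K \<subseteq> X \<and> (\<forall>z I J. z \<notin> K \<longrightarrow> \<omega> (z, I, J) = 0)}"

text \<open>
  For disjoint \<open>A\<close> and \<open>B\<close> this is the sign with \<open>dz\<^sub>A \<and> dz\<^sub>B = shuffle_sign A B \<cdot> dz\<^bsub>A \<union> B\<^esub>\<close>.
\<close>

definition shuffle_sign :: "'n::linorder set \<Rightarrow> 'n set \<Rightarrow> complex" where
  "shuffle_sign A B = (- 1) ^ card {(a, b). a \<in> A \<and> b \<in> B \<and> b < a}"

definition wirtinger :: "'n \<Rightarrow> (complex ^ 'n \<Rightarrow> complex) \<Rightarrow> complex ^ 'n \<Rightarrow> complex" where
  "wirtinger k f z =
     (frechet_derivative f (at z) (axis k 1) - \<i> * frechet_derivative f (at z) (axis k \<i>)) / 2"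

definition wirtinger_bar :: "'n \<Rightarrow> (complex ^ 'n \<Rightarrow> complex) \<Rightarrow> complex ^ 'n \<Rightarrow> complex" where
  "wirtinger_bar k f z =
     (frechet_derivative f (at z) (axis k 1) + \<i> * frechet_derivative f (at z) (axis k \<i>)) / 2"

definition del :: "(complex ^ 'n::{finite,linorder}) set \<Rightarrow> 'n form \<Rightarrow> 'n form" where
  "del X \<omega> = (\<lambda>(z, K, J).
     if z \<in> X
     then \<Sum>k\<in>K. shuffle_sign {k} (K - {k}) * wirtinger k (\<lambda>w. \<omega> (w, K - {k}, J)) z
     else 0)"

text \<open>The factor \<open>(- 1) ^ card I\<close> comes from moving \<open>d\<bar>z\<^sub>k\<close> past \<open>dz\<^sub>I\<close>.\<close>

definition delbar :: "(complex ^ 'n::{finite,linorder}) set \<Rightarrow> 'n form \<Rightarrow> 'n form" where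
  "delbar X \<omega> = (\<lambda>(z, I, M).
     if z \<in> X
     then (- 1) ^ card I *
       (\<Sum>k\<in>M. shuffle_sign {k} (M - {k}) * wirtinger_bar k (\<lambda>w. \<omega> (w, I, M - {k})) z)
     else 0)"

definition wedge :: "'n::{finite,linorder} form \<Rightarrow> 'n form \<Rightarrow> 'n form" where
  "wedge \<alpha> \<beta> = (\<lambda>(z, K, M).
     \<Sum>I\<in>Pow K. \<Sum>J\<in>Pow M.
       (- 1) ^ (card J * card (K - I)) * shuffle_sign I (K - I) * shuffle_sign J (M - J) *
       \<alpha> (z, I, J) * \<beta> (z, K - I, M - J))"

text \<open>
  The constant comes from \<open>dz \<and> d\<bar>z = -2\<i> dx \<and> dy\<close> and from reordering
  \<open>dz\<^sub>1 \<and> \<dots> \<and> dz\<^sub>n \<and> d\<bar>z\<^sub>1 \<and> \<dots> \<and> d\<bar>z\<^sub>n\<close> into \<open>(dz\<^sub>1 \<and> d\<bar>z\<^sub>1) \<and> \<dots> \<and> (dz\<^sub>n \<and> d\<bar>z\<^sub>n)\<close>.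
\<close>

definition form_integral :: "'n::{finite,linorder} form \<Rightarrow> complex" where
  "form_integral \<omega> =
     (- 1) ^ (CARD('n) * (CARD('n) - 1) div 2) * (- 2 * \<i>) ^ CARD('n) *
     (LINT z|lborel. \<omega> (z, UNIV, UNIV))"

text \<open>The Frechet topology: uniform convergence of all derivatives on compact sets.\<close>

definition form_seminorms :: "(complex ^ 'n) set \<Rightarrow> ('n form \<Rightarrow> real) set" where
  "form_seminorms X =
     {\<lambda>\<omega>. SUP z\<in>K. cmod (iter_deriv vs (\<lambda>w. \<omega> (w, I, J)) z)
        | K vs I J. compact K \<and> K \<noteq> {} \<and> K \<subseteq> X}"

definition form_topology :: "(complex ^ 'n) set \<Rightarrow> nat \<Rightarrow> nat \<Rightarrow> 'n form topology" where
  "form_topology X p q = seminorm_topology (forms X p q) (form_seminorms X)"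

subsection \<open>Compactly supported currents\<close>

text \<open>
  Compactly supported currents of bidegree \<open>(p, q)\<close>, with \<open>p, q \<le> n\<close>, form the dual of the
  space of smooth \<open>(n - p, n - q)\<close>-forms, with the strong dual topology (uniform
  convergence on bounded sets).
\<close>

definition currents :: "(complex ^ 'n) set \<Rightarrow> nat \<Rightarrow> nat \<Rightarrow> ('n form \<Rightarrow> complex) set" where
  "currents X p q =
     carr (top_dual (fun_space (forms X (CARD('n) - p) (CARD('n) - q)))
                    (form_topology X (CARD('n) - p) (CARD('n) - q)))"

definition bounded_forms :: "(complex ^ 'n) set \<Rightarrow> nat \<Rightarrow> nat \<Rightarrow> 'n form set \<Rightarrow> bool" where
  "bounded_forms X p q S \<longleftrightarrow> S \<subseteq> forms X p q \<and> (\<forall>\<rho>\<in>form_seminorms X. bdd_above (\<rho> ` S))"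

definition current_topology ::
    "(complex ^ 'n) set \<Rightarrow> nat \<Rightarrow> nat \<Rightarrow> ('n form \<Rightarrow> complex) topology" where
  "current_topology X p q =
     seminorm_topology (currents X p q)
       {\<lambda>T. SUP \<phi>\<in>S. cmod (T \<phi>) | S.
          S \<noteq> {} \<and> bounded_forms X (CARD('n) - p) (CARD('n) - q) S}"

text \<open>
  \<open>\<partial>\<close> and \<open>\<bar>\<partial>\<close> of a current of bidegree \<open>(p, q)\<close>; the sign makes them extend the operators on
  smooth forms.
\<close>

definition current_del ::
    "(complex ^ 'n::{finite,linorder}) set \<Rightarrow> nat \<Rightarrow> nat \<Rightarrow> ('n form \<Rightarrow> complex) \<Rightarrow> 'n form \<Rightarrow> complex" where
  "current_del X p q T = (\<lambda>\<phi>.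
     if \<phi> \<in> forms X (CARD('n) - Suc p) (CARD('n) - q)
     then (- 1) ^ (p + q + 1) * T (del X \<phi>) else 0)"

definition current_delbar ::
    "(complex ^ 'n::{finite,linorder}) set \<Rightarrow> nat \<Rightarrow> nat \<Rightarrow> ('n form \<Rightarrow> complex) \<Rightarrow> 'n form \<Rightarrow> complex" where
  "current_delbar X p q T = (\<lambda>\<phi>.
     if \<phi> \<in> forms X (CARD('n) - p) (CARD('n) - Suc q)
     then (- 1) ^ (p + q + 1) * T (delbar X \<phi>) else 0)"

definition form_current ::
    "(complex ^ 'n::{finite,linorder}) set \<Rightarrow> nat \<Rightarrow> nat \<Rightarrow> 'n form \<Rightarrow> 'n form \<Rightarrow> complex" where
  "form_current X p q \<alpha> = (\<lambda>\<phi>.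
     if \<phi> \<in> forms X (CARD('n) - p) (CARD('n) - q) then form_integral (wedge \<alpha> \<phi>) else 0)"

subsection \<open>Bott--Chern cohomology in bidegree (1,1)\<close>

definition BC_cocycles :: "(complex ^ 'n::{finite,linorder}) set \<Rightarrow> 'n form set" where
  "BC_cocycles X = {\<alpha> \<in> forms X 1 1. del X \<alpha> = 0 \<and> delbar X \<alpha> = 0}"

definition BC_coboundaries :: "(complex ^ 'n::{finite,linorder}) set \<Rightarrow> 'n form set" where
  "BC_coboundaries X = (\<lambda>f. del X (delbar X f)) ` forms X 0 0"

definition H_BC :: "(complex ^ 'n::{finite,linorder}) set \<Rightarrow> 'n form set cspace" where
  "H_BC X = quot_space (BC_cocycles X) (BC_coboundaries X)"

definition H_BC_topology :: "(complex ^ 'n::{finite,linorder}) set \<Rightarrow> 'n form set topology" where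
  "H_BC_topology X =
     quot_topology (subtopology (form_topology X 1 1) (BC_cocycles X)) (BC_coboundaries X)"

subsection \<open>Aeppli cohomology with compact supports in bidegree (1,1)\<close>

definition A_cocycles :: "(complex ^ 'n::{finite,linorder}) set \<Rightarrow> 'n form set" where
  "A_cocycles X = {\<alpha> \<in> compact_forms X 1 1. del X (delbar X \<alpha>) = 0}"

definition A_coboundaries :: "(complex ^ 'n::{finite,linorder}) set \<Rightarrow> 'n form set" where
  "A_coboundaries X = del X ` compact_forms X 0 1 + delbar X ` compact_forms X 1 0"

definition H_A_c :: "(complex ^ 'n::{finite,linorder}) set \<Rightarrow> 'n form set cspace" where
  "H_A_c X = quot_space (A_cocycles X) (A_coboundaries X)"

definition A_current_cocycles ::
    "(complex ^ 'n::{finite,linorder}) set \<Rightarrow> ('n form \<Rightarrow> complex) set" where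
  "A_current_cocycles X = {T \<in> currents X 1 1. current_del X 1 2 (current_delbar X 1 1 T) = 0}"

definition A_current_coboundaries ::
    "(complex ^ 'n::{finite,linorder}) set \<Rightarrow> ('n form \<Rightarrow> complex) set" where
  "A_current_coboundaries X =
     current_del X 0 1 ` currents X 0 1 + current_delbar X 1 0 ` currents X 1 0"

definition H_A_current_topology ::
    "(complex ^ 'n::{finite,linorder}) set \<Rightarrow> ('n form \<Rightarrow> complex) set topology" where
  "H_A_current_topology X =
     quot_topology (subtopology (current_topology X 1 1) (A_current_cocycles X))
       (A_current_coboundaries X)"

text \<open>
  The topology of the cohomology of compactly supported currents, transported along the
  natural map \<open>[\<alpha>] \<mapsto> [T\<^sub>\<alpha>]\<close>.  For a class \<open>c = \<alpha> + A_coboundaries X\<close>, the set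
  \<open>form_current X 1 1 ` c + A_current_coboundaries X\<close> is the class of \<open>T\<^sub>\<alpha>\<close>.
\<close>

definition H_A_c_topology :: "(complex ^ 'n::{finite,linorder}) set \<Rightarrow> 'n form set topology" where
  "H_A_c_topology X =
     pullback_topology (carr (H_A_c X))
       (\<lambda>c. form_current X 1 1 ` c + A_current_coboundaries X)
       (H_A_current_topology X)"

end

theory Submission
  imports Defs "HOL-Complex_Analysis.Conformal_Mappings" "HOL-Computational_Algebra.Polynomial"
begin

text \<open>
  The two cohomology spaces have very different sizes: \<open>H_A_c X\<close> has dimension at most one, while
  \<open>H_BC X\<close> contains any number of independent classes.  A space of dimension at most one has, for
  every topology, a dual of dimension at most one (\<open>not_isomorphic_to_dual\<close>), so \<open>H_BC X\<close> is not the
  dual of \<open>H_A_c X\<close>, whatever happens in the other direction.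

  \<^emph>\<open>Aeppli side.\<close>  Let \<open>\<alpha>\<close> be a compactly supported \<open>(1,1)\<close>-form with \<open>\<partial>\<partial>\<bar>\<alpha> = 0\<close>.  The line \<open>L\<close> is
  connected to infinity, so holomorphic functions have no first cohomology with compact supports in
  \<open>X\<close> (\<open>dbar_compact\<close>, proved with the Cauchy transform \<open>cauchy_dbar\<close> and the identity theorem).
  Applied to \<open>\<partial>\<alpha>\<close> and, after conjugation, to \<open>\<partial>\<bar>\<alpha>\<close>, this completes \<open>\<alpha>\<close> by terms of bidegree \<open>(2,0)\<close> and
  \<open>(0,2)\<close> to a closed form with compact support, and \<open>\<alpha>\<close> is a coboundary as soon as this form is
  exact with compact support.  But \<open>X\<close> is \<open>\<real> \<times> (\<real>\<^sup>3 - {0})\<close>, and its second de Rham cohomology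
  with compact support has dimension one; the single obstruction is an explicit integral, the \<open>period\<close> of
  \<open>\<alpha>\<close> (\<open>aeppli_exact\<close>, \<open>A_exact_if_period_zero\<close>).

  \<^emph>\<open>Bott-Chern side.\<close>  For a point \<open>c\<close> of \<open>L\<close>, applying \<open>\<partial>\<close> to the Bochner-Martinelli form centred at \<open>c\<close>
  gives a closed \<open>(1,1)\<close>-form on \<open>X\<close> that is singular at \<open>c\<close> only (\<open>bm_cocycle\<close>).  Forms with distinct centres
  are independent modulo \<open>\<partial>\<partial>\<bar>\<close>-exact ones (\<open>bm_combination_not_exact\<close>).  Continuous
  functionals cannot separate these classes, since they come from the other, small cohomology.  What does
  separate them is the behaviour of a family of functionals: over a slice \<open>z\<^sub>1 = const\<close> off the line, which is a full
  complex plane, the integral of the \<open>(2,2)\<close>-coefficient of \<open>\<partial>\<partial>\<bar>F\<close> against a test function of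
  \<open>z\<^sub>2\<close> that is harmonic near \<open>0\<close> stays bounded as the slice approaches \<open>L\<close>, whereas for the
  form centred at \<open>c\<close> it blows up at \<open>c\<close>.
\<close>

section \<open>Calculus of smooth functions\<close>

abbreviation Der :: "'a::real_normed_vector \<Rightarrow> ('a \<Rightarrow> complex) \<Rightarrow> 'a \<Rightarrow> complex" where
  "Der v f \<equiv> (\<lambda>x. frechet_derivative f (at x) v)"

lemma Der_eqI: "(f has_derivative f') (at x) \<Longrightarrow> Der v f x = f' v"
  by (metis frechet_derivative_at)

lemma Der_cong_open:
  assumes "open X" "x \<in> X" "\<And>y. y \<in> X \<Longrightarrow> f y = g y"
  shows "Der v f x = Der v g x"
proof -
  have "(f has_derivative D) (at x) \<longleftrightarrow> (g has_derivative D) (at x)" for D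
    using has_derivative_transform_within_open[of f D x UNIV X g]
      has_derivative_transform_within_open[of g D x UNIV X f] assms by auto
  then show ?thesis by (simp add: frechet_derivative_def)
qed

lemma differentiable_cong_open:
  assumes "open X" "x \<in> X" "\<And>y. y \<in> X \<Longrightarrow> f y = g y" "f differentiable (at x)"
  shows "g differentiable (at x)"
  using assms has_derivative_transform_within_open[of f _ x UNIV X g]
  unfolding differentiable_def by blast

lemma iter_deriv_append: "iter_deriv (vs @ ws) f = iter_deriv vs (iter_deriv ws f)"
  by (induction vs) auto

lemma smooth_on_Der: "smooth_on X f \<Longrightarrow> smooth_on X (Der v f)"
proof -
  assume f: "smooth_on X f"
  have "iter_deriv (vs @ [v]) f = iter_deriv vs (Der v f)" for vs
    by (simp add: iter_deriv_append)
  then show ?thesis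
    using f unfolding smooth_on_def by metis
qed

lemma smooth_on_differentiable: "smooth_on X f \<Longrightarrow> x \<in> X \<Longrightarrow> f differentiable (at x)"
  unfolding smooth_on_def by (metis iter_deriv.simps(1))

lemma smooth_on_has_derivative:
  "smooth_on X f \<Longrightarrow> x \<in> X \<Longrightarrow> (f has_derivative (\<lambda>v. Der v f x)) (at x)"
  using smooth_on_differentiable[of X f x] unfolding frechet_derivative_works by simp

lemma smooth_on_continuous_on: "smooth_on X f \<Longrightarrow> continuous_on X f"
  by (meson continuous_at_imp_continuous_on differentiable_imp_continuous_within smooth_on_differentiable)

lemma smooth_on_subset: "smooth_on X f \<Longrightarrow> Y \<subseteq> X \<Longrightarrow> smooth_on Y f"
  unfolding smooth_on_def by blast

lemma iter_deriv_cong_open: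
  assumes "open X" "\<And>y. y \<in> X \<Longrightarrow> f y = g y"
  shows "x \<in> X \<Longrightarrow> iter_deriv vs f x = iter_deriv vs g x"
proof (induction vs arbitrary: x)
  case (Cons v vs)
  then show ?case using Der_cong_open[OF assms(1) Cons.prems Cons.IH] by simp
qed (use assms in auto)

lemma smooth_on_cong:
  assumes "open X" "\<And>y. y \<in> X \<Longrightarrow> f y = g y" "smooth_on X f"
  shows "smooth_on X g"
  unfolding smooth_on_def
proof (intro allI ballI)
  fix vs x assume "x \<in> X"
  then show "iter_deriv vs g differentiable at x"
    using differentiable_cong_open[OF assms(1), of x "iter_deriv vs f" "iter_deriv vs g"]
      iter_deriv_cong_open[of X f g _ vs] assms unfolding smooth_on_def by blast
qed

lemma smooth_on_local:
  assumes "open X" "\<And>x. x \<in> X \<Longrightarrow> \<exists>U. open U \<and> x \<in> U \<and> smooth_on U f"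
  shows "smooth_on X f"
  using assms(2) unfolding smooth_on_def by blast

text \<open>
  Smoothness is the greatest property that implies differentiability and passes to directional
  derivatives, so it is proved by exhibiting a class of functions closed under derivation.
\<close>

lemma smooth_on_coinduct:
  assumes X: "open X" and P: "P f"
    and diff: "\<And>g x. P g \<Longrightarrow> x \<in> X \<Longrightarrow> g differentiable (at x)"
    and step: "\<And>g v. P g \<Longrightarrow> \<exists>h. P h \<and> (\<forall>x\<in>X. Der v g x = h x)"
  shows "smooth_on X f"
proof -
  have *: "\<exists>h. P h \<and> (\<forall>x\<in>X. iter_deriv vs f x = h x)" for vs
  proof (induction vs)
    case Nil then show ?case using P by auto
  next
    case (Cons v vs)
    then obtain h where h: "P h" "\<forall>x\<in>X. iter_deriv vs f x = h x" by blast
    obtain k where "P k" "\<forall>x\<in>X. Der v h x = k x" using step[OF h(1)] by blast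
    moreover have "Der v (iter_deriv vs f) x = Der v h x" if "x \<in> X" for x
      using Der_cong_open[OF X that] h(2) by blast
    ultimately show ?case by auto
  qed
  show ?thesis
    unfolding smooth_on_def
  proof (intro allI ballI)
    fix vs x assume x: "x \<in> X"
    obtain h where h: "P h" "\<forall>x\<in>X. iter_deriv vs f x = h x"
      using * by blast
    then show "iter_deriv vs f differentiable at x"
      using differentiable_cong_open[OF X x, of h "iter_deriv vs f"] diff[OF h(1) x] by auto
  qed
qed

text \<open>
  The product rule turns one product into a sum of products, so neither products nor inverses of
  smooth functions form by themselves a class closed under derivation.  The class generated by
  all these operations together is closed, because the rules for derivatives stay inside it.
\<close>

inductive smooth_gen :: "'a::real_normed_vector set \<Rightarrow> ('a \<Rightarrow> complex) \<Rightarrow> bool" for X where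
  base: "smooth_on X f \<Longrightarrow> smooth_gen X f"
| plus: "smooth_gen X f \<Longrightarrow> smooth_gen X g \<Longrightarrow> smooth_gen X (\<lambda>x. f x + g x)"
| times: "smooth_gen X f \<Longrightarrow> smooth_gen X g \<Longrightarrow> smooth_gen X (\<lambda>x. f x * g x)"
| inv: "smooth_gen X f \<Longrightarrow> (\<And>x. x \<in> X \<Longrightarrow> f x \<noteq> 0) \<Longrightarrow> smooth_gen X (\<lambda>x. inverse (f x))"
| conj: "smooth_gen X f \<Longrightarrow> smooth_gen X (\<lambda>x. cnj (f x))"

lemma Der_add:
  "f differentiable (at x) \<Longrightarrow> g differentiable (at x) \<Longrightarrow> Der v (\<lambda>x. f x + g x) x = Der v f x + Der v g x"
  by (rule Der_eqI[OF has_derivative_add]) (auto simp: frechet_derivative_works[symmetric])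

lemma Der_mult:
  "f differentiable (at x) \<Longrightarrow> g differentiable (at x) \<Longrightarrow>
    Der v (\<lambda>x. f x * g x) x = f x * Der v g x + Der v f x * g x"
  by (rule Der_eqI[OF has_derivative_mult]) (auto simp: frechet_derivative_works[symmetric])

lemma Der_inverse:
  "f differentiable (at x) \<Longrightarrow> f x \<noteq> 0 \<Longrightarrow>
    Der v (\<lambda>x. inverse (f x)) x = - (inverse (f x) * Der v f x * inverse (f x))"
  by (rule Der_eqI[OF Deriv.has_derivative_inverse]) (auto simp: frechet_derivative_works[symmetric])

lemma Der_cnj:
  "f differentiable (at x) \<Longrightarrow> Der v (\<lambda>x. cnj (f x)) x = cnj (Der v f x)"
  by (rule Der_eqI[OF has_derivative_cnj]) (auto simp: frechet_derivative_works[symmetric])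

lemma Der_const [simp]: "Der v (\<lambda>x. c) x = 0"
  by (rule Der_eqI) auto

lemma differentiable_cnj:
  "f differentiable (at x) \<Longrightarrow> (\<lambda>x. cnj (f x)) differentiable (at x)"
  unfolding differentiable_def using has_derivative_cnj by blast

lemma smooth_on_const [simp, intro]: "open X \<Longrightarrow> smooth_on X (\<lambda>x. c)"
  by (rule smooth_on_coinduct[where P = "\<lambda>f. \<exists>c. f = (\<lambda>x. c)"]) auto

lemma smooth_gen_imp:
  assumes X: "open X" and f: "smooth_gen X f"
  shows "(\<forall>x\<in>X. f differentiable (at x)) \<and> (\<forall>v. \<exists>h. smooth_gen X h \<and> (\<forall>x\<in>X. Der v f x = h x))"
  using f
proof (induction rule: smooth_gen.induct)
  case (base f)
  then show ?case
    using smooth_gen.base[OF smooth_on_Der[OF base]] smooth_on_differentiable[OF base] by blast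
next
  case (plus f g)
  show ?case
  proof (intro conjI allI ballI)
    fix v
    obtain h k where "smooth_gen X h" "\<forall>x\<in>X. Der v f x = h x" "smooth_gen X k" "\<forall>x\<in>X. Der v g x = k x"
      using plus by meson
    then show "\<exists>h. smooth_gen X h \<and> (\<forall>x\<in>X. Der v (\<lambda>x. f x + g x) x = h x)"
      using plus by (intro exI[of _ "\<lambda>x. h x + k x"]) (auto simp: Der_add intro: smooth_gen.plus)
  qed (use plus in auto)
next
  case (times f g)
  show ?case
  proof (intro conjI allI ballI)
    fix v
    obtain h k where "smooth_gen X h" "\<forall>x\<in>X. Der v f x = h x" "smooth_gen X k" "\<forall>x\<in>X. Der v g x = k x"
      using times by meson
    then show "\<exists>h. smooth_gen X h \<and> (\<forall>x\<in>X. Der v (\<lambda>x. f x * g x) x = h x)"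
      using times by (intro exI[of _ "\<lambda>x. f x * k x + h x * g x"])
        (auto simp: Der_mult intro!: smooth_gen.plus smooth_gen.times)
  qed (use times in auto)
next
  case (inv f)
  show ?case
  proof (intro conjI allI ballI)
    fix v
    obtain h where h: "smooth_gen X h" "\<forall>x\<in>X. Der v f x = h x"
      using inv by meson
    have "smooth_gen X (\<lambda>x. -1)"
      by (rule smooth_gen.base) (simp add: smooth_on_const[OF X])
    then have "smooth_gen X (\<lambda>x. (- 1) * (inverse (f x) * h x * inverse (f x)))"
      using h inv by (intro smooth_gen.times) (auto intro: smooth_gen.inv)
    then show "\<exists>h. smooth_gen X h \<and> (\<forall>x\<in>X. Der v (\<lambda>x. inverse (f x)) x = h x)"
      using inv h by (intro exI[of _ "\<lambda>x. (- 1) * (inverse (f x) * h x * inverse (f x))"])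
        (auto simp: Der_inverse)
  qed (use inv in auto)
next
  case (conj f)
  show ?case
  proof (intro conjI allI ballI)
    fix v
    obtain h where "smooth_gen X h" "\<forall>x\<in>X. Der v f x = h x"
      using conj by meson
    then show "\<exists>h. smooth_gen X h \<and> (\<forall>x\<in>X. Der v (\<lambda>x. cnj (f x)) x = h x)"
      using conj by (intro exI[of _ "\<lambda>x. cnj (h x)"]) (auto simp: Der_cnj intro!: smooth_gen.conj)
  qed (use conj in \<open>auto intro: differentiable_cnj\<close>)
qed

lemma smooth_gen_smooth: "open X \<Longrightarrow> smooth_gen X f \<Longrightarrow> smooth_on X f"
  by (rule smooth_on_coinduct[where P = "smooth_gen X"]) (use smooth_gen_imp in blast)+

lemma smooth_on_linear:
  assumes X: "open X" and f: "bounded_linear f"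
  shows "smooth_on X f"
proof (rule smooth_on_coinduct[OF X, where P = "\<lambda>g. g = f \<or> (\<exists>c. g = (\<lambda>x. c))"])
  have d: "(f has_derivative f) (at x)" for x
    using f by (rule bounded_linear_imp_has_derivative)
  fix g
  assume g: "g = f \<or> (\<exists>c. g = (\<lambda>x. c))"
  show "g differentiable (at x)" for x
    using g d by (auto intro: differentiableI)
  show "\<exists>h. (h = f \<or> (\<exists>c. h = (\<lambda>x. c))) \<and> (\<forall>x\<in>X. Der v g x = h x)" for v
    using g Der_eqI[OF d] by (intro exI[of _ "\<lambda>x. if g = f then f v else 0"]) auto
qed auto

lemma smooth_on_add [intro]:
  "open X \<Longrightarrow> smooth_on X f \<Longrightarrow> smooth_on X g \<Longrightarrow> smooth_on X (\<lambda>x. f x + g x)"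
  by (rule smooth_gen_smooth, assumption, rule smooth_gen.plus) (auto intro: smooth_gen.base)

lemma smooth_on_mult [intro]:
  "open X \<Longrightarrow> smooth_on X f \<Longrightarrow> smooth_on X g \<Longrightarrow> smooth_on X (\<lambda>x. f x * g x)"
  by (rule smooth_gen_smooth, assumption, rule smooth_gen.times) (auto intro: smooth_gen.base)

lemma smooth_on_cnj [intro]:
  "open X \<Longrightarrow> smooth_on X f \<Longrightarrow> smooth_on X (\<lambda>x. cnj (f x))"
  by (rule smooth_gen_smooth, assumption, rule smooth_gen.conj) (auto intro: smooth_gen.base)

lemma smooth_on_inverse [intro]:
  "open X \<Longrightarrow> smooth_on X f \<Longrightarrow> (\<And>x. x \<in> X \<Longrightarrow> f x \<noteq> 0) \<Longrightarrow> smooth_on X (\<lambda>x. inverse (f x))"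
  by (rule smooth_gen_smooth, assumption, rule smooth_gen.inv) (auto intro: smooth_gen.base)

lemma smooth_on_minus [intro]: "open X \<Longrightarrow> smooth_on X f \<Longrightarrow> smooth_on X (\<lambda>x. - f x)"
  using smooth_on_mult[OF _ smooth_on_const, of X f "- 1"] by simp

lemma smooth_on_diff [intro]:
  "open X \<Longrightarrow> smooth_on X f \<Longrightarrow> smooth_on X g \<Longrightarrow> smooth_on X (\<lambda>x. f x - g x)"
  using smooth_on_add[of X f "\<lambda>x. - g x"] by auto

lemma smooth_on_power [intro]:
  "open X \<Longrightarrow> smooth_on X f \<Longrightarrow> smooth_on X (\<lambda>x. f x ^ n)"
  by (induction n) auto

text \<open>
  Two applications of the mean value theorem, first along \<open>v\<close> and then along \<open>w\<close>.  The left-hand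
  side is symmetric in \<open>v\<close> and \<open>w\<close>, which is what makes mixed derivatives agree in the limit.
\<close>

lemma second_difference:
  fixes f g h :: "'a::real_normed_vector \<Rightarrow> real"
  assumes B: "\<And>s t. \<lbrakk>0 \<le> s; s \<le> e; 0 \<le> t; t \<le> e\<rbrakk> \<Longrightarrow> x + s *\<^sub>R v + t *\<^sub>R w \<in> U"
    and e: "0 < e"
    and f: "\<And>y. y \<in> U \<Longrightarrow> \<exists>D. (f has_derivative D) (at y) \<and> D v = g y"
    and g: "\<And>y. y \<in> U \<Longrightarrow> \<exists>D. (g has_derivative D) (at y) \<and> D w = h y"
  shows "\<exists>s t. 0 < s \<and> s < e \<and> 0 < t \<and> t < e \<and>
     f (x + e *\<^sub>R v + e *\<^sub>R w) - f (x + e *\<^sub>R v) - f (x + e *\<^sub>R w) + f x = e * e * h (x + s *\<^sub>R v + t *\<^sub>R w)"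
proof -
  have df: "((\<lambda>s. f (x + s *\<^sub>R v + t *\<^sub>R w)) has_real_derivative g (x + s *\<^sub>R v + t *\<^sub>R w)) (at s)"
    if st: "0 \<le> s" "s \<le> e" "0 \<le> t" "t \<le> e" for s t
  proof -
    obtain D where D: "(f has_derivative D) (at (x + s *\<^sub>R v + t *\<^sub>R w))" "D v = g (x + s *\<^sub>R v + t *\<^sub>R w)"
      using f[OF B[OF st]] by blast
    have "((\<lambda>s. x + s *\<^sub>R v + t *\<^sub>R w) has_derivative (\<lambda>r. r *\<^sub>R v)) (at s)"
      by (auto intro!: derivative_eq_intros)
    from has_derivative_compose[OF this D(1)]
    have "((\<lambda>s. f (x + s *\<^sub>R v + t *\<^sub>R w)) has_derivative (\<lambda>r. D (r *\<^sub>R v))) (at s)" .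
    moreover have "D (r *\<^sub>R v) = g (x + s *\<^sub>R v + t *\<^sub>R w) * r" for r
      using linear_cmul[OF has_derivative_linear[OF D(1)]] D(2) by simp
    ultimately show ?thesis by (simp add: has_field_derivative_def)
  qed
  have dg: "((\<lambda>t. g (x + s *\<^sub>R v + t *\<^sub>R w)) has_real_derivative h (x + s *\<^sub>R v + t *\<^sub>R w)) (at t)"
    if st: "0 \<le> s" "s \<le> e" "0 \<le> t" "t \<le> e" for s t
  proof -
    obtain D where D: "(g has_derivative D) (at (x + s *\<^sub>R v + t *\<^sub>R w))" "D w = h (x + s *\<^sub>R v + t *\<^sub>R w)"
      using g[OF B[OF st]] by blast
    have "((\<lambda>t. x + s *\<^sub>R v + t *\<^sub>R w) has_derivative (\<lambda>r. r *\<^sub>R w)) (at t)"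
      by (auto intro!: derivative_eq_intros)
    from has_derivative_compose[OF this D(1)]
    have "((\<lambda>t. g (x + s *\<^sub>R v + t *\<^sub>R w)) has_derivative (\<lambda>r. D (r *\<^sub>R w))) (at t)" .
    moreover have "D (r *\<^sub>R w) = h (x + s *\<^sub>R v + t *\<^sub>R w) * r" for r
      using linear_cmul[OF has_derivative_linear[OF D(1)]] D(2) by simp
    ultimately show ?thesis by (simp add: has_field_derivative_def)
  qed
  define \<phi> where "\<phi> s = f (x + s *\<^sub>R v + e *\<^sub>R w) - f (x + s *\<^sub>R v + 0 *\<^sub>R w)" for s
  have "(\<phi> has_real_derivative (g (x + s *\<^sub>R v + e *\<^sub>R w) - g (x + s *\<^sub>R v + 0 *\<^sub>R w))) (at s)"
    if "0 \<le> s" "s \<le> e" for s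
    unfolding \<phi>_def by (rule DERIV_diff[OF df df]) (use that e in auto)
  from MVT2[OF e this] obtain s where s: "0 < s" "s < e"
    "\<phi> e - \<phi> 0 = e * (g (x + s *\<^sub>R v + e *\<^sub>R w) - g (x + s *\<^sub>R v + 0 *\<^sub>R w))" by auto
  obtain t where t: "0 < t" "t < e"
    "g (x + s *\<^sub>R v + e *\<^sub>R w) - g (x + s *\<^sub>R v + 0 *\<^sub>R w) = e * h (x + s *\<^sub>R v + t *\<^sub>R w)"
    using MVT2[OF e dg, of s] s by auto
  show ?thesis
    using s t by (intro exI[of _ s] exI[of _ t]) (simp add: \<phi>_def algebra_simps)
qed

lemma schwarz_real:
  fixes f g h g' h' :: "'a::real_normed_vector \<Rightarrow> real"
  assumes X: "open X" "x \<in> X"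
    and f: "\<And>y. y \<in> X \<Longrightarrow> \<exists>D. (f has_derivative D) (at y) \<and> D v = g y \<and> D w = g' y"
    and g: "\<And>y. y \<in> X \<Longrightarrow> \<exists>D. (g has_derivative D) (at y) \<and> D w = h y"
    and g': "\<And>y. y \<in> X \<Longrightarrow> \<exists>D. (g' has_derivative D) (at y) \<and> D v = h' y"
    and c: "isCont h x" "isCont h' x"
  shows "h x = h' x"
proof (rule ccontr)
  assume ne: "h x \<noteq> h' x"
  define d where "d = \<bar>h x - h' x\<bar> / 2"
  have d: "d > 0" using ne by (simp add: d_def)
  obtain r where r: "r > 0" "ball x r \<subseteq> X" using X openE by blast
  obtain r1 where r1: "r1 > 0" "\<And>y. dist y x < r1 \<Longrightarrow> dist (h y) (h x) < d"
    using c(1) d unfolding continuous_at_eps_delta by (metis)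
  obtain r2 where r2: "r2 > 0" "\<And>y. dist y x < r2 \<Longrightarrow> dist (h' y) (h' x) < d"
    using c(2) d unfolding continuous_at_eps_delta by (metis)
  define \<rho> where "\<rho> = Min {r, r1, r2}"
  have \<rho>: "\<rho> > 0" "\<rho> \<le> r" "\<rho> \<le> r1" "\<rho> \<le> r2" using r r1 r2 by (auto simp: \<rho>_def)
  define e where "e = \<rho> / (2 * (norm v + norm w + 1))"
  have nn: "norm v + norm w + 1 > 0" by (smt (verit) norm_ge_zero)
  have e: "e > 0" using \<rho> nn by (simp add: e_def)
  have eb: "e * (norm v + norm w) < \<rho>"
  proof -
    have "e * (norm v + norm w) \<le> e * (norm v + norm w + 1)" using e by simp
    also have "\<dots> = \<rho> / 2" using nn unfolding e_def by (simp add: divide_simps)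
    finally show ?thesis using \<rho> by simp
  qed
  have near: "dist (x + s *\<^sub>R v + t *\<^sub>R w) x < \<rho>" if "0 \<le> s" "s \<le> e" "0 \<le> t" "t \<le> e" for s t
  proof -
    have "norm (s *\<^sub>R v + t *\<^sub>R w) \<le> s * norm v + t * norm w"
      using norm_triangle_ineq[of "s *\<^sub>R v" "t *\<^sub>R w"] that by simp
    also have "\<dots> \<le> e * norm v + e * norm w" using that by (intro add_mono mult_right_mono) auto
    finally show ?thesis using eb by (simp add: dist_norm algebra_simps)
  qed
  have near': "dist (x + t *\<^sub>R w + s *\<^sub>R v) x < \<rho>" if "0 \<le> s" "s \<le> e" "0 \<le> t" "t \<le> e" for s t
    using near[OF that] by (simp add: algebra_simps)
  have inX: "y \<in> X" if "y \<in> ball x \<rho>" for y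
    using that r \<rho> by (auto simp: subset_iff)
  have "\<exists>s t. 0 < s \<and> s < e \<and> 0 < t \<and> t < e \<and>
     f (x + e *\<^sub>R v + e *\<^sub>R w) - f (x + e *\<^sub>R v) - f (x + e *\<^sub>R w) + f x = e * e * h (x + s *\<^sub>R v + t *\<^sub>R w)"
  proof (rule second_difference[where U = "ball x \<rho>" and g = g])
    fix y assume y: "y \<in> ball x \<rho>"
    show "\<exists>D. (f has_derivative D) (at y) \<and> D v = g y" using f[OF inX[OF y]] by blast
    show "\<exists>D. (g has_derivative D) (at y) \<and> D w = h y" using g[OF inX[OF y]] by blast
  qed (use near e in \<open>auto simp: dist_commute\<close>)
  then obtain s t where st: "0 < s" "s < e" "0 < t" "t < e"
     "f (x + e *\<^sub>R v + e *\<^sub>R w) - f (x + e *\<^sub>R v) - f (x + e *\<^sub>R w) + f x = e * e * h (x + s *\<^sub>R v + t *\<^sub>R w)"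
    by blast
  have "\<exists>s t. 0 < s \<and> s < e \<and> 0 < t \<and> t < e \<and>
     f (x + e *\<^sub>R w + e *\<^sub>R v) - f (x + e *\<^sub>R w) - f (x + e *\<^sub>R v) + f x = e * e * h' (x + s *\<^sub>R w + t *\<^sub>R v)"
  proof (rule second_difference[where U = "ball x \<rho>" and g = g'])
    fix y assume y: "y \<in> ball x \<rho>"
    show "\<exists>D. (f has_derivative D) (at y) \<and> D w = g' y" using f[OF inX[OF y]] by blast
    show "\<exists>D. (g' has_derivative D) (at y) \<and> D v = h' y" using g'[OF inX[OF y]] by blast
  qed (use near' e in \<open>auto simp: dist_commute\<close>)
  then obtain s' t' where st': "0 < s'" "s' < e" "0 < t'" "t' < e"
     "f (x + e *\<^sub>R w + e *\<^sub>R v) - f (x + e *\<^sub>R w) - f (x + e *\<^sub>R v) + f x = e * e * h' (x + s' *\<^sub>R w + t' *\<^sub>R v)"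
    by blast
  have "e * e * h (x + s *\<^sub>R v + t *\<^sub>R w) = e * e * h' (x + s' *\<^sub>R w + t' *\<^sub>R v)"
    unfolding st(5)[symmetric] st'(5)[symmetric] by (simp add: algebra_simps)
  then have "h (x + s *\<^sub>R v + t *\<^sub>R w) = h' (x + s' *\<^sub>R w + t' *\<^sub>R v)" using e by simp
  moreover have "dist (h (x + s *\<^sub>R v + t *\<^sub>R w)) (h x) < d"
    using near[of s t] st \<rho> by (intro r1) auto
  moreover have "dist (h' (x + s' *\<^sub>R w + t' *\<^sub>R v)) (h' x) < d"
    using near'[of t' s'] st' \<rho> by (intro r2) auto
  ultimately show False unfolding d_def dist_real_def by (smt (verit) field_sum_of_halves)
qed

lemma Der_commute:
  assumes X: "open X" "x \<in> X" and f: "smooth_on X f"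
  shows "Der v (Der w f) x = Der w (Der v f) x"
proof -
  have d: "((\<lambda>y. L (F y)) has_derivative (\<lambda>u. L (Der u F y))) (at y)"
    if "bounded_linear L" "smooth_on X F" "y \<in> X" for L :: "complex \<Rightarrow> real" and F y
    using bounded_linear.has_derivative[OF that(1) smooth_on_has_derivative[OF that(2,3)]] .
  have "L (Der w (Der v f) x) = L (Der v (Der w f) x)" if L: "bounded_linear L" for L :: "complex \<Rightarrow> real"
  proof (rule schwarz_real[OF X, where f = "\<lambda>y. L (f y)" and g = "\<lambda>y. L (Der v f y)" and g' = "\<lambda>y. L (Der w f y)"])
    note D = d[OF L f] d[OF L smooth_on_Der[OF f]]
    show "\<exists>D. ((\<lambda>y. L (f y)) has_derivative D) (at y) \<and> D v = L (Der v f y) \<and> D w = L (Der w f y)"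
      if "y \<in> X" for y
      by (intro exI conjI, rule d[OF L f that]) auto
    show "\<exists>D. ((\<lambda>y. L (Der v f y)) has_derivative D) (at y) \<and> D w = L (Der w (Der v f) y)"
      if "y \<in> X" for y
      by (intro exI conjI, rule d[OF L smooth_on_Der[OF f] that]) auto
    show "\<exists>D. ((\<lambda>y. L (Der w f y)) has_derivative D) (at y) \<and> D v = L (Der v (Der w f) y)"
      if "y \<in> X" for y
      by (intro exI conjI, rule d[OF L smooth_on_Der[OF f] that]) auto
    have "isCont (Der a (Der b f)) x" for a b
      using smooth_on_differentiable[OF smooth_on_Der[OF smooth_on_Der[OF f]] X(2)]
      by (rule differentiable_imp_continuous_within)
    then show "isCont (\<lambda>y. L (Der w (Der v f) y)) x" "isCont (\<lambda>y. L (Der v (Der w f) y)) x"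
      by (auto intro: bounded_linear.isCont[OF L])
  qed
  from this[OF bounded_linear_Re] this[OF bounded_linear_Im] show ?thesis
    by (simp add: complex_eq_iff)
qed

section \<open>Convolution with locally integrable kernels\<close>

definition csmooth :: "('a::euclidean_space \<Rightarrow> complex) \<Rightarrow> bool" where
  "csmooth f \<longleftrightarrow> smooth_on UNIV f \<and> (\<exists>R. \<forall>x. R < norm x \<longrightarrow> f x = 0)"

lemma Der_zero_open:
  assumes "open U" "x \<in> U" "\<And>y. y \<in> U \<Longrightarrow> f y = 0"
  shows "Der v f x = 0"
  using Der_cong_open[OF assms(1,2), of f "\<lambda>x. 0" v] assms(3) by simp

lemma csmooth_smooth: "csmooth f \<Longrightarrow> smooth_on UNIV f"
  by (simp add: csmooth_def)

lemma csmooth_differentiable: "csmooth f \<Longrightarrow> f differentiable (at x)"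
  using smooth_on_differentiable[of UNIV f x] by (simp add: csmooth_def)

lemma csmooth_has_derivative: "csmooth f \<Longrightarrow> (f has_derivative (\<lambda>v. Der v f x)) (at x)"
  using smooth_on_has_derivative[of UNIV f x] by (simp add: csmooth_def)

lemma csmooth_continuous: "csmooth f \<Longrightarrow> continuous_on UNIV f"
  using smooth_on_continuous_on[of UNIV f] by (simp add: csmooth_def)

lemma csmooth_measurable: "csmooth f \<Longrightarrow> f \<in> borel_measurable borel"
  by (intro borel_measurable_continuous_onI csmooth_continuous)

lemma csmooth_Der: "csmooth f \<Longrightarrow> csmooth (Der v f)"
proof -
  assume f: "csmooth f"
  then obtain R where R: "\<And>x. R < norm x \<Longrightarrow> f x = 0" by (auto simp: csmooth_def)
  have "open {x::'a. R < norm x}" by (intro open_Collect_less continuous_intros)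
  then have "Der v f x = 0" if "R < norm x" for x
    using Der_zero_open[of "{x. R < norm x}" x f v] R that by simp
  then show "csmooth (Der v f)"
    using smooth_on_Der[of UNIV f v] f unfolding csmooth_def by blast
qed

lemma csmooth_mult_right: "csmooth f \<Longrightarrow> smooth_on UNIV g \<Longrightarrow> csmooth (\<lambda>x. g x * f x)"
  using smooth_on_mult[of UNIV g f] unfolding csmooth_def by fastforce

lemma csmooth_cmult: "csmooth f \<Longrightarrow> csmooth (\<lambda>x. c * f x)"
  using csmooth_mult_right[of f "\<lambda>x. c"] smooth_on_const[of UNIV c] by simp

lemma csmooth_add: "csmooth f \<Longrightarrow> csmooth g \<Longrightarrow> csmooth (\<lambda>x. f x + g x)"
proof -
  assume f: "csmooth f" and g: "csmooth g"
  obtain R S where R: "\<And>x. R < norm x \<Longrightarrow> f x = 0" and S: "\<And>x. S < norm x \<Longrightarrow> g x = 0"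
    using f g unfolding csmooth_def by blast
  have "f x + g x = 0" if "max R S < norm x" for x
    using that R[of x] S[of x] by simp
  then show "csmooth (\<lambda>x. f x + g x)"
    using smooth_on_add[of UNIV f g] f g unfolding csmooth_def by blast
qed

lemma csmooth_bounded:
  assumes f: "csmooth f"
  shows "\<exists>B\<ge>0. \<forall>x. norm (f x) \<le> B"
proof -
  obtain R where R: "\<And>x. R < norm x \<Longrightarrow> f x = 0" using f by (auto simp: csmooth_def)
  have "compact (f ` cball 0 R)"
    by (intro compact_continuous_image continuous_on_subset[OF csmooth_continuous[OF f]]) auto
  then have "bounded (f ` cball 0 R)" by (rule compact_imp_bounded)
  then obtain B where B: "\<And>x. x \<in> cball 0 R \<Longrightarrow> norm (f x) \<le> B"
    unfolding bounded_iff by blast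
  have "norm (f x) \<le> max B 0" for x
    using B[of x] R[of x] by (cases "norm x \<le> R") auto
  then show ?thesis by (intro exI[of _ "max B 0"]) auto
qed

lemma csmooth_integrable:
  assumes f: "csmooth f" shows "integrable lborel f"
proof -
  obtain T where T: "\<And>p. T < norm p \<Longrightarrow> f p = 0" using f by (auto simp: csmooth_def)
  have "integrable lborel (\<lambda>p. indicator (cball 0 T) p *\<^sub>R f p)"
    by (rule borel_integrable_compact) (auto intro: continuous_on_subset[OF csmooth_continuous[OF f]])
  also have "(\<lambda>p. indicator (cball 0 T) p *\<^sub>R f p) = f"
    using T by (auto simp: indicator_def fun_eq_iff not_le)
  finally show ?thesis .
qed

lemma Der_linear:
  assumes "f differentiable (at x)"
  shows "Der (v + w) f x = Der v f x + Der w f x" "Der (c *\<^sub>R v) f x = c *\<^sub>R Der v f x"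
  using linear_add[OF linear_frechet_derivative[OF assms]] linear_scale[OF linear_frechet_derivative[OF assms]] by auto

lemma Der_le_basis:
  fixes f :: "'a::euclidean_space \<Rightarrow> complex"
  assumes "linear L" and B: "\<And>b. b \<in> Basis \<Longrightarrow> norm (L b) \<le> B b"
  shows "norm (L v :: complex) \<le> (\<Sum>b\<in>(Basis::'a set). B b) * norm v"
proof -
  have "L v = (\<Sum>b\<in>Basis. (v \<bullet> b) *\<^sub>R L b)"
    using linear_sum[OF assms(1), of "\<lambda>b. (v \<bullet> b) *\<^sub>R b" Basis] linear_scale[OF assms(1)]
    by (simp add: euclidean_representation)
  also have "norm \<dots> \<le> (\<Sum>b\<in>Basis. norm v * B b)"
  proof (intro sum_norm_le)
    fix b :: 'a assume b: "b \<in> Basis"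
    have "\<bar>v \<bullet> b\<bar> \<le> norm v" using Basis_le_norm[OF b] .
    then show "norm ((v \<bullet> b) *\<^sub>R L b) \<le> norm v * B b"
      using B[OF b] by (simp add: mult_mono)
  qed
  finally show ?thesis by (simp add: sum_distrib_left mult.commute)
qed

lemma csmooth_lipschitz:
  fixes f :: "'a::euclidean_space \<Rightarrow> complex"
  assumes f: "csmooth f"
  shows "\<exists>C\<ge>0. \<forall>x y. norm (f x - f y) \<le> C * norm (x - y)"
proof -
  have "\<exists>B\<ge>0. \<forall>x. norm (Der b f x) \<le> B" for b
    using csmooth_bounded[OF csmooth_Der[OF f]] .
  then obtain B where B: "\<And>b. B b \<ge> 0" "\<And>b x. norm (Der b f x) \<le> B b" by metis
  have "norm (Der v f x) \<le> (\<Sum>b\<in>Basis. B b) * norm v" for v x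
    by (rule Der_le_basis[OF linear_frechet_derivative[OF csmooth_differentiable[OF f]]]) (rule B)
  then have "onorm (\<lambda>v. Der v f x) \<le> (\<Sum>b\<in>Basis. B b)" for x
    by (intro onorm_le) 
  then have "norm (f x - f y) \<le> (\<Sum>b\<in>Basis. B b) * norm (x - y)" for x y
    by (intro differentiable_bound[of UNIV f "\<lambda>x v. Der v f x"]) (auto intro: csmooth_has_derivative[OF f])
  then show ?thesis using B(1) by (intro exI[of _ "\<Sum>b\<in>Basis. B b"]) (auto intro: sum_nonneg)
qed

text \<open>
  Uniformity in the base point \<open>y\<close> is what allows differentiation under the integral sign against
  a kernel about which only local integrability is known.
\<close>

lemma csmooth_taylor:
  fixes f :: "'a::euclidean_space \<Rightarrow> complex"
  assumes f: "csmooth f"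
  shows "\<exists>C\<ge>0. \<forall>y h. norm (f (y + h) - f y - Der h f y) \<le> C * norm h * norm h"
proof -
  have "\<exists>B\<ge>0. \<forall>x y. norm (Der b f x - Der b f y) \<le> B * norm (x - y)" for b
    using csmooth_lipschitz[OF csmooth_Der[OF f]] .
  then obtain B where B: "\<And>b. B b \<ge> 0" "\<And>b x y. norm (Der b f x - Der b f y) \<le> B b * norm (x - y)"
    by metis
  define C where "C = (\<Sum>b\<in>Basis. B b)"
  have C: "C \<ge> 0" unfolding C_def using B(1) by (intro sum_nonneg)
  have lin: "linear (frechet_derivative f (at x))" for x
    by (rule linear_frechet_derivative[OF csmooth_differentiable[OF f]])
  have *: "onorm (\<lambda>v. Der v f x - Der v f y) \<le> C * norm (x - y)" for x y
  proof (rule onorm_le)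
    fix v
    have "norm (Der v f x - Der v f y) \<le> (\<Sum>b\<in>Basis. B b * norm (x - y)) * norm v"
      by (rule Der_le_basis[of "\<lambda>v. Der v f x - Der v f y"]) (auto intro: B lin linear_compose_sub)
    then show "norm (Der v f x - Der v f y) \<le> C * norm (x - y) * norm v"
      by (simp add: C_def sum_distrib_right)
  qed
  have "norm (f (y + h) - f y - Der h f y) \<le> C * norm h * norm h" for y h
  proof -
    let ?S = "cball y (norm h)"
    have "norm (f (y + h) - f y - (\<lambda>v. Der v f y) (y + h - y)) \<le> norm (y + h - y) * (C * norm h)"
    proof (rule differentiable_bound_linearization[where S = ?S and f' = "\<lambda>x v. Der v f x"])
      show "y + t *\<^sub>R (y + h - y) \<in> ?S" if "t \<in> {0..1}" for t
        using that by (auto simp: dist_norm mult_left_le_one_le)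
      show "(f has_derivative (\<lambda>v. Der v f x)) (at x within ?S)" for x
        using csmooth_has_derivative[OF f] has_derivative_at_withinI by blast
      show "onorm ((\<lambda>v. Der v f x) - (\<lambda>v. Der v f y)) \<le> C * norm h" if "x \<in> ?S" for x
      proof -
        have "C * norm (x - y) \<le> C * norm h"
          using that C by (intro mult_left_mono) (auto simp: dist_norm norm_minus_commute)
        then show ?thesis using *[of x y] by (simp add: fun_diff_def)
      qed
    qed auto
    then show ?thesis by (simp add: mult_ac)
  qed
  then show ?thesis using C by blast
qed

text \<open>
  \<open>conv f\<close> is the convolution of \<open>f\<close> with the image of the measure \<open>k M\<close> under \<open>v\<close>.  Keeping the
  kernel on a parameter space covers integration along half-lines, lines and half-planes and the
  Cauchy transform in one complex direction, whose kernels are singular measures on the ambient space.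
\<close>

locale kernel =
  fixes M :: "'m measure" and k :: "'m \<Rightarrow> complex" and v :: "'m \<Rightarrow> 'a::euclidean_space"
  assumes k [measurable]: "k \<in> borel_measurable M"
    and v [measurable]: "v \<in> borel_measurable M"
    and loc: "\<And>R. integrable M (\<lambda>t. if norm (v t) \<le> R then k t else 0)"
begin

definition conv :: "('a \<Rightarrow> complex) \<Rightarrow> 'a \<Rightarrow> complex" where
  "conv f z = (\<integral>t. k t * f (z - v t) \<partial>M)"

lemma integrable_bound:
  assumes g: "g \<in> borel_measurable M"
    and b: "\<And>t. norm (g t) \<le> B"
    and s: "\<And>t. R < norm (v t) \<Longrightarrow> g t = 0"
  shows "integrable M (\<lambda>t. k t * g t)"
    and "norm (\<integral>t. k t * g t \<partial>M) \<le> B * (\<integral>t. norm (if norm (v t) \<le> R then k t else 0) \<partial>M)"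
proof -
  have le: "norm (k t * g t) \<le> B * norm (if norm (v t) \<le> R then k t else 0)" for t
    using s[of t] b[of t] by (auto simp: norm_mult mult.commute mult_right_mono not_le)
  have i: "integrable M (\<lambda>t. B * norm (if norm (v t) \<le> R then k t else 0))"
    by (intro integrable_mult_right integrable_norm loc)
  show 1: "integrable M (\<lambda>t. k t * g t)"
  proof (rule Bochner_Integration.integrable_bound[OF i])
    show "(\<lambda>t. k t * g t) \<in> borel_measurable M" using g by measurable
    show "AE t in M. norm (k t * g t) \<le> norm (B * norm (if norm (v t) \<le> R then k t else 0))"
      using le by (intro AE_I2) (smt (verit) real_norm_def)
  qed
  have "norm (\<integral>t. k t * g t \<partial>M) \<le> (\<integral>t. norm (k t * g t) \<partial>M)" by (rule integral_norm_bound)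
  also have "\<dots> \<le> (\<integral>t. B * norm (if norm (v t) \<le> R then k t else 0) \<partial>M)"
    by (intro integral_mono integrable_norm 1 i le)
  finally show "norm (\<integral>t. k t * g t \<partial>M) \<le> B * (\<integral>t. norm (if norm (v t) \<le> R then k t else 0) \<partial>M)"
    by simp
qed

lemma measurable_shift: "csmooth f \<Longrightarrow> (\<lambda>t. f (z - v t)) \<in> borel_measurable M"
  by (rule measurable_compose[OF _ csmooth_measurable]) measurable

lemma conv_integrable:
  assumes f: "csmooth f"
  shows "integrable M (\<lambda>t. k t * f (z - v t))"
proof -
  obtain B where B: "\<And>x. norm (f x) \<le> B" using csmooth_bounded[OF f] by blast
  obtain R where R: "\<And>x. R < norm x \<Longrightarrow> f x = 0" using f by (auto simp: csmooth_def)
  show ?thesis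
  proof (rule integrable_bound(1)[OF measurable_shift[OF f] B, of "norm z + R"])
    show "f (z - v t) = 0" if "norm z + R < norm (v t)" for t
      using R[of "z - v t"] that norm_triangle_ineq2[of "v t" z] by (simp add: norm_minus_commute)
  qed
qed

lemma conv_add: "csmooth f \<Longrightarrow> csmooth g \<Longrightarrow> conv (\<lambda>x. f x + g x) z = conv f z + conv g z"
  unfolding conv_def by (simp add: distrib_left conv_integrable)

lemma conv_cmult: "conv (\<lambda>x. c * f x) z = c * conv f z"
  unfolding conv_def by (simp add: mult.left_commute[of _ c])

lemma conv_diff: "csmooth f \<Longrightarrow> csmooth g \<Longrightarrow> conv (\<lambda>x. f x - g x) z = conv f z - conv g z"
  unfolding conv_def by (simp add: right_diff_distrib conv_integrable)

lemma conv_zero: "(\<And>t. k t \<noteq> 0 \<Longrightarrow> f (z - v t) = 0) \<Longrightarrow> conv f z = 0"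
  unfolding conv_def by (rule integral_eq_zero_AE) auto

text \<open>
  The remainder of the Taylor bound vanishes unless \<open>v t\<close> lies in a fixed ball, and there the
  kernel is integrable.
\<close>

lemma conv_has_derivative:
  assumes f: "csmooth f"
  shows "(conv f has_derivative (\<lambda>w. conv (Der w f) z)) (at z)"
proof -
  have df: "f differentiable (at x)" for x by (rule csmooth_differentiable[OF f])
  have lin: "linear (\<lambda>w. conv (Der w f) z)"
  proof (rule linearI)
    show "conv (Der (a + b) f) z = conv (Der a f) z + conv (Der b f) z" for a b
      using conv_add[OF csmooth_Der[OF f, of a] csmooth_Der[OF f, of b], of z] by (simp add: Der_linear[OF df])
    show "conv (Der (c *\<^sub>R b) f) z = c *\<^sub>R conv (Der b f) z" for c b
      using conv_cmult[of "of_real c" "Der b f" z] by (simp add: Der_linear[OF df] scaleR_conv_of_real)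
  qed
  obtain C where C: "C \<ge> 0" "\<And>y h. norm (f (y + h) - f y - Der h f y) \<le> C * norm h * norm h"
    using csmooth_taylor[OF f] by blast
  obtain R where R: "\<And>x. R < norm x \<Longrightarrow> f x = 0" using f by (auto simp: csmooth_def)
  have oR: "open {x::'a. R < norm x}" by (intro open_Collect_less continuous_intros)
  have DR: "Der h f x = 0" if "R < norm x" for h x
    using Der_zero_open[OF oR, of x f h] R that by simp
  define I where "I = (\<integral>t. norm (if norm (v t) \<le> norm z + R + 1 then k t else 0) \<partial>M)"
  have I: "I \<ge> 0" unfolding I_def by (intro integral_nonneg_AE) auto
  have rem: "norm (conv f (z + h) - conv f z - conv (Der h f) z) \<le> C * norm h * norm h * I"
    if h: "norm h < 1" for h
  proof -
    have "norm (\<integral>t. k t * (f (z - v t + h) - f (z - v t) - Der h f (z - v t)) \<partial>M)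
        \<le> (C * norm h * norm h) * I"
      unfolding I_def
    proof (rule integrable_bound(2))
      have "(\<lambda>t. f (z - v t + h)) = (\<lambda>t. f (z + h - v t))" by (simp add: algebra_simps)
      then have [measurable]: "(\<lambda>t. f (z - v t + h)) \<in> borel_measurable M"
        "(\<lambda>t. f (z - v t)) \<in> borel_measurable M" "(\<lambda>t. Der h f (z - v t)) \<in> borel_measurable M"
        using measurable_shift[OF f] measurable_shift[OF csmooth_Der[OF f]] by simp_all
      show "(\<lambda>t. f (z - v t + h) - f (z - v t) - Der h f (z - v t)) \<in> borel_measurable M"
        by measurable
      show "norm (f (z - v t + h) - f (z - v t) - Der h f (z - v t)) \<le> C * norm h * norm h" for t
        by (rule C)
      show "f (z - v t + h) - f (z - v t) - Der h f (z - v t) = 0" if t: "norm z + R + 1 < norm (v t)" for t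
      proof -
        have "R < norm (z - v t)"
          using t norm_triangle_ineq2[of "v t" z] by (simp add: norm_minus_commute)
        moreover have "norm (v t) \<le> norm (z - v t + h) + norm z + norm h"
          using norm_triangle_ineq4[of "z + h" "z - v t + h"] norm_triangle_ineq[of z h]
          by (simp add: algebra_simps)
        ultimately show ?thesis using R[of "z - v t"] R[of "z - v t + h"] DR[of "z - v t"] t h by simp
      qed
    qed
    also have "(\<integral>t. k t * (f (z - v t + h) - f (z - v t) - Der h f (z - v t)) \<partial>M)
        = (\<integral>t. k t * f (z + h - v t) - k t * f (z - v t) - k t * Der h f (z - v t) \<partial>M)"
      by (simp add: algebra_simps)
    also have "\<dots> = conv f (z + h) - conv f z - conv (Der h f) z"
      unfolding conv_def using conv_integrable[OF f] conv_integrable[OF csmooth_Der[OF f]]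
      by (simp add: Bochner_Integration.integral_diff)
    finally show ?thesis .
  qed
  show ?thesis
    unfolding has_derivative_at_alt
  proof (intro conjI allI impI)
    show "bounded_linear (\<lambda>w. conv (Der w f) z)" using lin by (simp add: linear_conv_bounded_linear)
    fix e :: real assume e: "e > 0"
    define d where "d = min 1 (e / (C * I + 1))"
    have CI: "C * I + 1 > 0" using C(1) I by (simp add: add_nonneg_pos)
    have "d > 0" using e CI by (simp add: d_def)
    moreover have "norm (conv f y - conv f z - conv (Der (y - z) f) z) \<le> e * norm (y - z)"
      if "norm (y - z) < d" for y
    proof -
      have h: "norm (y - z) < 1" "norm (y - z) < e / (C * I + 1)" using that by (auto simp: d_def)
      have "norm (conv f y - conv f z - conv (Der (y - z) f) z) \<le> (C * I * norm (y - z)) * norm (y - z)"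
        using rem[OF h(1)] by (simp add: mult_ac)
      also have "\<dots> \<le> e * norm (y - z)"
      proof (rule mult_right_mono)
        have "C * I * norm (y - z) \<le> (C * I + 1) * norm (y - z)" by (simp add: algebra_simps)
        also have "\<dots> \<le> e" using h(2) CI by (simp add: pos_less_divide_eq mult.commute less_imp_le)
        finally show "C * I * norm (y - z) \<le> e" .
      qed auto
      finally show ?thesis .
    qed
    ultimately show "\<exists>d>0. \<forall>y. norm (y - z) < d \<longrightarrow>
        norm (conv f y - conv f z - conv (Der (y - z) f) z) \<le> e * norm (y - z)" by blast
  qed
qed

lemma Der_conv: "csmooth f \<Longrightarrow> Der w (conv f) z = conv (Der w f) z"
  by (rule Der_eqI[OF conv_has_derivative])

lemma smooth_conv:
  assumes "csmooth f" shows "smooth_on UNIV (conv f)"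
proof (rule smooth_on_coinduct[where P = "\<lambda>g. \<exists>f. csmooth f \<and> g = conv f"])
  show "\<exists>g. csmooth g \<and> conv f = conv g" using assms by blast
  fix g assume "\<exists>f. csmooth f \<and> g = conv f"
  then obtain f where f: "csmooth f" "g = conv f" by blast
  show "g differentiable at x" for x
    using conv_has_derivative[OF f(1)] f(2) by (auto intro: differentiableI)
  show "\<exists>h. (\<exists>f. csmooth f \<and> h = conv f) \<and> (\<forall>x\<in>UNIV. Der w g x = h x)" for w
    using Der_conv[OF f(1)] csmooth_Der[OF f(1)] f(2) by blast
qed auto

end

text \<open>
  Convolution with the constant kernel does not depend on the point, by translation invariance of
  Lebesgue measure; so its derivative, which is the convolution of the derivative, vanishes.
\<close>

lemma integral_Der_zero:
  fixes f :: "'a::euclidean_space \<Rightarrow> complex"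
  assumes f: "csmooth f"
  shows "(\<integral>x. Der w f x \<partial>lborel) = 0"
proof -
  interpret kernel "lborel :: 'a measure" "\<lambda>x. 1" "\<lambda>x. x"
  proof
    show "integrable lborel (\<lambda>x::'a. if norm x \<le> R then 1 else (0::complex))" for R
    proof -
      have "integrable lborel (\<lambda>x::'a. indicator (cball 0 R) x *\<^sub>R (1::complex))"
        by (rule borel_integrable_compact) auto
      also have "(\<lambda>x::'a. indicator (cball 0 R) x *\<^sub>R (1::complex)) = (\<lambda>x. if norm x \<le> R then 1 else 0)"
        by (auto simp: indicator_def fun_eq_iff)
      finally show ?thesis .
    qed
  qed auto
  have refl: "conv g z = (\<integral>x. g x \<partial>lborel)" if g: "csmooth g" for g z
  proof -
    have [measurable]: "g \<in> borel_measurable borel" by (rule csmooth_measurable[OF g])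
    have "(\<integral>x. g x \<partial>lborel) = (\<integral>x. g x \<partial>density (distr lborel borel (\<lambda>x. z + (-1) *\<^sub>R x)) (\<lambda>_. 1))"
      by (subst lborel_affine[of "-1" z]) auto
    also have "\<dots> = (\<integral>x. g (z - x) \<partial>lborel)"
      by (simp add: density_1 integral_distr)
    finally show ?thesis by (simp add: conv_def)
  qed
  have "conv f = (\<lambda>z. \<integral>x. f x \<partial>lborel)" using refl[OF f] by auto
  then have "Der w (conv f) 0 = 0" by simp
  then show ?thesis using Der_conv[OF f, where w = w and z = 0] refl[OF csmooth_Der[OF f]] by simp
qed

lemma line_derivative:
  assumes f: "csmooth f"
  shows "((\<lambda>t. f (z - t *\<^sub>R w)) has_vector_derivative - Der w f (z - t *\<^sub>R w)) (at t within S)"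
proof -
  have "((\<lambda>t. z - t *\<^sub>R w) has_derivative (\<lambda>r. - (r *\<^sub>R w))) (at t within S)"
    by (auto intro!: derivative_eq_intros)
  from has_derivative_compose[OF this csmooth_has_derivative[OF f]]
  have "((\<lambda>t. f (z - t *\<^sub>R w)) has_derivative (\<lambda>r. Der (- (r *\<^sub>R w)) f (z - t *\<^sub>R w))) (at t within S)" .
  moreover have "Der (- (r *\<^sub>R w)) f x = r *\<^sub>R (- Der w f x)" for r x
    using Der_linear(2)[OF csmooth_differentiable[OF f], where c = "-r" and v = w and x = x] by simp
  ultimately show ?thesis by (simp add: has_vector_derivative_def)
qed

lemma half_line_integral:
  assumes f: "csmooth f" and w: "w \<noteq> 0"
  shows "has_bochner_integral lborel (\<lambda>t::real. indicator {0..} t * Der w f (z - t *\<^sub>R w)) (f z)"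
proof -
  obtain R where R: "\<And>x. R < norm x \<Longrightarrow> f x = 0" using f by (auto simp: csmooth_def)
  have oR: "open {x::'a. R < norm x}" by (intro open_Collect_less continuous_intros)
  have DR: "Der h f x = 0" if "R < norm x" for h x
    using Der_zero_open[OF oR, of x f h] R that by simp
  define b where "b = (\<bar>R\<bar> + norm z + 1) / norm w"
  have b: "b \<ge> 0" by (simp add: b_def)
  have far: "R < norm (z - t *\<^sub>R w)" if "t \<ge> b" for t
  proof -
    have "b * norm w \<le> t * norm w" using that by (simp add: mult_right_mono)
    then have "\<bar>R\<bar> + norm z + 1 \<le> norm (t *\<^sub>R w)" using order_trans[OF b that] w that by (simp add: b_def abs_of_nonneg)
    then show ?thesis using norm_triangle_ineq2[of "t *\<^sub>R w" z] by (simp add: norm_minus_commute)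
  qed
  have "has_bochner_integral lborel (\<lambda>t. indicator {0..b} t *\<^sub>R (Der w f (z - t *\<^sub>R w)))
      (- f (z - b *\<^sub>R w) - - f (z - 0 *\<^sub>R w))"
  proof (rule has_bochner_integral_FTC_Icc[OF b])
    show "((\<lambda>t. - f (z - t *\<^sub>R w)) has_vector_derivative Der w f (z - x *\<^sub>R w)) (at x within {0..b})" for x
      using has_vector_derivative_minus[OF line_derivative[OF f]] by simp
    show "continuous_on {0..b} (\<lambda>t. Der w f (z - t *\<^sub>R w))"
      by (rule continuous_on_compose2[OF csmooth_continuous[OF csmooth_Der[OF f]]]) (auto intro!: continuous_intros)
  qed
  moreover have "f (z - b *\<^sub>R w) = 0" using R far by simp
  moreover have "indicator {0..b} t *\<^sub>R (Der w f (z - t *\<^sub>R w)) = indicator {0..} t * Der w f (z - t *\<^sub>R w)" for t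
    using DR[OF far, of t w] by (auto simp: indicator_def)
  ultimately show ?thesis by simp
qed

section \<open>The Cauchy transform in one complex direction\<close>

lemma integrable_product_real:
  fixes g h :: "real \<Rightarrow> real"
  assumes g: "integrable lborel g" and h: "integrable lborel h"
  shows "integrable lborel (\<lambda>p. g (fst p) * h (snd p))"
proof -
  have [measurable]: "g \<in> borel_measurable borel" "h \<in> borel_measurable borel" using g h by auto
  have "integrable (lborel \<Otimes>\<^sub>M lborel) (\<lambda>p. g (fst p) * h (snd p))"
  proof (rule lborel_pair.Fubini_integrable)
    show "integrable lborel (\<lambda>x. \<integral>y. norm (g (fst (x, y)) * h (snd (x, y))) \<partial>lborel)"
      using integrable_norm[OF g] by (simp add: abs_mult)
    show "AE x in lborel. integrable lborel (\<lambda>y. g (fst (x, y)) * h (snd (x, y)))"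
      using h by simp
  qed measurable
  then show ?thesis by (simp add: lborel_prod)
qed

lemma integrable_even_extension:
  fixes h :: "real \<Rightarrow> real"
  assumes h: "integrable lborel h"
  shows "integrable lborel (\<lambda>x. h x + h (- x))"
  using lborel_integrable_real_affine[OF h, of "-1" 0] h by simp

lemma integrable_inverse_sqrt: "integrable lborel (\<lambda>x. indicator {0..R} x * x powr (- (1 / 2)))"
  for R :: real
proof (cases "R \<ge> 0")
  case True
  have "(\<lambda>x. x powr (- (1 / 2))) absolutely_integrable_on {0..R}"
    by (intro nonnegative_absolutely_integrable_1 integrable_on_powr_from_0) (use True in auto)
  then have "integrable lebesgue (\<lambda>x. indicator {0..R} x * x powr (- (1 / 2)))"
    by (simp add: set_integrable_def)
  then show ?thesis
    by (subst (asm) integrable_completion) auto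
qed auto

definition plane :: "real \<times> real \<Rightarrow> complex" where
  "plane p = of_real (fst p) + \<i> * of_real (snd p)"

lemma norm_plane: "norm (plane p) = norm p"
proof -
  have "plane p = Complex (fst p) (snd p)" by (simp add: plane_def complex_eq_iff)
  then show ?thesis by (simp add: norm_prod_def complex_norm)
qed

lemma plane_cnj: "plane p * cnj (plane p) = of_real ((norm p)\<^sup>2)"
  using complex_norm_square[of "plane p"] by (simp add: norm_plane)

lemma bounded_linear_plane: "bounded_linear plane"
proof -
  have "bounded_linear (\<lambda>p::real \<times> real. of_real (fst p) + \<i> * of_real (snd p) :: complex)"
    by (intro bounded_linear_add bounded_linear_compose[OF bounded_linear_of_real]
        bounded_linear_const_mult bounded_linear_fst bounded_linear_snd)
  then show ?thesis by (simp add: plane_def[abs_def])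
qed

lemma plane_measurable [measurable]: "plane \<in> borel_measurable borel"
  by (intro borel_measurable_continuous_onI linear_continuous_on bounded_linear_plane)

lemma AE_off_axes: "AE p in (lborel :: (real \<times> real) measure). fst p \<noteq> 0 \<and> snd p \<noteq> 0"
proof -
  have "AE p in lborel \<Otimes>\<^sub>M lborel. fst p \<noteq> (0::real) \<and> snd p \<noteq> (0::real)"
  proof (rule lborel_pair.AE_pair_measure)
    show "AE x in lborel. AE y in lborel. fst (x, y) \<noteq> (0::real) \<and> snd (x, y) \<noteq> (0::real)"
      using AE_lborel_singleton[of "0::real"]
    proof eventually_elim
      case (elim x)
      show ?case using AE_lborel_singleton[of "0::real"] by eventually_elim (use elim in auto)
    qed
  qed measurable
  then show ?thesis unfolding lborel_prod .
qed

text \<open>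
  Since \<open>x\<^sup>2 + y\<^sup>2 \<ge> |x| |y|\<close>, the kernel is dominated by the product of \<open>|x| powr (-1/2)\<close> and
  \<open>|y| powr (-1/2)\<close>.  The bound fails on the axes, because \<open>0 powr a = 0\<close>, so it holds almost
  everywhere only.
\<close>

lemma cauchy_kernel_locally_integrable:
  "integrable lborel (\<lambda>p. if norm p \<le> R then inverse (plane p) else 0)"
proof -
  define h where "h x = indicator {0..R} x * x powr (- (1 / 2))" for x
  define g where "g x = h x + h (- x)" for x
  have "integrable lborel g"
    unfolding g_def h_def by (intro integrable_even_extension integrable_inverse_sqrt)
  then have i: "integrable lborel (\<lambda>p. g (fst p) * g (snd p))" by (intro integrable_product_real)
  have g: "g x = \<bar>x\<bar> powr (- (1 / 2))" if "\<bar>x\<bar> \<le> R" "x \<noteq> 0" for x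
    using that by (cases "x > 0") (auto simp: g_def h_def indicator_def)
  show ?thesis
  proof (rule Bochner_Integration.integrable_bound[OF i])
    show "(\<lambda>p. if norm p \<le> R then inverse (plane p) else 0) \<in> borel_measurable lborel" by measurable
    show "AE p in lborel. norm (if norm p \<le> R then inverse (plane p) else 0) \<le> norm (g (fst p) * g (snd p))"
      using AE_off_axes
    proof eventually_elim
      case (elim p)
      show ?case
      proof (cases "norm p \<le> R")
        case True
        obtain x y where p: "p = (x, y)" by force
        have n: "norm p = sqrt (x\<^sup>2 + y\<^sup>2)" by (simp add: p norm_prod_def)
        have le: "\<bar>x\<bar> \<le> norm p" "\<bar>y\<bar> \<le> norm p"
          unfolding n by (auto intro: real_sqrt_ge_abs1 real_sqrt_ge_abs2)
        have pos: "\<bar>x\<bar> > 0" "\<bar>y\<bar> > 0" using elim p by auto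
        have "g x * g y = (\<bar>x\<bar> * \<bar>y\<bar>) powr (- (1 / 2))"
          using g[of x] g[of y] le True pos by (simp add: powr_mult)
        also have "\<dots> = 1 / sqrt (\<bar>x\<bar> * \<bar>y\<bar>)"
          unfolding powr_minus using powr_half_sqrt[of "\<bar>x\<bar> * \<bar>y\<bar>"] by (simp only: divide_inverse mult_1 zero_le_mult_iff abs_ge_zero simp_thms)
        finally have "g x * g y = 1 / sqrt (\<bar>x\<bar> * \<bar>y\<bar>)" .
        moreover have "sqrt (\<bar>x\<bar> * \<bar>y\<bar>) \<le> norm p"
        proof -
          have "\<bar>x\<bar> * \<bar>y\<bar> \<le> norm p * norm p" using le by (intro mult_mono) auto
          then show ?thesis using real_sqrt_le_mono by fastforce
        qed
        moreover have "sqrt (\<bar>x\<bar> * \<bar>y\<bar>) > 0" using pos by simp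
        ultimately have "inverse (norm p) \<le> g x * g y"
          by (simp add: divide_inverse le_imp_inverse_le)
        then show ?thesis using True by (simp add: p[symmetric] norm_inverse norm_plane) (simp add: p)
      qed auto
    qed
  qed
qed

text \<open>
  The total mass (in fact \<open>\<pi>\<close>) of the approximate identity that arises in \<open>cauchy_dbar\<close>.
\<close>

definition cauchy_const :: real where
  "cauchy_const = (\<integral>p. inverse (((norm (p :: real \<times> real))\<^sup>2 + 1)\<^sup>2) \<partial>lborel)"

lemma integrable_inverse_1_plus_square: "integrable lborel (\<lambda>x::real. inverse (1 + x\<^sup>2))"
proof -
  define h where "h x = inverse (1 + x\<^sup>2) * indicator {0..} x" for x :: real
  have "(\<integral>\<^sup>+x. ennreal (inverse (1 + x\<^sup>2)) * indicator {0..} x \<partial>lborel) = ennreal (pi / 2 - arctan 0)"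
  proof (rule nn_integral_FTC_atLeast)
    show "(arctan \<longlongrightarrow> pi / 2) at_top" by (rule tendsto_arctan_at_top)
    show "DERIV arctan x :> inverse (1 + x\<^sup>2)" for x by (rule DERIV_arctan)
    show "0 \<le> inverse (1 + x\<^sup>2)" for x :: real by simp
  qed measurable
  also have "(\<lambda>x. ennreal (inverse (1 + x\<^sup>2)) * indicator {0..} x) = (\<lambda>x. ennreal (h x))"
    by (auto simp: h_def indicator_def)
  finally have "(\<integral>\<^sup>+x. ennreal (h x) \<partial>lborel) < \<infinity>" by simp
  moreover have "norm (h x) = h x" for x by (auto simp: h_def indicator_def)
  moreover have "h \<in> borel_measurable lborel" unfolding h_def by measurable
  ultimately have "integrable lborel h" by (simp add: integrable_iff_bounded)
  then have "integrable lborel (\<lambda>x. h x + h (- x))" by (rule integrable_even_extension)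
  then show ?thesis
    by (rule Bochner_Integration.integrable_bound) (auto simp: h_def indicator_def)
qed

lemma integrable_cauchy_const: "integrable lborel (\<lambda>p::real \<times> real. inverse (((norm p)\<^sup>2 + 1)\<^sup>2))"
proof (rule Bochner_Integration.integrable_bound)
  show "integrable lborel (\<lambda>p. inverse (1 + (fst p)\<^sup>2) * inverse (1 + (snd p)\<^sup>2) :: real)"
    by (intro integrable_product_real integrable_inverse_1_plus_square)
  show "(\<lambda>p::real \<times> real. inverse (((norm p)\<^sup>2 + 1)\<^sup>2)) \<in> borel_measurable lborel" by measurable
  have "inverse (((norm p)\<^sup>2 + 1)\<^sup>2) \<le> inverse (1 + (fst p)\<^sup>2) * inverse (1 + (snd p)\<^sup>2)" for p :: "real \<times> real"
  proof -
    obtain x y where p: "p = (x, y)" by force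
    have n: "(norm p)\<^sup>2 = x\<^sup>2 + y\<^sup>2" by (simp add: p norm_prod_def)
    have "(1 + x\<^sup>2) * (1 + y\<^sup>2) \<le> (x\<^sup>2 + y\<^sup>2 + 1)\<^sup>2"
    proof -
      have "(x\<^sup>2 + y\<^sup>2 + 1)\<^sup>2 - (1 + x\<^sup>2) * (1 + y\<^sup>2) = x\<^sup>2 + y\<^sup>2 + (x\<^sup>2)\<^sup>2 + (y\<^sup>2)\<^sup>2 + x\<^sup>2 * y\<^sup>2"
        by algebra
      also have "\<dots> \<ge> 0" by (intro add_nonneg_nonneg mult_nonneg_nonneg) auto
      finally show ?thesis by simp
    qed
    moreover have "0 < (1 + x\<^sup>2) * (1 + y\<^sup>2)" by (simp add: add_pos_nonneg)
    ultimately have "inverse ((x\<^sup>2 + y\<^sup>2 + 1)\<^sup>2) \<le> inverse ((1 + x\<^sup>2) * (1 + y\<^sup>2))"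
      by (rule le_imp_inverse_le)
    then show ?thesis by (simp add: n) (simp add: p)
  qed
  then show "AE p::real \<times> real in lborel. norm (inverse (((norm p)\<^sup>2 + 1)\<^sup>2))
      \<le> norm (inverse (1 + (fst p)\<^sup>2) * inverse (1 + (snd p)\<^sup>2))"
    by simp
qed

lemma cauchy_const_nonzero: "cauchy_const \<noteq> 0"
proof
  assume "cauchy_const = 0"
  then have "AE p::real \<times> real in lborel. inverse (((norm p)\<^sup>2 + 1)\<^sup>2) = 0"
    unfolding cauchy_const_def
    using integral_nonneg_eq_0_iff_AE[OF integrable_cauchy_const] by simp
  then have "AE p::real \<times> real in lborel. False"
  proof eventually_elim
    case (elim p)
    have "(norm p)\<^sup>2 + 1 > 0" by (simp add: add_nonneg_pos)
    then show ?case using elim by simp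
  qed
  then have "emeasure (lborel :: (real \<times> real) measure) UNIV = 0"
    using ae_filter_eq_bot_iff[of "lborel :: (real \<times> real) measure"] by (simp add: trivial_limit_def)
  then show False by (simp add: emeasure_lborel_UNIV)
qed

lemma smooth_on_affine_within:
  fixes L :: "'b::real_normed_vector \<Rightarrow> 'a::real_normed_vector"
  assumes f: "smooth_on X f" and L: "bounded_linear L" and X: "\<And>p. z + L p \<in> X"
  shows "smooth_on UNIV (\<lambda>p. f (z + L p))" and "Der q (\<lambda>p. f (z + L p)) p = Der (L q) f (z + L p)"
proof -
  have d: "((\<lambda>p. f (z + L p)) has_derivative (\<lambda>q. Der (L q) f (z + L p))) (at p)"
    if f: "smooth_on X f" for f p
  proof -
    have "((\<lambda>p. z + L p) has_derivative L) (at p)"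
      using bounded_linear_imp_has_derivative[OF L] by (auto intro!: derivative_eq_intros)
    from has_derivative_compose[OF this smooth_on_has_derivative[OF f X]]
    show ?thesis by simp
  qed
  show "Der q (\<lambda>p. f (z + L p)) p = Der (L q) f (z + L p)" by (rule Der_eqI[OF d[OF f]])
  show "smooth_on UNIV (\<lambda>p. f (z + L p))"
  proof (rule smooth_on_coinduct[where P = "\<lambda>g. \<exists>f. smooth_on X f \<and> g = (\<lambda>p. f (z + L p))"])
    fix g :: "'b \<Rightarrow> complex" assume "\<exists>f. smooth_on X f \<and> g = (\<lambda>p. f (z + L p))"
    then obtain h where h: "smooth_on X h" "g = (\<lambda>p. h (z + L p))" by blast
    show "g differentiable at x" for x using d[OF h(1)] h(2) by (auto intro: differentiableI)
    have "Der v g x = Der (L v) h (z + L x)" for v x unfolding h(2) by (rule Der_eqI[OF d[OF h(1)]])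
    then show "\<exists>k. (\<exists>f. smooth_on X f \<and> k = (\<lambda>p. f (z + L p))) \<and> (\<forall>x\<in>UNIV. Der v g x = k x)" for v
      using smooth_on_Der[OF h(1), of "L v"] by blast
  qed (use f in auto)
qed

lemmas smooth_on_affine = smooth_on_affine_within[where X = UNIV, OF _ _ UNIV_I]

lemma Der_plane: "Der q plane p = plane q"
  by (rule Der_eqI[OF bounded_linear_imp_has_derivative[OF bounded_linear_plane]])

lemma smooth_plane: "smooth_on UNIV plane"
  by (rule smooth_on_linear[OF open_UNIV bounded_linear_plane])

text \<open>
  A smooth approximation of \<open>1 / \<zeta> = cnj \<zeta> / |\<zeta>|\<^sup>2\<close> that is dominated by it.
\<close>

definition reg_kernel :: "real \<Rightarrow> real \<times> real \<Rightarrow> complex" where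
  "reg_kernel e p = cnj (plane p) * inverse (plane p * cnj (plane p) + of_real (e\<^sup>2))"

lemma reg_denominator:
  assumes "e > 0" shows "plane p * cnj (plane p) + of_real (e\<^sup>2) = of_real ((norm p)\<^sup>2 + e\<^sup>2)"
    and "plane p * cnj (plane p) + of_real (e\<^sup>2) \<noteq> 0"
proof -
  show 1: "plane p * cnj (plane p) + of_real (e\<^sup>2) = of_real ((norm p)\<^sup>2 + e\<^sup>2)"
    unfolding plane_cnj by simp
  have "(norm p)\<^sup>2 + e\<^sup>2 > 0" using assms by (simp add: add_nonneg_pos)
  then show "plane p * cnj (plane p) + of_real (e\<^sup>2) \<noteq> 0" unfolding 1 of_real_eq_0_iff by linarith
qed

lemma smooth_reg_kernel:
  assumes e: "e > 0" shows "smooth_on UNIV (reg_kernel e)"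
  unfolding reg_kernel_def[abs_def]
  by (intro smooth_on_mult smooth_on_cnj smooth_on_inverse smooth_on_add smooth_on_const open_UNIV
      smooth_plane reg_denominator[OF e])

text \<open>
  The right-hand side is an approximate identity: it arises from \<open>2 / (|p|\<^sup>2 + 1)\<^sup>2\<close> by the scaling
  that preserves integrals over the plane.
\<close>

lemma dbar_reg_kernel:
  assumes e: "e > 0"
  shows "Der (1, 0) (reg_kernel e) p + \<i> * Der (0, 1) (reg_kernel e) p
    = of_real (2 * e\<^sup>2 / ((norm p)\<^sup>2 + e\<^sup>2)\<^sup>2)"
proof -
  define r where "r p = plane p * cnj (plane p) + of_real (e\<^sup>2)" for p
  have sp: "plane differentiable at p" "(\<lambda>p. cnj (plane p)) differentiable at p" for p
    using smooth_on_differentiable[OF smooth_plane UNIV_I, of p]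
      differentiable_cnj[OF smooth_on_differentiable[OF smooth_plane UNIV_I, of p]] by blast+
  have sr: "smooth_on UNIV r" unfolding r_def
    by (intro smooth_on_mult smooth_on_cnj smooth_on_add smooth_on_const open_UNIV smooth_plane)
  then have dr: "r differentiable at p" for p using smooth_on_differentiable by blast
  have r0: "r p \<noteq> 0" for p using reg_denominator(2)[OF e] by (simp add: r_def)
  have dir: "(\<lambda>p. inverse (r p)) differentiable at p"
    using smooth_on_differentiable[OF smooth_on_inverse[OF open_UNIV sr r0]] by blast
  have Dr: "Der q r p = plane p * cnj (plane q) + plane q * cnj (plane p)" for q
  proof -
    have m: "(\<lambda>p. plane p * cnj (plane p)) differentiable at p"
      using smooth_on_differentiable[OF smooth_on_mult[OF open_UNIV smooth_plane smooth_on_cnj[OF open_UNIV smooth_plane]]] by blast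
    have "Der q r p = Der q (\<lambda>p. plane p * cnj (plane p)) p + Der q (\<lambda>p. of_real (e\<^sup>2)) p"
      unfolding r_def[abs_def] by (rule Der_add[OF m]) simp
    also have "\<dots> = plane p * cnj (plane q) + plane q * cnj (plane p)"
      by (simp add: Der_mult[OF sp] Der_cnj[OF sp(1)] Der_plane)
    finally show ?thesis .
  qed
  have Dk: "Der q (reg_kernel e) p = cnj (plane p) * (- (inverse (r p) * Der q r p * inverse (r p)))
      + cnj (plane q) * inverse (r p)" for q
  proof -
    have "Der q (reg_kernel e) p = cnj (plane p) * Der q (\<lambda>p. inverse (r p)) p
      + Der q (\<lambda>p. cnj (plane p)) p * inverse (r p)"
      unfolding reg_kernel_def[abs_def] r_def[symmetric] by (rule Der_mult[OF sp(2) dir])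
    then show ?thesis by (simp add: Der_inverse[OF dr r0] Der_cnj[OF sp(1)] Der_plane)
  qed
  have q: "plane (1, 0) = 1" "plane (0, 1) = \<i>" by (simp_all add: plane_def)
  have "Der (1, 0) (reg_kernel e) p + \<i> * Der (0, 1) (reg_kernel e) p
    = 2 * inverse (r p) - 2 * (plane p * cnj (plane p)) * inverse (r p) * inverse (r p)"
    unfolding Dk Dr q by (simp add: algebra_simps)
  also have "\<dots> = 2 * (r p - plane p * cnj (plane p)) * inverse (r p) * inverse (r p)"
    using r0[of p] by (simp add: left_diff_distrib right_diff_distrib)
  also have "r p - plane p * cnj (plane p) = of_real (e\<^sup>2)" by (simp add: r_def)
  also have "r p = of_real ((norm p)\<^sup>2 + e\<^sup>2)" using reg_denominator(1)[OF e] by (simp add: r_def)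
  finally show ?thesis by (simp add: power2_eq_square divide_inverse mult_ac)
qed

lemma reg_kernel_le:
  assumes e: "e > 0" shows "norm (reg_kernel e p) \<le> norm (inverse (plane p))"
proof (cases "p = 0")
  case False
  then have n: "norm p > 0" by simp
  have "norm (reg_kernel e p) = norm p * inverse ((norm p)\<^sup>2 + e\<^sup>2)"
    unfolding reg_kernel_def reg_denominator(1)[OF e] norm_mult norm_inverse norm_of_real complex_mod_cnj
    by (simp add: norm_plane abs_of_nonneg add_nonneg_nonneg)
  also have "\<dots> \<le> norm p * inverse ((norm p)\<^sup>2)"
    using n by (intro mult_left_mono le_imp_inverse_le) auto
  also have "\<dots> = inverse (norm p)" using n by (simp add: power2_eq_square)
  finally show ?thesis by (simp add: norm_inverse norm_plane)
qed (auto simp: reg_kernel_def plane_def)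

lemma reg_kernel_tendsto:
  "(\<lambda>n. reg_kernel (inverse (real (Suc n))) p) \<longlonglongrightarrow> inverse (plane p)"
proof (cases "p = 0")
  case False
  then have "plane p \<noteq> 0" using norm_plane[of p] by auto
  then have ne: "plane p * cnj (plane p) \<noteq> 0" by simp
  have "(\<lambda>n. reg_kernel (inverse (real (Suc n))) p) \<longlonglongrightarrow>
      cnj (plane p) * inverse (plane p * cnj (plane p) + of_real (0\<^sup>2))"
    unfolding reg_kernel_def
    by (intro tendsto_intros LIMSEQ_inverse_real_of_nat) (use ne in simp)
  then show ?thesis using \<open>plane p \<noteq> 0\<close> by (simp add: field_simps)
qed (auto simp: reg_kernel_def plane_def)

locale orthonormal_pair =
  fixes a b :: "'a::euclidean_space"
  assumes a: "norm a = 1" and b: "norm b = 1" and ab: "a \<bullet> b = 0"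
begin

definition embed :: "real \<times> real \<Rightarrow> 'a" where
  "embed p = fst p *\<^sub>R a + snd p *\<^sub>R b"

lemma norm_embed: "norm (embed p) = norm p"
proof -
  have "a \<bullet> a = 1" "b \<bullet> b = 1" using a b by (simp_all add: dot_square_norm)
  then have "(norm (embed p))\<^sup>2 = (norm p)\<^sup>2"
    unfolding power2_norm_eq_inner embed_def
    by (simp add: inner_prod_def inner_add inner_commute[of b a] ab)
  then show ?thesis by simp
qed

lemma bounded_linear_embed: "bounded_linear embed"
  unfolding embed_def[abs_def]
  by (intro bounded_linear_add bounded_linear_scaleR_const bounded_linear_fst bounded_linear_snd)

lemma embed_measurable [measurable]: "embed \<in> borel_measurable borel"
  by (intro borel_measurable_continuous_onI linear_continuous_on bounded_linear_embed)

sublocale cauchy: kernel lborel "\<lambda>p. inverse (plane p)" embed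
proof
  show "integrable lborel (\<lambda>t. if norm (embed t) \<le> R then inverse (plane t) else 0)" for R
    unfolding norm_embed by (rule cauchy_kernel_locally_integrable)
qed measurable

text \<open>
  The Cauchy-Pompeiu formula: up to a constant, \<open>1 / \<zeta>\<close> is a fundamental solution of the
  Cauchy-Riemann operator.  With the regularised kernel, integration by parts moves the derivative
  to the kernel, where it yields an approximate identity; both sides converge by dominated
  convergence.
\<close>

lemma cauchy_dbar:
  assumes f: "csmooth f"
  shows "cauchy.conv (\<lambda>x. (Der a f x + \<i> * Der b f x) / 2) z = of_real cauchy_const * f z"
proof -
  define F where "F p = f (z - embed p)" for p :: "real \<times> real"
  have bl: "bounded_linear (\<lambda>p. - embed p)" by (intro bounded_linear_minus bounded_linear_embed)
  have sF: "smooth_on UNIV F"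
    using smooth_on_affine(1)[OF csmooth_smooth[OF f] bl, where z = z] by (simp add: F_def[abs_def])
  have DF: "Der q F p = - Der (embed q) f (z - embed p)" for q p :: "real \<times> real"
  proof -
    have "Der q F p = Der (- embed q) f (z - embed p)"
      using smooth_on_affine(2)[OF csmooth_smooth[OF f] bl, where q = q and z = z and p = p] by (simp add: F_def[abs_def])
    then show ?thesis using Der_linear(2)[OF csmooth_differentiable[OF f], where c = "-1" and v = "embed q" and x = "z - embed p"] by simp
  qed
  obtain R where R: "\<And>x. R < norm x \<Longrightarrow> f x = 0" using f by (auto simp: csmooth_def)
  have cF: "csmooth F"
    unfolding csmooth_def
  proof (intro conjI sF exI[of _ "norm z + R"] allI impI)
    fix p :: "real \<times> real" assume "norm z + R < norm p"
    then have "R < norm (z - embed p)"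
      using norm_triangle_ineq2[of "embed p" z] by (simp add: norm_embed norm_minus_commute)
    then show "F p = 0" using R by (simp add: F_def)
  qed
  define N where "N p = Der (1, 0) F p + \<i> * Der (0, 1) F p" for p
  have cN: "csmooth N" unfolding N_def[abs_def]
    by (intro csmooth_add csmooth_cmult csmooth_Der cF)
  have em: "embed (1, 0) = a" "embed (0, 1) = b" by (simp_all add: embed_def)
  have NN: "N p = - (Der a f (z - embed p) + \<i> * Der b f (z - embed p))" for p
    by (simp add: N_def DF em)
  have lhs: "cauchy.conv (\<lambda>x. (Der a f x + \<i> * Der b f x) / 2) z = (\<integral>p. inverse (plane p) * (- (1/2) * N p) \<partial>lborel)"
    unfolding cauchy.conv_def
    by (intro Bochner_Integration.integral_cong refl) (simp add: NN algebra_simps)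
  obtain B where B: "B \<ge> 0" "\<And>p. norm (N p) \<le> B" using csmooth_bounded[OF cN] by blast
  obtain S where S: "\<And>p. S < norm p \<Longrightarrow> N p = 0" using cN by (auto simp: csmooth_def)
  have [measurable]: "N \<in> borel_measurable borel" "F \<in> borel_measurable borel"
    using csmooth_measurable cN cF by auto
  have [measurable]: "reg_kernel e \<in> borel_measurable borel" if "e > 0" for e
    by (intro borel_measurable_continuous_onI smooth_on_continuous_on smooth_reg_kernel that)
  define e where "e n = inverse (real (Suc n))" for n
  have e: "e n > 0" for n by (simp add: e_def)
  have lim1: "(\<lambda>n. \<integral>p. reg_kernel (e n) p * (- (1/2) * N p) \<partial>lborel) \<longlonglongrightarrow>
      (\<integral>p. inverse (plane p) * (- (1/2) * N p) \<partial>lborel)"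
  proof (rule integral_dominated_convergence)
    show "integrable lborel (\<lambda>p. norm (if norm p \<le> S then inverse (plane p) else 0) * B)"
      by (intro integrable_mult_left integrable_norm cauchy_kernel_locally_integrable)
    show "AE p in lborel. (\<lambda>n. reg_kernel (e n) p * (- (1/2) * N p)) \<longlonglongrightarrow> inverse (plane p) * (- (1/2) * N p)"
      unfolding e_def by (intro AE_I2 tendsto_mult reg_kernel_tendsto tendsto_const)
    show "AE p in lborel. norm (reg_kernel (e n) p * (- (1/2) * N p))
        \<le> norm (if norm p \<le> S then inverse (plane p) else 0) * B" for n
    proof (rule AE_I2)
      fix p
      show "norm (reg_kernel (e n) p * (- (1/2) * N p)) \<le> norm (if norm p \<le> S then inverse (plane p) else 0) * B"
      proof (cases "norm p \<le> S")
        case True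
        have "norm (- (1/2) * N p) \<le> B" using B(2)[of p] B(1) by (simp add: norm_mult)
        then have "norm (reg_kernel (e n) p) * norm (- (1/2) * N p) \<le> norm (inverse (plane p)) * B"
          using reg_kernel_le[OF e, of n p] by (intro mult_mono) simp_all
        then show ?thesis using True unfolding norm_mult[of "reg_kernel (e n) p"] by simp
      qed (use S in simp)
    qed
    show "(\<lambda>p. inverse (plane p) * (- (1/2) * N p)) \<in> borel_measurable lborel" by measurable
    show "(\<lambda>p. reg_kernel (e n) p * (- (1/2) * N p)) \<in> borel_measurable lborel" for n
      using e[of n] by measurable
  qed
  \<comment> \<open>Integration by parts, followed by the substitution \<open>p \<mapsto> e n *\<^sub>R p\<close>.\<close>
  have parts: "(\<integral>p. reg_kernel (e n) p * (- (1/2) * N p) \<partial>lborel)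
      = (\<integral>p. F (e n *\<^sub>R p) * of_real (inverse (((norm p)\<^sup>2 + 1)\<^sup>2)) \<partial>lborel)" for n
  proof -
    let ?k = "reg_kernel (e n)"
    have ck: "csmooth (\<lambda>p. ?k p * F p)" by (rule csmooth_mult_right[OF cF smooth_reg_kernel[OF e]])
    have dk: "?k differentiable at p" "F differentiable at p" for p
      using smooth_on_differentiable[OF smooth_reg_kernel[OF e]] csmooth_differentiable[OF cF] by auto
    let ?G = "\<lambda>p. of_real (2 * (e n)\<^sup>2 / ((norm p)\<^sup>2 + (e n)\<^sup>2)\<^sup>2) * F p"
    have D: "Der (1, 0) (\<lambda>p. ?k p * F p) p + \<i> * Der (0, 1) (\<lambda>p. ?k p * F p) p = ?k p * N p + ?G p" for p
    proof -
      have "Der (1, 0) (\<lambda>p. ?k p * F p) p + \<i> * Der (0, 1) (\<lambda>p. ?k p * F p) p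
        = ?k p * N p + (Der (1, 0) ?k p + \<i> * Der (0, 1) ?k p) * F p"
        unfolding Der_mult[OF dk] N_def by (simp add: algebra_simps)
      then show ?thesis unfolding dbar_reg_kernel[OF e] .
    qed
    have ikN: "integrable lborel (\<lambda>p. ?k p * N p)"
      by (rule csmooth_integrable[OF csmooth_mult_right[OF cN smooth_reg_kernel[OF e]]])
    have iD: "integrable lborel (Der q (\<lambda>p. ?k p * F p))" for q
      by (rule csmooth_integrable[OF csmooth_Der[OF ck]])
    have iG: "integrable lborel ?G"
    proof -
      have "?G = (\<lambda>p. (Der (1, 0) (\<lambda>p. ?k p * F p) p + \<i> * Der (0, 1) (\<lambda>p. ?k p * F p) p) - ?k p * N p)"
        unfolding D by simp
      then show ?thesis using iD ikN by (simp add: Bochner_Integration.integrable_diff)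
    qed
    have "(\<integral>p. ?k p * N p \<partial>lborel) + (\<integral>p. ?G p \<partial>lborel) = (\<integral>p. ?k p * N p + ?G p \<partial>lborel)"
      by (rule Bochner_Integration.integral_add[symmetric, OF ikN iG])
    also have "\<dots> = (\<integral>p. Der (1, 0) (\<lambda>p. ?k p * F p) p + \<i> * Der (0, 1) (\<lambda>p. ?k p * F p) p \<partial>lborel)"
      unfolding D ..
    also have "\<dots> = 0"
      using iD integral_Der_zero[OF ck] by (simp add: Bochner_Integration.integral_add)
    finally have *: "(\<integral>p. ?k p * N p \<partial>lborel) = - (\<integral>p. ?G p \<partial>lborel)"
      by (simp add: eq_neg_iff_add_eq_0)
    have "(\<integral>p. ?k p * (- (1/2) * N p) \<partial>lborel) = - (1/2) * (\<integral>p. ?k p * N p \<partial>lborel)"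
      by (subst integral_mult_right_zero[symmetric]) (simp add: mult_ac)
    also have "\<dots> = (1/2) * (\<integral>p. ?G p \<partial>lborel)" unfolding * by simp
    also have "(\<integral>p. ?G p \<partial>lborel) = (\<integral>p. ?G p \<partial>density (distr lborel borel (\<lambda>x. 0 + e n *\<^sub>R x)) (\<lambda>_. \<bar>e n\<bar>^DIM(real \<times> real)))"
      using e[of n] by (subst lborel_affine[of "e n" 0]) auto
    also have "\<dots> = (\<integral>p. (e n)\<^sup>2 *\<^sub>R ?G (e n *\<^sub>R p) \<partial>lborel)"
      using e[of n] by (subst integral_density) (auto simp: integral_distr power2_eq_square)
    also have "(1/2) * \<dots> = (\<integral>p. (1/2) * ((e n)\<^sup>2 *\<^sub>R ?G (e n *\<^sub>R p)) \<partial>lborel)"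
      by (rule integral_mult_right_zero[symmetric])
    also have "(\<lambda>p. (1/2) * ((e n)\<^sup>2 *\<^sub>R ?G (e n *\<^sub>R p))) = (\<lambda>p. F (e n *\<^sub>R p) * of_real (inverse (((norm p)\<^sup>2 + 1)\<^sup>2)))"
    proof
      fix p :: "real \<times> real"
      have 1: "(norm (e n *\<^sub>R p))\<^sup>2 + (e n)\<^sup>2 = (e n)\<^sup>2 * ((norm p)\<^sup>2 + 1)"
        by (simp add: power_mult_distrib algebra_simps)
      have pos: "(norm p)\<^sup>2 + 1 > 0" by (simp add: add_nonneg_pos)
      have "(e n)\<^sup>2 * (2 * (e n)\<^sup>2 / ((norm (e n *\<^sub>R p))\<^sup>2 + (e n)\<^sup>2)\<^sup>2) = 2 * inverse (((norm p)\<^sup>2 + 1)\<^sup>2)"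
      proof -
        have "d * (2 * d / (d * q)\<^sup>2) = 2 * inverse (q\<^sup>2)" if "d > 0" "q > 0" for d q :: real
          using that by (simp add: power2_eq_square divide_inverse mult.assoc[symmetric])
        then show ?thesis unfolding 1 using e[of n] pos by simp
      qed
      moreover have "(1/2) * (A *\<^sub>R (of_real Q * w)) = w * of_real c" if "A * Q = 2 * c" for A Q c and w :: complex
      proof -
        have "A *\<^sub>R (of_real Q * w) = of_real (A * Q) * w" by (simp add: scaleR_conv_of_real)
        then show ?thesis by (simp add: that)
      qed
      ultimately show "(1/2) * ((e n)\<^sup>2 *\<^sub>R ?G (e n *\<^sub>R p)) = F (e n *\<^sub>R p) * of_real (inverse (((norm p)\<^sup>2 + 1)\<^sup>2))"
        by blast
    qed
    finally show ?thesis .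
  qed
  obtain BF where BF: "\<And>p. norm (F p) \<le> BF" using csmooth_bounded[OF cF] by blast
  have lim2: "(\<lambda>n. \<integral>p. F (e n *\<^sub>R p) * of_real (inverse (((norm p)\<^sup>2 + 1)\<^sup>2)) \<partial>lborel) \<longlonglongrightarrow>
      (\<integral>p. F 0 * of_real (inverse (((norm (p :: real \<times> real))\<^sup>2 + 1)\<^sup>2)) \<partial>lborel)"
  proof (rule integral_dominated_convergence)
    show "integrable lborel (\<lambda>p::real \<times> real. BF * inverse (((norm p)\<^sup>2 + 1)\<^sup>2))"
      by (intro integrable_mult_right integrable_cauchy_const)
    show "AE p::real \<times> real in lborel. (\<lambda>n. F (e n *\<^sub>R p) * of_real (inverse (((norm p)\<^sup>2 + 1)\<^sup>2))) \<longlonglongrightarrow>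
        F 0 * of_real (inverse (((norm p)\<^sup>2 + 1)\<^sup>2))"
    proof (intro AE_I2 tendsto_mult tendsto_const)
      fix p :: "real \<times> real"
      have "isCont F 0" using csmooth_differentiable[OF cF] by (rule differentiable_imp_continuous_within)
      moreover have "(\<lambda>n. e n *\<^sub>R p) \<longlonglongrightarrow> 0 *\<^sub>R p"
        unfolding e_def by (intro tendsto_intros LIMSEQ_inverse_real_of_nat)
      ultimately show "(\<lambda>n. F (e n *\<^sub>R p)) \<longlonglongrightarrow> F 0"
        using isCont_tendsto_compose[of 0 F] by simp
    qed
    show "AE p::real \<times> real in lborel. norm (F (e n *\<^sub>R p) * of_real (inverse (((norm p)\<^sup>2 + 1)\<^sup>2)))
        \<le> BF * inverse (((norm p)\<^sup>2 + 1)\<^sup>2)" for n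
    proof (rule AE_I2)
      fix p :: "real \<times> real"
      have "0 \<le> inverse (((norm p)\<^sup>2 + 1)\<^sup>2)" by simp
      then show "norm (F (e n *\<^sub>R p) * of_real (inverse (((norm p)\<^sup>2 + 1)\<^sup>2))) \<le> BF * inverse (((norm p)\<^sup>2 + 1)\<^sup>2)"
        unfolding norm_mult norm_of_real by (simp only: abs_of_nonneg mult_right_mono[OF BF])
    qed
    show "(\<lambda>p::real \<times> real. F 0 * of_real (inverse (((norm p)\<^sup>2 + 1)\<^sup>2))) \<in> borel_measurable lborel" by measurable
    show "(\<lambda>p::real \<times> real. F (e n *\<^sub>R p) * of_real (inverse (((norm p)\<^sup>2 + 1)\<^sup>2))) \<in> borel_measurable lborel" for n
      by measurable
  qed
  have "(\<integral>p. inverse (plane p) * (- (1/2) * N p) \<partial>lborel)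
      = (\<integral>p. F 0 * of_real (inverse (((norm (p :: real \<times> real))\<^sup>2 + 1)\<^sup>2)) \<partial>lborel)"
    using LIMSEQ_unique[OF lim1] lim2 unfolding parts by blast
  also have "\<dots> = F 0 * of_real cauchy_const"
    unfolding cauchy_const_def by (simp only: integral_mult_right_zero integral_complex_of_real)
  finally show ?thesis unfolding lhs by (simp add: F_def embed_def mult.commute)
qed

end

section \<open>Wirtinger derivatives and the Cauchy-Riemann equations with compact support\<close>

text \<open>
  The parameter \<open>s\<close> is \<open>- \<i>\<close> for \<open>\<partial>/\<partial>z\<^sub>k\<close> and \<open>\<i>\<close> for its conjugate; all rules are the same for both.
\<close>

definition wop :: "complex \<Rightarrow> 'n \<Rightarrow> (complex ^ 'n::finite \<Rightarrow> complex) \<Rightarrow> complex ^ 'n \<Rightarrow> complex" where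
  "wop s k f z = (Der (axis k 1) f z + s * Der (axis k \<i>) f z) / 2"

lemma wirtinger_wop: "wirtinger k = wop (- \<i>) k"
  and wirtinger_bar_wop: "wirtinger_bar k = wop \<i> k"
  by (simp_all add: fun_eq_iff wop_def wirtinger_def wirtinger_bar_def)

lemma smooth_on_divide_const: "open X \<Longrightarrow> smooth_on X f \<Longrightarrow> smooth_on X (\<lambda>x. f x / c)"
  using smooth_on_mult[of X f "\<lambda>x. inverse c"] by (simp add: divide_inverse)

lemma smooth_wop: "open X \<Longrightarrow> smooth_on X f \<Longrightarrow> smooth_on X (wop s k f)"
  unfolding wop_def[abs_def]
  by (intro smooth_on_divide_const smooth_on_add smooth_on_mult smooth_on_const smooth_on_Der)

lemma csmooth_wop: "csmooth f \<Longrightarrow> csmooth (wop s k f)"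
proof -
  assume f: "csmooth f"
  have "csmooth (\<lambda>z. (1 / 2) * (Der (axis k 1) f z + s * Der (axis k \<i>) f z))"
    by (intro csmooth_cmult csmooth_add csmooth_Der f)
  then show ?thesis by (simp add: wop_def[abs_def])
qed

lemma wop_cong_open:
  assumes "open X" "x \<in> X" "\<And>y. y \<in> X \<Longrightarrow> f y = g y"
  shows "wop s k f x = wop s k g x"
proof -
  have "Der v f x = Der v g x" for v by (rule Der_cong_open[OF assms])
  then show ?thesis by (simp add: wop_def)
qed

lemma wop_zero_open:
  assumes "open X" "x \<in> X" "\<And>y. y \<in> X \<Longrightarrow> f y = 0"
  shows "wop s k f x = 0"
proof -
  have "Der v f x = 0" for v by (rule Der_zero_open[OF assms])
  then show ?thesis by (simp add: wop_def)
qed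

lemma wop_add: "f differentiable (at x) \<Longrightarrow> g differentiable (at x) \<Longrightarrow>
    wop s k (\<lambda>x. f x + g x) x = wop s k f x + wop s k g x"
  by (simp add: wop_def Der_add field_simps)

lemma wop_mult: "f differentiable (at x) \<Longrightarrow> g differentiable (at x) \<Longrightarrow>
    wop s k (\<lambda>x. f x * g x) x = f x * wop s k g x + wop s k f x * g x"
  by (simp add: wop_def Der_mult field_simps)

lemma wop_cmult: "f differentiable (at x) \<Longrightarrow> wop s k (\<lambda>x. c * f x) x = c * wop s k f x"
  using wop_mult[of "\<lambda>x. c" x f s k] by (simp add: wop_def)

lemma wop_diff: "f differentiable (at x) \<Longrightarrow> g differentiable (at x) \<Longrightarrow>
    wop s k (\<lambda>x. f x - g x) x = wop s k f x - wop s k g x"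
proof -
  assume f: "f differentiable (at x)" and g: "g differentiable (at x)"
  have g': "(\<lambda>x. (-1) * g x) differentiable (at x)" using g by (intro differentiable_mult) auto
  have "wop s k (\<lambda>x. f x - g x) x = wop s k (\<lambda>x. f x + (-1) * g x) x" by simp
  also have "\<dots> = wop s k f x - wop s k g x" unfolding wop_add[OF f g'] wop_cmult[OF g] by simp
  finally show ?thesis .
qed

lemma wop_cnj: "f differentiable (at x) \<Longrightarrow> wop s k (\<lambda>x. cnj (f x)) x = cnj (wop (cnj s) k f x)"
  by (simp add: wop_def Der_cnj)

lemma Der_wop:
  assumes "open X" "x \<in> X" "smooth_on X f"
  shows "Der v (wop s k f) x = wop s k (Der v f) x"
proof -
  have d: "Der w f differentiable (at x)" for w
    using smooth_on_differentiable[OF smooth_on_Der[OF assms(3)] assms(2)] .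
  have d2: "(\<lambda>x. s * Der w f x) differentiable (at x)" for w using d by (intro differentiable_mult) auto
  have d3: "(\<lambda>x. Der (axis k 1) f x + s * Der (axis k \<i>) f x) differentiable (at x)"
    by (intro differentiable_add d d2)
  have "Der v (wop s k f) x = Der v (\<lambda>x. (1/2) * (Der (axis k 1) f x + s * Der (axis k \<i>) f x)) x"
    by (simp add: wop_def[abs_def])
  also have "\<dots> = (1/2) * (Der v (Der (axis k 1) f) x + s * Der v (Der (axis k \<i>) f) x)"
    using Der_mult[OF _ d3, of "\<lambda>x. 1/2", where v = v] Der_add[OF d d2, where v = v] Der_mult[OF _ d, of "\<lambda>x. s", where v = v] by simp
  also have "\<dots> = wop s k (Der v f) x"
    using Der_commute[OF assms, where v = v] by (simp add: wop_def)
  finally show ?thesis .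
qed

lemma wop_commute:
  assumes "open X" "x \<in> X" "smooth_on X f"
  shows "wop s j (wop t k f) x = wop t k (wop s j f) x"
proof -
  have d: "Der w f differentiable (at x)" for w
    using smooth_on_differentiable[OF smooth_on_Der[OF assms(3)] assms(2)] .
  have d2: "(\<lambda>x. s * Der w f x) differentiable (at x)" for w using d by (intro differentiable_mult) auto
  have d3: "(\<lambda>x. Der (axis j 1) f x + s * Der (axis j \<i>) f x) differentiable (at x)"
    by (intro differentiable_add d d2)
  have E: "wop s j f = (\<lambda>x. (1/2) * (Der (axis j 1) f x + s * Der (axis j \<i>) f x))"
    by (simp add: fun_eq_iff wop_def)
  have "wop s j (wop t k f) x = (1/2) * (wop t k (Der (axis j 1) f) x + s * wop t k (Der (axis j \<i>) f) x)"
    by (simp add: wop_def[of s j "wop t k f"] Der_wop[OF assms])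
  also have "\<dots> = wop t k (\<lambda>x. (1/2) * (Der (axis j 1) f x + s * Der (axis j \<i>) f x)) x"
    unfolding wop_cmult[OF d3] wop_add[OF d d2] wop_cmult[OF d] ..
  also have "\<dots> = wop t k (wop s j f) x" by (simp add: E)
  finally show ?thesis .
qed

lemma wop_conv:
  assumes "kernel M k v" "csmooth f"
  shows "wop s j (kernel.conv M k v f) z = kernel.conv M k v (wop s j f) z"
proof -
  interpret kernel M k v by fact
  have "conv (\<lambda>x. (1 / 2) * (Der (axis j 1) f x + s * Der (axis j \<i>) f x)) z
      = (1 / 2) * (conv (Der (axis j 1) f) z + s * conv (Der (axis j \<i>) f) z)"
    unfolding conv_cmult
    by (subst conv_add) (auto intro!: csmooth_Der csmooth_cmult assms(2) simp: conv_cmult)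
  then show ?thesis by (simp add: wop_def Der_conv[OF assms(2)] wop_def[abs_def])
qed

lemma axis_Der:
  assumes "f differentiable (at y)"
  shows "Der (axis k h) f y = of_real (Re h) * Der (axis k 1) f y + of_real (Im h) * Der (axis k \<i>) f y"
proof -
  have "axis k h = Re h *\<^sub>R axis k 1 + Im h *\<^sub>R (axis k \<i> :: complex ^ 'a)"
    by (auto simp: vec_eq_iff axis_def complex_eq_iff)
  then show ?thesis using Der_linear[OF assms] by (simp add: scaleR_conv_of_real)
qed

lemma slice_field_derivative:
  fixes m :: "complex ^ 'n::finite \<Rightarrow> complex"
  assumes d: "m differentiable (at (z + axis k (w - c)))" and h: "wop \<i> k m (z + axis k (w - c)) = 0"
  shows "((\<lambda>w. m (z + axis k (w - c))) has_field_derivative Der (axis k 1) m (z + axis k (w - c))) (at w)"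
proof -
  let ?y = "z + axis k (w - c)"
  have "bounded_linear (axis k :: complex \<Rightarrow> complex ^ 'n)"
    by (intro linear_conv_bounded_linear[THEN iffD1] linearI) (auto simp: vec_eq_iff axis_def)
  then have "((\<lambda>w. axis k (w - c) :: complex ^ 'n) has_derivative (\<lambda>h. axis k h)) (at w)"
    by (rule bounded_linear.has_derivative) (auto intro!: derivative_eq_intros)
  then have "((\<lambda>w. z + axis k (w - c)) has_derivative axis k) (at w)"
    by (auto intro!: derivative_eq_intros)
  moreover have "(m has_derivative (\<lambda>v. Der v m ?y)) (at ?y)"
    using d unfolding frechet_derivative_works by simp
  ultimately have *: "((\<lambda>w. m (z + axis k (w - c))) has_derivative (\<lambda>h. Der (axis k h) m ?y)) (at w)"
    by (rule has_derivative_compose)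
  have "Der (axis k h) m ?y = Der (axis k 1) m ?y * h" for h
  proof -
    have "Der (axis k \<i>) m ?y = \<i> * Der (axis k 1) m ?y"
    proof -
      have "Der (axis k 1) m ?y + \<i> * Der (axis k \<i>) m ?y = 0" using h by (simp add: wop_def)
      then have "\<i> * (Der (axis k 1) m ?y + \<i> * Der (axis k \<i>) m ?y) = 0" by simp
      then show ?thesis by (simp add: algebra_simps)
    qed
    then have "Der (axis k h) m ?y = (of_real (Re h) + \<i> * of_real (Im h)) * Der (axis k 1) m ?y"
      unfolding axis_Der[OF d, where h = h] by (simp add: algebra_simps)
    also have "of_real (Re h) + \<i> * of_real (Im h) = h" by (rule complex_eq[symmetric])
    finally show ?thesis by (simp only: mult.commute)
  qed
  then have "(\<lambda>h. Der (axis k h) m ?y) = (*) (Der (axis k 1) m ?y)" by (rule ext)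
  with * show ?thesis by (simp only: has_field_derivative_def)
qed

text \<open>
  The identity theorem on the complex line through \<open>z\<close> in direction \<open>k\<close>, parametrised by the
  value \<open>w\<close> of the \<open>k\<close>-th coordinate.
\<close>

lemma slice_vanishes:
  fixes m :: "complex ^ 'n::finite \<Rightarrow> complex"
  assumes m: "smooth_on UNIV m" and S: "open S" "connected S" "z $ k \<in> S"
    and h: "\<And>w. w \<in> S \<Longrightarrow> wop \<i> k m (z + axis k (w - z $ k)) = 0"
    and U: "open U" "U \<noteq> {}" "U \<subseteq> S" "\<And>w. w \<in> U \<Longrightarrow> m (z + axis k (w - z $ k)) = 0"
  shows "m z = 0"
proof -
  have "(\<lambda>w. m (z + axis k (w - z $ k))) holomorphic_on S"
    using slice_field_derivative[OF smooth_on_differentiable[OF m UNIV_I] h]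
    by (meson field_differentiable_at_within field_differentiable_def holomorphic_on_def)
  from analytic_continuation_open[OF U(1) S(1) U(2) S(2) U(3) this _ _ S(3), of "\<lambda>w. 0"] U(4)
  have "m (z + axis k (z $ k - z $ k)) = 0" by simp
  moreover have "axis k (0::complex) = (0 :: complex ^ 'n)" by (simp add: vec_eq_iff axis_def)
  ultimately show ?thesis by simp
qed

text \<open>
  The complement of a compact set that avoids the line \<open>Re z\<^sub>1 = 0, z\<^sub>2 = 0\<close>: a neighbourhood of
  infinity together with a tube around the line.
\<close>

definition far :: "real \<Rightarrow> real \<Rightarrow> (complex ^ 2) set" where
  "far R e = {z. R < \<bar>Re (z $ 1)\<bar> \<or> R < \<bar>Im (z $ 1)\<bar> \<or> R < norm (z $ 2) \<or>
                (\<bar>Re (z $ 1)\<bar> < e \<and> norm (z $ 2) < e)}"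

lemma open_far: "open (far R e)"
proof -
  have "open {z :: complex ^ 2. R < \<bar>Re (z $ 1)\<bar>}" "open {z :: complex ^ 2. R < \<bar>Im (z $ 1)\<bar>}"
    "open {z :: complex ^ 2. R < norm (z $ 2)}" "open {z :: complex ^ 2. \<bar>Re (z $ 1)\<bar> < e}"
    "open {z :: complex ^ 2. norm (z $ 2) < e}"
    by (intro open_Collect_less continuous_intros)+
  then have "open ({z :: complex ^ 2. R < \<bar>Re (z $ 1)\<bar>} \<union> {z. R < \<bar>Im (z $ 1)\<bar>} \<union> {z. R < norm (z $ 2)} \<union>
      ({z. \<bar>Re (z $ 1)\<bar> < e} \<inter> {z. norm (z $ 2) < e}))" by blast
  then show ?thesis by (simp add: far_def Collect_disj_eq Collect_conj_eq Un_assoc)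
qed

lemma norm_complex2_le: "norm (z :: complex ^ 2) \<le> \<bar>Re (z $ 1)\<bar> + \<bar>Im (z $ 1)\<bar> + norm (z $ 2)"
proof -
  have "norm z \<le> (\<Sum>i\<in>UNIV. norm (z $ i))" unfolding norm_vec_def by (intro L2_set_le_sum) auto
  also have "\<dots> = norm (z $ 1) + norm (z $ 2)" by (simp add: UNIV_2)
  also have "norm (z $ 1) \<le> \<bar>Re (z $ 1)\<bar> + \<bar>Im (z $ 1)\<bar>" by (rule cmod_le)
  finally show ?thesis by simp
qed

lemma not_far_bounded: "z \<notin> far R e \<Longrightarrow> norm z \<le> 3 * R"
  using norm_complex2_le[of z] by (auto simp: far_def)

lemma csmooth_far:
  assumes "smooth_on UNIV f" "\<And>z. z \<in> far R e \<Longrightarrow> f z = 0"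
  shows "csmooth f"
  unfolding csmooth_def
proof (intro conjI assms(1) exI[of _ "3 * R"] allI impI)
  fix z :: "complex ^ 2" assume "3 * R < norm z"
  then show "f z = 0" using not_far_bounded[of z R e] assms(2)[of z] by linarith
qed

lemma compact_not_far: "compact (- far R e)"
proof -
  have "bounded (- far R e)" unfolding bounded_iff using not_far_bounded by blast
  then show ?thesis using open_far by (simp add: compact_eq_bounded_closed closed_Compl)
qed

lemma compact_avoids_far:
  assumes K: "compact K" "K \<inter> {z. Re (z $ 1) = 0 \<and> z $ 2 = 0} = {}"
  obtains R e where "R > 0" "e > 0" "K \<inter> far R e = {}"
proof (cases "K = {}")
  case True then show ?thesis using that[of 1 1] by auto
next
  case False
  define g where "g z = max \<bar>Re (z $ 1)\<bar> (norm (z $ 2))" for z :: "complex ^ 2"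
  have "continuous_on K g" unfolding g_def by (intro continuous_intros)
  then obtain w where w: "w \<in> K" "\<And>z. z \<in> K \<Longrightarrow> g w \<le> g z"
    using continuous_attains_inf[OF K(1) False] by blast
  have gw: "g w > 0" using w(1) K(2) by (auto simp: g_def less_max_iff_disj)
  obtain B where B: "\<And>z. z \<in> K \<Longrightarrow> norm z \<le> B"
    using compact_imp_bounded[OF K(1)] unfolding bounded_iff by blast
  have "z \<notin> far (\<bar>B\<bar> + 1) (g w)" if "z \<in> K" for z
  proof -
    have "norm (z $ i) \<le> B" for i using order_trans[OF Finite_Cartesian_Product.norm_nth_le B[OF that]] .
    then have "norm (z $ 1) \<le> B" "norm (z $ 2) \<le> B" by auto
    moreover have "\<bar>Re (z $ 1)\<bar> \<le> norm (z $ 1)" "\<bar>Im (z $ 1)\<bar> \<le> norm (z $ 1)"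
      by (rule abs_Re_le_cmod abs_Im_le_cmod)+
    moreover have "g w \<le> \<bar>Re (z $ 1)\<bar> \<or> g w \<le> norm (z $ 2)"
      using w(2)[OF that] unfolding g_def[of z] by (simp add: le_max_iff_disj)
    ultimately show ?thesis by (auto simp: far_def)
  qed
  then show ?thesis using gw by (intro that[of "\<bar>B\<bar> + 1" "g w"]) auto
qed

interpretation pair1: orthonormal_pair "axis 1 1 :: complex ^ 2" "axis 1 \<i> :: complex ^ 2"
proof
  show "norm (axis 1 1 :: complex ^ 2) = 1" "norm (axis 1 \<i> :: complex ^ 2) = 1"
    by (simp_all add: norm_eq_1 inner_axis_axis)
  show "(axis 1 1 :: complex ^ 2) \<bullet> axis 1 \<i> = 0"
    by (simp add: inner_axis_axis)
qed

lemma embed_nth: "pair1.embed p $ 1 = plane p" "pair1.embed p $ 2 = 0"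
  unfolding pair1.embed_def plane_def by (simp_all add: axis_def complex_eq_iff)

text \<open>
  Vanishing of the first cohomology with compact supports in \<open>X\<close> of the sheaf of holomorphic
  functions.  The Cauchy transform in \<open>z\<^sub>1\<close> solves the equation on \<open>\<complex>\<^sup>2\<close>.  Outside the support of the
  data the solution is holomorphic in each variable, and it vanishes for large \<open>z\<^sub>2\<close>, so the identity
  theorem first makes it vanish for large \<open>z\<^sub>1\<close>.  Along the tube around the line it is again
  holomorphic in \<open>z\<^sub>1\<close>, and the tube reaches infinity; this is the place where it matters that the
  removed set is not compact.
\<close>

lemma dbar_compact:
  assumes f: "smooth_on UNIV f1" "smooth_on UNIV f2"
    and v: "\<And>z. z \<in> far R e \<Longrightarrow> f1 z = 0" "\<And>z. z \<in> far R e \<Longrightarrow> f2 z = 0"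
    and e: "e > 0" and closed: "\<And>z. wop \<i> 1 f2 z = wop \<i> 2 f1 z"
  obtains m where "smooth_on UNIV m" "\<And>z. z \<in> far R e \<Longrightarrow> m z = 0"
    "\<And>z. wop \<i> 1 m z = f1 z" "\<And>z. wop \<i> 2 m z = f2 z"
proof -
  have c: "csmooth f1" "csmooth f2" using csmooth_far f v by blast+
  define T where "T = pair1.cauchy.conv"
  define m where "m z = of_real (inverse cauchy_const) * T f1 z" for z
  have sT: "smooth_on UNIV (T f1)" unfolding T_def by (rule pair1.cauchy.smooth_conv[OF c(1)])
  have Tw: "wop s k (T f) z = T (wop s k f) z" if "csmooth f" for s k f z
    unfolding T_def by (rule wop_conv[OF pair1.cauchy.kernel_axioms that])
  have T1: "T (wop \<i> 1 f) z = of_real cauchy_const * f z" if "csmooth f" for f z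
    using pair1.cauchy_dbar[OF that, of z] by (simp add: T_def wop_def[abs_def])
  have mw: "wop s k m z = of_real (inverse cauchy_const) * T (wop s k f1) z" for s k z
    unfolding m_def[abs_def] Tw[OF c(1), symmetric]
    by (rule wop_cmult[OF smooth_on_differentiable[OF sT UNIV_I]])
  have cancel: "of_real (inverse cauchy_const) * (of_real cauchy_const * w) = w" for w :: complex
    using cauchy_const_nonzero by (simp add: mult.assoc[symmetric] of_real_mult[symmetric] del: of_real_mult of_real_inverse)
  have m1: "wop \<i> 1 m z = f1 z" for z unfolding mw T1[OF c(1)] cancel ..
  have "wop \<i> 2 f1 = wop \<i> 1 f2" using closed by auto
  then have m2: "wop \<i> 2 m z = f2 z" for z unfolding mw by (simp only: T1[OF c(2)] cancel)
  have sm: "smooth_on UNIV m" unfolding m_def by (intro smooth_on_mult smooth_on_const open_UNIV sT)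
  have z2: "m z = 0" if "R < norm (z $ 2)" for z
  proof -
    have "z - pair1.embed t \<in> far R e" for t using that by (simp add: far_def embed_nth)
    then have "T f1 z = 0" unfolding T_def by (intro pair1.cauchy.conv_zero v)
    then show ?thesis by (simp add: m_def)
  qed
  have z1: "m z = 0" if z: "R < \<bar>Re (z $ 1)\<bar> \<or> R < \<bar>Im (z $ 1)\<bar>" for z
  proof (rule slice_vanishes[OF sm open_UNIV connected_UNIV, of z 2])
    show "wop \<i> 2 m (z + axis 2 (w - z $ 2)) = 0" for w
      unfolding m2 by (rule v(2)) (use z in \<open>auto simp: far_def axis_def\<close>)
    show "open {w::complex. R < norm w}" by (intro open_Collect_less continuous_intros)
    show "{w::complex. R < norm w} \<noteq> {}"
    proof -
      have "of_real (\<bar>R\<bar> + 1) \<in> {w::complex. R < norm w}" by simp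
      then show ?thesis by blast
    qed
    show "m (z + axis 2 (w - z $ 2)) = 0" if "w \<in> {w. R < norm w}" for w
      by (rule z2) (use that in \<open>simp add: axis_def\<close>)
  qed auto
  have z0: "m z = 0" if z: "\<bar>Re (z $ 1)\<bar> < e" "norm (z $ 2) < e" for z
  proof (rule slice_vanishes[OF sm, where S = "{w. \<bar>Re w\<bar> < e}" and k = 1 and U = "{w. \<bar>Re w\<bar> < e} \<inter> {w. R < Im w}"])
    show o: "open {w. \<bar>Re w\<bar> < e}" by (intro open_Collect_less continuous_intros)
    have "{w. \<bar>Re w\<bar> < e} = {w. Re w < e} \<inter> {w. - e < Re w}" by auto
    moreover have "convex {w. Re w < e}" "convex {w. - e < Re w}"
      by (rule convex_halfspace_Re_lt convex_halfspace_Re_gt)+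
    ultimately show "connected {w. \<bar>Re w\<bar> < e}" by (simp add: convex_Int convex_connected)
    show "z $ 1 \<in> {w. \<bar>Re w\<bar> < e}" using z by simp
    show "wop \<i> 1 m (z + axis 1 (w - z $ 1)) = 0" if "w \<in> {w. \<bar>Re w\<bar> < e}" for w
      unfolding m1 by (rule v(1)) (use z that in \<open>auto simp: far_def axis_def\<close>)
    show "open ({w. \<bar>Re w\<bar> < e} \<inter> {w. R < Im w})"
      by (intro open_Int o open_Collect_less continuous_intros)
    have "Complex 0 (R + 1) \<in> {w. \<bar>Re w\<bar> < e} \<inter> {w. R < Im w}" using e by simp
    then show "{w. \<bar>Re w\<bar> < e} \<inter> {w. R < Im w} \<noteq> {}" by blast
    show "m (z + axis 1 (w - z $ 1)) = 0" if "w \<in> {w. \<bar>Re w\<bar> < e} \<inter> {w. R < Im w}" for w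
      by (rule z1) (use that in \<open>auto simp: axis_def\<close>)
  qed auto
  show ?thesis
    by (rule that[OF sm _ m1 m2]) (use z0 z1 z2 in \<open>auto simp: far_def\<close>)
qed

lemma d_compact:
  assumes f: "smooth_on UNIV f1" "smooth_on UNIV f2"
    and v: "\<And>z. z \<in> far R e \<Longrightarrow> f1 z = 0" "\<And>z. z \<in> far R e \<Longrightarrow> f2 z = 0"
    and e: "e > 0" and closed: "\<And>z. wop (- \<i>) 1 f2 z = wop (- \<i>) 2 f1 z"
  obtains m where "smooth_on UNIV m" "\<And>z. z \<in> far R e \<Longrightarrow> m z = 0"
    "\<And>z. wop (- \<i>) 1 m z = f1 z" "\<And>z. wop (- \<i>) 2 m z = f2 z"
proof (rule dbar_compact[of "\<lambda>z. cnj (f1 z)" "\<lambda>z. cnj (f2 z)" R e])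
  have d: "f1 differentiable (at z)" "f2 differentiable (at z)" for z
    using smooth_on_differentiable[OF f(1) UNIV_I] smooth_on_differentiable[OF f(2) UNIV_I] .
  show "smooth_on UNIV (\<lambda>z. cnj (f1 z))" "smooth_on UNIV (\<lambda>z. cnj (f2 z))"
    by (intro smooth_on_cnj open_UNIV f)+
  show "wop \<i> 1 (\<lambda>z. cnj (f2 z)) z = wop \<i> 2 (\<lambda>z. cnj (f1 z)) z" for z
    unfolding wop_cnj[OF d(1)] wop_cnj[OF d(2)] using closed[of z] by simp
  fix m assume m: "smooth_on UNIV m" "\<And>z. z \<in> far R e \<Longrightarrow> m z = 0"
    "\<And>z. wop \<i> 1 m z = cnj (f1 z)" "\<And>z. wop \<i> 2 m z = cnj (f2 z)"
  have dm: "m differentiable (at z)" for z using smooth_on_differentiable[OF m(1) UNIV_I] .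
  show ?thesis
  proof (rule that[of "\<lambda>z. cnj (m z)"])
    show "smooth_on UNIV (\<lambda>z. cnj (m z))" by (intro smooth_on_cnj open_UNIV m)
    show "wop (- \<i>) 1 (\<lambda>z. cnj (m z)) z = f1 z" "wop (- \<i>) 2 (\<lambda>z. cnj (m z)) z = f2 z" for z
      unfolding wop_cnj[OF dm] by (simp_all add: m)
  qed (simp add: m)
qed (use v e in auto)

section \<open>A smooth step function\<close>

text \<open>
  Polynomials in \<open>1 / x\<close> times \<open>exp (- 1 / x)\<close>, extended by \<open>0\<close>, are closed under derivation.
\<close>

definition flat :: "real poly \<Rightarrow> real \<Rightarrow> real" where
  "flat p x = (if x > 0 then poly p (inverse x) * exp (- inverse x) else 0)"

lemma poly_times_exp_tendsto_0:
  "((\<lambda>y. y ^ k * poly p y * exp (- y)) \<longlongrightarrow> 0) at_top" for p :: "real poly"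
proof (induction p arbitrary: k)
  case (pCons a p)
  have "((\<lambda>y. a * (y ^ k / exp y) + y ^ Suc k * poly p y * exp (- y)) \<longlongrightarrow> a * 0 + 0) at_top"
    by (intro tendsto_add tendsto_mult tendsto_const tendsto_power_div_exp_0 pCons.IH)
  then show ?case by (simp add: exp_minus divide_inverse algebra_simps)
qed simp

lemma flat_derivative:
  "(flat p has_real_derivative flat ([:0, 0, 1:] * (p - pderiv p)) x) (at x)"
proof -
  consider "x > 0" | "x < 0" | "x = 0" by linarith
  then show ?thesis
  proof cases
    case 1
    have "((\<lambda>x. poly p (inverse x) * exp (- inverse x)) has_real_derivative
        flat ([:0, 0, 1:] * (p - pderiv p)) x) (at x)"
      using 1 by (auto intro!: derivative_eq_intros simp: flat_def algebra_simps power2_eq_square)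
    then show ?thesis
      by (rule DERIV_cong_ev[THEN iffD1, rotated -1])
         (use 1 eventually_nhds_in_open[of "{0<..}" x] in \<open>auto simp: flat_def elim!: eventually_mono\<close>)
  next
    case 2
    have "((\<lambda>x. 0) has_real_derivative flat ([:0, 0, 1:] * (p - pderiv p)) x) (at x)"
      using 2 by (simp add: flat_def)
    then show ?thesis
      by (rule DERIV_cong_ev[THEN iffD1, rotated -1])
         (use 2 eventually_nhds_in_open[of "{..<0}" x] in \<open>auto simp: flat_def elim!: eventually_mono\<close>)
  next
    case 3
    have "((\<lambda>h. flat p h / h) \<longlongrightarrow> 0) (at_right 0)"
    proof (rule Lim_transform_eventually)
      show "((\<lambda>h. inverse h ^ 1 * poly p (inverse h) * exp (- inverse h)) \<longlongrightarrow> 0) (at_right 0)"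
        by (rule filterlim_compose[OF poly_times_exp_tendsto_0 filterlim_inverse_at_top_right])
      show "\<forall>\<^sub>F h in at_right 0. inverse h ^ 1 * poly p (inverse h) * exp (- inverse h) = flat p h / h"
        using eventually_at_right_less[of "0::real"]
        by eventually_elim (simp add: flat_def divide_inverse)
    qed
    moreover have "((\<lambda>h. flat p h / h) \<longlongrightarrow> 0) (at_left 0)"
    proof (rule Lim_transform_eventually)
      show "\<forall>\<^sub>F h in at_left 0. 0 = flat p h / h"
        using eventually_at_left_real[of "-1" 0]
        by (auto simp: flat_def elim!: eventually_mono)
    qed simp
    ultimately have "((\<lambda>h. flat p h / h) \<longlongrightarrow> 0) (at 0)"
      by (intro filterlim_split_at)
    then show ?thesis using 3 by (simp add: DERIV_def flat_def)
  qed
qed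

lemma smooth_flat: "smooth_on UNIV (\<lambda>x. of_real (flat p x))"
proof (rule smooth_on_coinduct[where P = "\<lambda>g. \<exists>c p. g = (\<lambda>x. c * of_real (flat p x))"])
  show "\<exists>c q. (\<lambda>x. complex_of_real (flat p x)) = (\<lambda>x. c * of_real (flat q x))"
    by (rule exI[of _ 1], rule exI[of _ p]) simp
  fix g :: "real \<Rightarrow> complex" assume "\<exists>c p. g = (\<lambda>x. c * of_real (flat p x))"
  then obtain c p where g: "g = (\<lambda>x. c * of_real (flat p x))" by blast
  let ?q = "[:0, 0, 1:] * (p - pderiv p)"
  have d: "(g has_derivative (\<lambda>v. c * of_real (flat ?q x * v))) (at x)" for x
  proof -
    have "(flat p has_derivative (\<lambda>v. flat ?q x * v)) (at x)"
      using flat_derivative[of p x] by (simp add: has_field_derivative_def)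
    from bounded_linear.has_derivative[OF bounded_linear_const_mult[OF bounded_linear_of_real] this, of c]
    show ?thesis unfolding g .
  qed
  show "g differentiable at x" for x using d by (rule differentiableI)
  show "\<exists>h. (\<exists>c p. h = (\<lambda>x. c * complex_of_real (flat p x))) \<and> (\<forall>x\<in>UNIV. Der v g x = h x)" for v
  proof (intro exI[of _ "\<lambda>x. (c * of_real v) * of_real (flat ?q x)"] conjI ballI)
    show "\<exists>c' p'. (\<lambda>x. (c * of_real v) * complex_of_real (flat ?q x)) = (\<lambda>x. c' * of_real (flat p' x))"
      by (intro exI) (rule refl)
    show "Der v g x = (c * of_real v) * of_real (flat ?q x)" for x
      unfolding Der_eqI[OF d] by (simp only: of_real_mult mult_ac)
  qed
qed auto

definition step :: "real \<Rightarrow> real" where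
  "step x = flat 1 x / (flat 1 x + flat 1 (1 - x))"

lemma step_denominator: "flat 1 x + flat 1 (1 - x) > 0"
  by (auto simp: flat_def add_pos_nonneg add_nonneg_pos)

lemma step_0: "x \<le> 0 \<Longrightarrow> step x = 0" and step_1: "x \<ge> 1 \<Longrightarrow> step x = 1"
  and step_nonneg: "step x \<ge> 0"
  by (auto simp: step_def flat_def)

lemma smooth_step: "smooth_on UNIV (\<lambda>x. of_real (step x))"
proof -
  have "smooth_on UNIV (\<lambda>x. of_real (flat 1 (1 + (- x))) :: complex)"
    by (rule smooth_on_affine(1)[OF smooth_flat]) (intro bounded_linear_minus bounded_linear_ident)
  moreover have "of_real (flat 1 x) + of_real (flat 1 (1 + (- x))) \<noteq> (0 :: complex)" for x
    using step_denominator[of x] by (simp add: of_real_add[symmetric] del: of_real_add)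
  ultimately have "smooth_on UNIV (\<lambda>x. of_real (flat 1 x) * inverse (of_real (flat 1 x) + of_real (flat 1 (1 + (- x)))) :: complex)"
    by (intro smooth_on_mult smooth_on_inverse smooth_on_add open_UNIV smooth_flat)
  then show ?thesis by (simp add: step_def divide_inverse)
qed

section \<open>Integration in the direction of the line\<close>

lemma kernel_bounded:
  fixes k :: "'m::euclidean_space \<Rightarrow> complex" and v :: "'m \<Rightarrow> 'a::euclidean_space"
  assumes [measurable]: "k \<in> borel_measurable borel" and k: "\<And>t. norm (k t) \<le> 1"
    and v: "bounded_linear v" "\<And>t. norm (v t) = norm t"
  shows "kernel lborel k v"
proof
  show "k \<in> borel_measurable lborel" by simp
  show "v \<in> borel_measurable lborel"
    using borel_measurable_continuous_onI[OF linear_continuous_on[OF v(1), of UNIV]] by simp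
  fix R
  have "integrable lborel (\<lambda>x::'m. indicator (cball 0 R) x *\<^sub>R (1::real))"
    by (rule borel_integrable_compact) auto
  then show "integrable lborel (\<lambda>t. if norm (v t) \<le> R then k t else 0)"
    by (rule Bochner_Integration.integrable_bound) (auto simp: v k)
qed

abbreviation E1 :: "complex ^ 2" where "E1 \<equiv> axis 1 1"
abbreviation I1 :: "complex ^ 2" where "I1 \<equiv> axis 1 \<i>"

lemma bl_I1: "bounded_linear (\<lambda>t. t *\<^sub>R I1)"
  by (intro bounded_linear_scaleR_const bounded_linear_ident)

text \<open>
  The three operators integrate over the half-line \<open>{z - t \<i> | t \<ge> 0}\<close>, the line and the half-plane
  \<open>{z - t - u \<i> | t \<ge> 0}\<close> in the \<open>z\<^sub>1\<close>-coordinate.  The first inverts the derivative along the line,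
  and the derivative of the third in the direction \<open>E1\<close> is the second.
\<close>

interpretation half: kernel "lborel :: real measure" "\<lambda>t. indicator {0..} t" "\<lambda>t. t *\<^sub>R I1"
  by (rule kernel_bounded[OF _ _ bl_I1]) (use pair1.b in \<open>auto simp: indicator_def\<close>)

interpretation line: kernel "lborel :: real measure" "\<lambda>t. 1" "\<lambda>t. t *\<^sub>R I1"
  by (rule kernel_bounded[OF _ _ bl_I1]) (use pair1.b in auto)

interpretation hplane: kernel "lborel :: (real \<times> real) measure" "\<lambda>p. indicator {0..} (fst p)" pair1.embed
proof (rule kernel_bounded[OF _ _ pair1.bounded_linear_embed pair1.norm_embed])
  have "(fst :: real \<times> real \<Rightarrow> real) \<in> borel_measurable borel"
    by (intro borel_measurable_continuous_onI continuous_intros)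
  moreover have "(indicator {0..} :: real \<Rightarrow> complex) \<in> borel_measurable borel" by measurable
  ultimately show "(\<lambda>p :: real \<times> real. indicator {0..} (fst p) :: complex) \<in> borel_measurable borel"
    by (rule measurable_compose)
qed (simp add: indicator_def)

lemma half_Der: "csmooth f \<Longrightarrow> half.conv (Der I1 f) z = f z"
  using has_bochner_integral_integral_eq[OF half_line_integral[of f I1 z]] pair1.b
  unfolding half.conv_def by fastforce

lemma line_Der:
  assumes f: "csmooth f" shows "line.conv (Der I1 f) z = 0"
proof -
  define F where "F t = f (z + (- (t *\<^sub>R I1)))" for t
  have bl: "bounded_linear (\<lambda>t. - (t *\<^sub>R I1))" by (intro bounded_linear_minus bl_I1)
  have sF: "smooth_on UNIV F" unfolding F_def by (rule smooth_on_affine(1)[OF csmooth_smooth[OF f] bl])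
  have DF: "Der 1 F t = - Der I1 f (z - t *\<^sub>R I1)" for t
  proof -
    have "Der 1 F t = Der ((-1) *\<^sub>R I1) f (z - t *\<^sub>R I1)"
      unfolding F_def using smooth_on_affine(2)[OF csmooth_smooth[OF f] bl, where q = 1 and z = z and p = t] by simp
    then show ?thesis unfolding Der_linear(2)[OF csmooth_differentiable[OF f]] by simp
  qed
  obtain R where R: "\<And>x. R < norm x \<Longrightarrow> f x = 0" using f by (auto simp: csmooth_def)
  have "csmooth F"
    unfolding csmooth_def
  proof (intro conjI sF exI[of _ "norm z + R"] allI impI)
    fix t :: real assume t: "norm z + R < norm t"
    have "norm (t *\<^sub>R I1) = norm t" using pair1.b by simp
    then have "R < norm (z - t *\<^sub>R I1)"
      using norm_triangle_ineq2[of "t *\<^sub>R I1" z] t by (simp add: norm_minus_commute)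
    then show "F t = 0" using R by (simp add: F_def)
  qed
  from integral_Der_zero[OF this, of 1] show ?thesis
    by (simp add: DF line.conv_def)
qed

lemma hplane_integrable:
  assumes f: "csmooth f"
  shows "integrable (lborel \<Otimes>\<^sub>M lborel) (\<lambda>(t, u). indicator {0..} t * f (z - pair1.embed (t, u)))"
  using hplane.conv_integrable[OF f, of z] by (simp add: lborel_prod case_prod_beta')

lemma hplane_Der_line:
  assumes f: "csmooth f" shows "hplane.conv (Der I1 f) z = 0"
proof -
  have "hplane.conv (Der I1 f) z
    = integral\<^sup>L (lborel \<Otimes>\<^sub>M lborel) (\<lambda>(t, u). indicator {0..} t * Der I1 f (z - pair1.embed (t, u)))"
    by (simp add: hplane.conv_def lborel_prod case_prod_beta')
  also have "\<dots> = (\<integral>t. (\<integral>u. indicator {0..} t * Der I1 f (z - pair1.embed (t, u)) \<partial>lborel) \<partial>lborel)"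
    by (rule lborel_pair.integral_fst[symmetric, OF hplane_integrable[OF csmooth_Der[OF f]]])
  also have "(\<lambda>t. \<integral>u. indicator {0..} t * Der I1 f (z - pair1.embed (t, u)) \<partial>lborel) = (\<lambda>t. 0)"
  proof
    fix t :: real
    have "(\<integral>u. indicator {0..} t * Der I1 f (z - pair1.embed (t, u)) \<partial>lborel)
      = indicator {0..} t * line.conv (Der I1 f) (z - t *\<^sub>R E1)"
      by (simp add: line.conv_def pair1.embed_def algebra_simps)
    then show "(\<integral>u. indicator {0..} t * Der I1 f (z - pair1.embed (t, u)) \<partial>lborel) = 0"
      by (simp add: line_Der[OF f])
  qed
  finally show ?thesis by simp
qed

lemma hplane_Der_normal:
  assumes f: "csmooth f" shows "hplane.conv (Der E1 f) z = line.conv f z"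
proof -
  have "hplane.conv (Der E1 f) z
    = integral\<^sup>L (lborel \<Otimes>\<^sub>M lborel) (\<lambda>(t, u). indicator {0..} t * Der E1 f (z - pair1.embed (t, u)))"
    by (simp add: hplane.conv_def lborel_prod case_prod_beta')
  also have "\<dots> = (\<integral>u. (\<integral>t. indicator {0..} t * Der E1 f (z - pair1.embed (t, u)) \<partial>lborel) \<partial>lborel)"
    by (rule lborel_pair.integral_snd[symmetric, OF hplane_integrable[OF csmooth_Der[OF f]]])
  also have "(\<lambda>u. \<integral>t. indicator {0..} t * Der E1 f (z - pair1.embed (t, u)) \<partial>lborel) = (\<lambda>u. f (z - u *\<^sub>R I1))"
  proof
    fix u :: real
    have "(\<integral>t. indicator {0..} t * Der E1 f ((z - u *\<^sub>R I1) - t *\<^sub>R E1) \<partial>lborel) = f (z - u *\<^sub>R I1)"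
      using pair1.a by (intro has_bochner_integral_integral_eq half_line_integral[OF f]) auto
    then show "(\<integral>t. indicator {0..} t * Der E1 f (z - pair1.embed (t, u)) \<partial>lborel) = f (z - u *\<^sub>R I1)"
      by (simp add: pair1.embed_def algebra_simps)
  qed
  finally show ?thesis by (simp add: line.conv_def)
qed

lemma I1_nth: "I1 $ 1 = \<i>" "I1 $ 2 = 0"
  by (simp_all add: axis_def)

lemma half_eq_line:
  assumes "\<And>z. R < \<bar>Im (z $ 1)\<bar> \<Longrightarrow> f z = 0" "R < Im (z $ 1)"
  shows "half.conv f z = line.conv f z"
  unfolding half.conv_def line.conv_def
proof (intro Bochner_Integration.integral_cong refl)
  fix t :: real
  show "indicator {0..} t * f (z - t *\<^sub>R I1) = 1 * f (z - t *\<^sub>R I1)"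
    using assms(1)[of "z - t *\<^sub>R I1"] assms(2) by (cases "t \<ge> 0") (simp_all add: I1_nth)
qed

lemma wop1: "wop s 1 f z = (Der E1 f z + s * Der I1 f z) / 2"
  by (simp add: wop_def)

text \<open>
  Integrals over the half-plane do not change along the line, so only the derivative in the
  direction \<open>E1\<close> survives, whatever \<open>s\<close> is.
\<close>

lemma hplane_wop1:
  assumes f: "csmooth f" shows "hplane.conv (wop s 1 f) z = line.conv f z / 2"
proof -
  have "hplane.conv (\<lambda>z. (1/2) * (Der E1 f z + s * Der I1 f z)) z
     = (1/2) * (hplane.conv (Der E1 f) z + s * hplane.conv (Der I1 f) z)"
    unfolding hplane.conv_cmult
    by (subst hplane.conv_add) (auto intro!: csmooth_Der csmooth_cmult f simp: hplane.conv_cmult)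
  then show ?thesis by (simp add: wop1[abs_def] hplane_Der_line[OF f] hplane_Der_normal[OF f])
qed

lemma Der_zero_wop:
  fixes f :: "complex ^ 2 \<Rightarrow> complex"
  assumes f: "f differentiable (at z)" and w: "\<And>k. wop (- \<i>) k f z = 0" "\<And>k. wop \<i> k f z = 0"
  shows "Der v f z = 0"
proof -
  have 1: "Der (axis k 1) f z = 0" "Der (axis k \<i>) f z = 0" for k
  proof -
    have "Der (axis k 1) f z = wop (- \<i>) k f z + wop \<i> k f z" by (simp add: wop_def field_simps)
    then show a: "Der (axis k 1) f z = 0" by (simp add: w)
    show "Der (axis k \<i>) f z = 0" using w(2)[of k] a by (simp add: wop_def)
  qed
  have "v = axis 1 (v $ 1) + axis 2 (v $ 2)"
    by (auto simp: vec_eq_iff axis_def forall_2)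
  then have "Der v f z = Der (axis 1 (v $ 1)) f z + Der (axis 2 (v $ 2)) f z"
    using Der_linear(1)[OF f, of "axis 1 (v $ 1)" "axis 2 (v $ 2)"] by simp
  then show ?thesis unfolding axis_Der[OF f, where h = "v $ 1"] axis_Der[OF f, where h = "v $ 2"] by (simp add: 1)
qed

lemma constant_on_convex:
  fixes f :: "complex ^ 2 \<Rightarrow> complex"
  assumes U: "convex U" and f: "smooth_on UNIV f"
    and w: "\<And>z k. z \<in> U \<Longrightarrow> wop (- \<i>) k f z = 0" "\<And>z k. z \<in> U \<Longrightarrow> wop \<i> k f z = 0"
    and xy: "x \<in> U" "y \<in> U"
  shows "f x = f y"
proof -
  have "\<exists>c. \<forall>x\<in>U. f x = c"
  proof (rule has_derivative_zero_constant[OF U])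
    fix x assume x: "x \<in> U"
    have "(f has_derivative (\<lambda>v. Der v f x)) (at x within U)"
      using smooth_on_has_derivative[OF f UNIV_I] has_derivative_at_withinI by blast
    also have "(\<lambda>v. Der v f x) = (\<lambda>v. 0)"
      using Der_zero_wop[OF smooth_on_differentiable[OF f UNIV_I] w(1)[OF x] w(2)[OF x]] by auto
    finally show "(f has_derivative (\<lambda>v. 0)) (at x within U)" .
  qed
  then show ?thesis using xy by auto
qed

section \<open>Exactness of Aeppli cocycles without period\<close>

abbreviation del_op where "del_op \<equiv> wop (- \<i>)"
abbreviation dbar_op where "dbar_op \<equiv> wop \<i>"

lemma wop1_difference: "del_op 1 f z - dbar_op 1 f z = - \<i> * Der I1 f z"
  by (simp add: wop_def field_simps)

lemma half_difference:
  assumes c: "csmooth u" "csmooth w" "csmooth f" and eq: "\<And>z. u z - w z = - \<i> * Der I1 f z"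
  shows "\<i> * half.conv u z - \<i> * half.conv w z = f z"
proof -
  have "\<i> * half.conv u z - \<i> * half.conv w z = \<i> * half.conv (\<lambda>z. u z - w z) z"
    by (simp add: half.conv_diff[OF c(1,2)] right_diff_distrib)
  also have "\<dots> = \<i> * (- \<i> * half.conv (Der I1 f) z)"
    unfolding eq half.conv_cmult ..
  also have "\<dots> = f z" by (simp add: half_Der[OF c(3)])
  finally show ?thesis .
qed

lemma wop_half: "csmooth f \<Longrightarrow> wop s k (\<lambda>z. \<i> * half.conv f z) z = \<i> * half.conv (wop s k f) z"
  using wop_cmult[OF smooth_on_differentiable[OF half.smooth_conv UNIV_I]]
    wop_conv[OF half.kernel_axioms] by metis

text \<open>
  The part of \<open>far R e\<close> that is invariant under translation along the line.
\<close>

definition tube :: "real \<Rightarrow> real \<Rightarrow> (complex ^ 2) set" where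
  "tube R e = {z. R < \<bar>Re (z $ 1)\<bar> \<or> R < norm (z $ 2) \<or> (\<bar>Re (z $ 1)\<bar> < e \<and> norm (z $ 2) < e)}"

lemma open_tube: "open (tube R e)"
proof -
  have "open {z :: complex ^ 2. R < \<bar>Re (z $ 1)\<bar>}"
    "open {z :: complex ^ 2. R < norm (z $ 2)}" "open {z :: complex ^ 2. \<bar>Re (z $ 1)\<bar> < e}"
    "open {z :: complex ^ 2. norm (z $ 2) < e}"
    by (intro open_Collect_less continuous_intros)+
  then have "open ({z :: complex ^ 2. R < \<bar>Re (z $ 1)\<bar>} \<union> {z. R < norm (z $ 2)} \<union>
      ({z. \<bar>Re (z $ 1)\<bar> < e} \<inter> {z. norm (z $ 2) < e}))" by blast
  then show ?thesis by (simp add: tube_def Collect_disj_eq Collect_conj_eq Un_assoc)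
qed

lemma far_cases: "z \<in> far R e \<longleftrightarrow> z \<in> tube R e \<or> R < Im (z $ 1) \<or> Im (z $ 1) < - R"
  by (auto simp: far_def tube_def)

lemma tube_shift: "z \<in> tube R e \<Longrightarrow> z - t *\<^sub>R I1 \<in> tube R e"
  by (simp add: tube_def I1_nth)

lemma convex_strip: "convex {z :: complex ^ 2. \<bar>Re (z $ 1)\<bar> < e \<and> norm (z $ 2) < e}"
proof -
  have "linear (\<lambda>z :: complex ^ 2. z $ 2)" by (intro linearI) auto
  then have "convex ((\<lambda>z :: complex ^ 2. z $ 2) -` ball 0 e)"
    by (intro convex_linear_vimage convex_ball)
  moreover have "convex {z. E1 \<bullet> z < e}" "convex {z. E1 \<bullet> z > - e}"
    by (rule convex_halfspace_lt convex_halfspace_gt)+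
  ultimately have "convex (((\<lambda>z :: complex ^ 2. z $ 2) -` ball 0 e) \<inter> ({z. E1 \<bullet> z < e} \<inter> {z. E1 \<bullet> z > - e}))"
    by (intro convex_Int)
  also have "\<dots> = {z :: complex ^ 2. \<bar>Re (z $ 1)\<bar> < e \<and> norm (z $ 2) < e}"
    by (auto simp: inner_axis' inner_complex_def)
  finally show ?thesis .
qed

lemma convex_beyond: "convex {z :: complex ^ 2. R < Re (z $ 1)}"
proof -
  have "{z :: complex ^ 2. R < Re (z $ 1)} = {z. E1 \<bullet> z > R}"
    by (auto simp: inner_axis' inner_complex_def)
  then show ?thesis by (simp add: convex_halfspace_gt)
qed

text \<open>
  The coefficients \<open>a\<^sub>j\<^sub>k\<close> belong to a compactly supported form \<open>\<alpha>\<close> with \<open>\<partial>\<partial>\<bar>\<alpha> = 0\<close>.  By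
  \<open>dbar_compact\<close>, \<open>\<partial>\<alpha>\<close> and its conjugate counterpart have compactly supported primitives \<open>m\<close> and \<open>n\<close>, which
  complete \<open>\<alpha>\<close> to a closed \<open>2\<close>-form.  Integrating the contraction of that form with the direction of the line over
  half-lines, as in the Poincare lemma, gives a primitive \<open>\<eta>\<close> that vanishes in the tube around the
  line and for \<open>Im z\<^sub>1 < - R\<close>.  For \<open>Im z\<^sub>1 > R\<close> it does not depend on the position along the line and equals
  \<open>d\<phi>\<close>, where \<open>\<phi>\<close> integrates \<open>a\<^sub>1\<^sub>1\<close> over half-planes.  Near the line \<open>\<phi>\<close> is constant, with value \<open>2 \<i>\<close> times the
  integral in the last hypothesis.  If it is \<open>0\<close>, subtracting \<open>d(\<chi>'\<phi>)\<close> with a step function \<open>\<chi>'\<close> of \<open>Im z\<^sub>1\<close> makes the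
  primitive compactly supported in \<open>X\<close>; its components of bidegree \<open>(1,0)\<close> and \<open>(0,1)\<close> are the
  functions \<open>p\<close> and \<open>q\<close>.
\<close>

lemma aeppli_exact:
  fixes a11 a12 a21 a22 :: "complex ^ 2 \<Rightarrow> complex"
  assumes s: "smooth_on UNIV a11" "smooth_on UNIV a12" "smooth_on UNIV a21" "smooth_on UNIV a22"
    and v: "\<And>z. z \<in> far R e \<Longrightarrow> a11 z = 0 \<and> a12 z = 0 \<and> a21 z = 0 \<and> a22 z = 0"
    and R: "R > 0" and e: "e > 0"
    and closed: "\<And>z. del_op 2 (dbar_op 2 a11) z - del_op 2 (dbar_op 1 a12) z
      - del_op 1 (dbar_op 2 a21) z + del_op 1 (dbar_op 1 a22) z = 0"
    and period: "hplane.conv a11 0 = 0"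
  obtains p1 p2 q1 q2 where
    "smooth_on UNIV p1" "smooth_on UNIV p2" "smooth_on UNIV q1" "smooth_on UNIV q2"
    "\<And>z. z \<in> far R e \<Longrightarrow> p1 z = 0 \<and> p2 z = 0 \<and> q1 z = 0 \<and> q2 z = 0"
    "\<And>z. a11 z = del_op 1 q1 z - dbar_op 1 p1 z" "\<And>z. a12 z = del_op 1 q2 z - dbar_op 2 p1 z"
    "\<And>z. a21 z = del_op 2 q1 z - dbar_op 1 p2 z" "\<And>z. a22 z = del_op 2 q2 z - dbar_op 2 p2 z"
proof -
  have dif: "f differentiable (at z)" if "smooth_on UNIV f" for f z
    using smooth_on_differentiable[OF that UNIV_I] .
  have sw: "smooth_on UNIV (wop t k f)" if "smooth_on UNIV f" for t k f
    by (rule smooth_wop[OF open_UNIV that])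
  note dw = dif[OF sw]
  note com = wop_commute[OF open_UNIV UNIV_I]
  have vw: "wop t k f z = 0" if "\<And>z. z \<in> far R e \<Longrightarrow> f z = 0" "z \<in> far R e" for t k f z
    by (rule wop_zero_open[OF open_far that(2) that(1)])
  obtain m where m: "smooth_on UNIV m" "\<And>z. z \<in> far R e \<Longrightarrow> m z = 0"
    "\<And>z. dbar_op 1 m z = del_op 1 a21 z - del_op 2 a11 z"
    "\<And>z. dbar_op 2 m z = del_op 1 a22 z - del_op 2 a12 z"
  proof (rule dbar_compact[of "\<lambda>z. del_op 1 a21 z - del_op 2 a11 z" "\<lambda>z. del_op 1 a22 z - del_op 2 a12 z" R e])
    show "dbar_op 1 (\<lambda>z. del_op 1 a22 z - del_op 2 a12 z) z = dbar_op 2 (\<lambda>z. del_op 1 a21 z - del_op 2 a11 z) z" for z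
      unfolding wop_diff[OF dw[OF s(4)] dw[OF s(2)]] wop_diff[OF dw[OF s(3)] dw[OF s(1)]]
        com[OF s(4), of \<i>] com[OF s(3), of \<i>] com[OF s(2), of \<i>] com[OF s(1), of \<i>]
      using closed[of z] by (simp add: algebra_simps)
  qed (use v e in \<open>auto intro!: smooth_on_diff sw s simp: vw\<close>)
  obtain n where n: "smooth_on UNIV n" "\<And>z. z \<in> far R e \<Longrightarrow> n z = 0"
    "\<And>z. del_op 1 n z = dbar_op 2 a11 z - dbar_op 1 a12 z"
    "\<And>z. del_op 2 n z = dbar_op 2 a21 z - dbar_op 1 a22 z"
  proof (rule d_compact[of "\<lambda>z. dbar_op 2 a11 z - dbar_op 1 a12 z" "\<lambda>z. dbar_op 2 a21 z - dbar_op 1 a22 z" R e])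
    show "del_op 1 (\<lambda>z. dbar_op 2 a21 z - dbar_op 1 a22 z) z = del_op 2 (\<lambda>z. dbar_op 2 a11 z - dbar_op 1 a12 z) z" for z
      unfolding wop_diff[OF dw[OF s(3)] dw[OF s(4)]] wop_diff[OF dw[OF s(1)] dw[OF s(2)]]
      using closed[of z] by (simp add: algebra_simps)
  qed (use v e in \<open>auto intro!: smooth_on_diff sw s simp: vw\<close>)
  \<comment> \<open>The coefficients of \<open>\<eta>\<close> are \<open>\<i>\<close> times the half-line integrals of \<open>a11\<close>, \<open>b\<close>, \<open>a11\<close> and \<open>c\<close>.\<close>
  define b where "b z = a21 z - m z" for z
  define c where "c z = a12 z + n z" for z
  have sb: "smooth_on UNIV b" and sc: "smooth_on UNIV c"
    unfolding b_def c_def by (intro smooth_on_diff smooth_on_add open_UNIV s m n)+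
  have vb: "b z = 0" and vc: "c z = 0" and v11: "a11 z = 0" if "z \<in> far R e" for z
    using v[OF that] m(2)[OF that] n(2)[OF that] by (simp_all add: b_def c_def)
  have wb: "wop t k b z = wop t k a21 z - wop t k m z" for t k z
    unfolding b_def[abs_def] by (rule wop_diff[OF dif[OF s(3)] dif[OF m(1)]])
  have wc: "wop t k c z = wop t k a12 z + wop t k n z" for t k z
    unfolding c_def[abs_def] by (rule wop_add[OF dif[OF s(2)] dif[OF n(1)]])
  have cs: "csmooth a11" "csmooth a12" "csmooth a21" "csmooth a22" "csmooth b" "csmooth c" "csmooth m" "csmooth n"
    using csmooth_far[OF s(1)] csmooth_far[OF s(2)] csmooth_far[OF s(3)] csmooth_far[OF s(4)]
      csmooth_far[OF sb vb] csmooth_far[OF sc vc] csmooth_far[OF m(1,2)] csmooth_far[OF n(1,2)] v by blast+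
  note cw = csmooth_wop

  \<comment> \<open>The derivatives of \<open>\<phi>\<close> are the line integrals of the same coefficients.\<close>
  define \<phi> where "\<phi> z = 2 * \<i> * hplane.conv a11 z" for z
  have s\<phi>: "smooth_on UNIV \<phi>"
    unfolding \<phi>_def by (intro smooth_on_mult smooth_on_const open_UNIV hplane.smooth_conv cs)
  have w\<phi>: "wop t k \<phi> z = 2 * \<i> * hplane.conv (wop t k a11) z" for t k z
    unfolding \<phi>_def[abs_def] wop_conv[OF hplane.kernel_axioms cs(1), symmetric]
    by (rule wop_cmult[OF dif[OF hplane.smooth_conv[OF cs(1)]]])
  have \<phi>1: "wop t 1 \<phi> z = \<i> * line.conv a11 z" for t z
    unfolding w\<phi> hplane_wop1[OF cs(1)] by simp
  have \<phi>2: "del_op 2 \<phi> z = \<i> * line.conv b z" for z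
  proof -
    have "del_op 2 a11 = (\<lambda>z. del_op 1 a21 z - dbar_op 1 m z)" using m(3) by auto
    then have "hplane.conv (del_op 2 a11) z = line.conv a21 z / 2 - line.conv m z / 2"
      by (simp add: hplane.conv_diff cw cs hplane_wop1)
    also have "\<dots> = line.conv b z / 2"
      unfolding b_def[abs_def] by (simp add: line.conv_diff cs diff_divide_distrib)
    finally show ?thesis unfolding w\<phi> by (simp add: mult.commute)
  qed
  have \<phi>2': "dbar_op 2 \<phi> z = \<i> * line.conv c z" for z
  proof -
    have "dbar_op 2 a11 = (\<lambda>z. dbar_op 1 a12 z + del_op 1 n z)" using n(3) by auto
    then have "hplane.conv (dbar_op 2 a11) z = line.conv a12 z / 2 + line.conv n z / 2"
      by (simp add: hplane.conv_add cw cs hplane_wop1)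
    also have "\<dots> = line.conv c z / 2"
      unfolding c_def[abs_def] by (simp add: line.conv_add cs add_divide_distrib)
    finally show ?thesis unfolding w\<phi> by (simp add: mult.commute)
  qed
  have line0: "line.conv f z = 0" if "\<And>z. z \<in> far R e \<Longrightarrow> f z = 0" "z \<in> tube R e" for f z
    by (rule line.conv_zero) (use that tube_shift far_cases in blast)
  have \<phi>0: "wop (- \<i>) k \<phi> z = 0" "wop \<i> k \<phi> z = 0" if "z \<in> tube R e" for k z
  proof -
    have "k = 1 \<or> k = 2" by (rule exhaust_2)
    then show "wop (- \<i>) k \<phi> z = 0" "wop \<i> k \<phi> z = 0"
      using \<phi>1[of _ z] \<phi>2[of z] \<phi>2'[of z] line0[OF v11 that] line0[OF vb that] line0[OF vc that] by auto
  qed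
  have \<phi>far: "\<phi> z = 0" if "R < norm (z $ 2) \<or> Re (z $ 1) < - R" for z
  proof -
    have "hplane.conv a11 z = 0"
    proof (rule hplane.conv_zero)
      fix t :: "real \<times> real" assume "indicator {0..} (fst t) \<noteq> (0 :: complex)"
      then have "fst t \<ge> 0" by (simp add: indicator_def split: if_splits)
      then have "z - pair1.embed t \<in> far R e"
        using that by (auto simp: far_def embed_nth plane_def)
      then show "a11 (z - pair1.embed t) = 0" by (rule v11)
    qed
    then show ?thesis by (simp add: \<phi>_def)
  qed
  \<comment> \<open>For \<open>Re z\<^sub>1 > R\<close>, \<open>\<phi>\<close> is constant and vanishes where \<open>z\<^sub>2\<close> is large.\<close>
  have \<phi>tube: "\<phi> z = 0" if z: "z \<in> tube R e" for z
  proof -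
    have "R < \<bar>Re (z $ 1)\<bar> \<Longrightarrow> Re (z $ 1) < - R \<or> R < Re (z $ 1)" by linarith
    then consider "R < norm (z $ 2) \<or> Re (z $ 1) < - R" | "R < Re (z $ 1)" | "\<bar>Re (z $ 1)\<bar> < e \<and> norm (z $ 2) < e"
      using z unfolding tube_def by blast
    then show ?thesis
    proof cases
      case 1 then show ?thesis by (rule \<phi>far)
    next
      case 2
      define y :: "complex ^ 2" where "y = (\<chi> i. if i = 1 then z $ 1 else of_real (R + 1))"
      have y: "y $ 1 = z $ 1" "y $ 2 = of_real (R + 1)" by (simp_all add: y_def)
      have "\<phi> z = \<phi> y"
        by (rule constant_on_convex[OF convex_beyond[of R] s\<phi> \<phi>0]) (use 2 y in \<open>auto simp: tube_def\<close>)
      also have "\<phi> y = 0" using R by (intro \<phi>far) (simp add: y abs_of_pos del: of_real_add)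
      finally show ?thesis .
    next
      case 3
      have "\<phi> z = \<phi> 0"
        by (rule constant_on_convex[OF convex_strip[of e] s\<phi> \<phi>0]) (use 3 e in \<open>auto simp: tube_def\<close>)
      then show ?thesis using period by (simp add: \<phi>_def)
    qed
  qed

  \<comment> \<open>\<open>\<chi>'\<close> is \<open>0\<close> where \<open>\<eta> = 0\<close> and \<open>1\<close> where \<open>\<eta> = d\<phi>\<close>.\<close>
  define \<chi>' :: "complex ^ 2 \<Rightarrow> complex" where "\<chi>' z = of_real (step (1/2 + Im (z $ 1) / (2 * R)))" for z
  have s\<chi>: "smooth_on UNIV \<chi>'"
  proof -
    have "bounded_linear (\<lambda>z :: complex ^ 2. Im (z $ 1) / (2 * R))"
      by (rule bounded_linear_compose[OF bounded_linear_divide bounded_linear_compose[OF bounded_linear_Im bounded_linear_vec_nth]])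
    from smooth_on_affine(1)[OF smooth_step this, of "1/2"] show ?thesis by (simp add: \<chi>'_def[abs_def])
  qed
  have \<chi>0: "\<chi>' z = 0" if "Im (z $ 1) < - R" for z
    unfolding \<chi>'_def using step_0[of "1/2 + Im (z $ 1) / (2 * R)"] that R by (simp add: field_simps)
  have \<chi>1: "\<chi>' z = 1" if "R < Im (z $ 1)" for z
    unfolding \<chi>'_def using step_1[of "1/2 + Im (z $ 1) / (2 * R)"] that R by (simp add: field_simps)
  define h where "h z = \<chi>' z * \<phi> z" for z
  have sh: "smooth_on UNIV h" unfolding h_def by (intro smooth_on_mult open_UNIV s\<chi> s\<phi>)
  have op: "open {z :: complex ^ 2. R < Im (z $ 1)}" "open {z :: complex ^ 2. Im (z $ 1) < - R}"
    by (intro open_Collect_less continuous_intros)+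
  have V: "\<i> * half.conv f z - wop t k h z = 0"
    if f: "\<And>z. z \<in> far R e \<Longrightarrow> f z = 0" and w: "\<And>z. wop t k \<phi> z = \<i> * line.conv f z" and z: "z \<in> far R e"
    for f t k z
  proof -
    consider "z \<in> tube R e" | "R < Im (z $ 1)" | "Im (z $ 1) < - R" using z far_cases by blast
    then show ?thesis
    proof cases
      case 1
      have "half.conv f z = 0" by (rule half.conv_zero) (use f 1 tube_shift far_cases in blast)
      moreover have "wop t k h z = 0"
        by (rule wop_zero_open[OF open_tube 1]) (simp add: h_def \<phi>tube)
      ultimately show ?thesis by simp
    next
      case 2
      have "half.conv f z = line.conv f z"
        by (rule half_eq_line[of R, OF _ 2]) (auto intro!: f simp: far_def)
      moreover have "wop t k h z = wop t k \<phi> z"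
        by (rule wop_cong_open[OF op(1)]) (use 2 in \<open>auto simp: h_def \<chi>1\<close>)
      ultimately show ?thesis by (simp add: w)
    next
      case 3
      have "half.conv f z = 0"
      proof (rule half.conv_zero)
        fix u :: real assume "indicator {0..} u \<noteq> (0 :: complex)"
        then have "u \<ge> 0" by (simp add: indicator_def split: if_splits)
        then show "f (z - u *\<^sub>R I1) = 0" using 3 by (intro f) (simp add: far_cases I1_nth)
      qed
      moreover have "wop t k h z = 0"
        by (rule wop_zero_open[OF op(2)]) (use 3 in \<open>auto simp: h_def \<chi>0\<close>)
      ultimately show ?thesis by simp
    qed
  qed

  have sS: "smooth_on UNIV (\<lambda>z. \<i> * half.conv f z)" if "csmooth f" for f
    by (intro smooth_on_mult smooth_on_const open_UNIV half.smooth_conv that)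
  have ww: "wop t j (\<lambda>z. \<i> * half.conv f z - wop t' k h z) z
      = \<i> * half.conv (wop t j f) z - wop t j (wop t' k h) z" if "csmooth f" for f t j t' k z
    unfolding wop_diff[OF dif[OF sS[OF that]] dw[OF sh]] wop_half[OF that] ..
  have key: "(\<i> * half.conv u z - del_op j (dbar_op k h) z) - (\<i> * half.conv w z - dbar_op k (del_op j h) z) = f z"
    if "csmooth u" "csmooth w" "csmooth f" "\<And>z. u z - w z = - \<i> * Der I1 f z" for u w f j k z
    using half_difference[OF that, of z] com[OF sh, of "- \<i>" j \<i> k z] by simp
  show ?thesis
  proof (rule that[of "\<lambda>z. \<i> * half.conv a11 z - del_op 1 h z" "\<lambda>z. \<i> * half.conv b z - del_op 2 h z"
        "\<lambda>z. \<i> * half.conv a11 z - dbar_op 1 h z" "\<lambda>z. \<i> * half.conv c z - dbar_op 2 h z"])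
    show "smooth_on UNIV (\<lambda>z. \<i> * half.conv a11 z - del_op 1 h z)" "smooth_on UNIV (\<lambda>z. \<i> * half.conv b z - del_op 2 h z)"
      "smooth_on UNIV (\<lambda>z. \<i> * half.conv a11 z - dbar_op 1 h z)" "smooth_on UNIV (\<lambda>z. \<i> * half.conv c z - dbar_op 2 h z)"
      by (intro smooth_on_diff open_UNIV sS cs sw sh)+
    show "\<i> * half.conv a11 z - del_op 1 h z = 0 \<and> \<i> * half.conv b z - del_op 2 h z = 0 \<and>
      \<i> * half.conv a11 z - dbar_op 1 h z = 0 \<and> \<i> * half.conv c z - dbar_op 2 h z = 0" if z: "z \<in> far R e" for z
      by (intro conjI V[OF v11 \<phi>1 z] V[OF vb \<phi>2 z] V[OF vc \<phi>2' z])
    fix z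
    show "a11 z = del_op 1 (\<lambda>z. \<i> * half.conv a11 z - dbar_op 1 h z) z - dbar_op 1 (\<lambda>z. \<i> * half.conv a11 z - del_op 1 h z) z"
      unfolding ww[OF cs(1)] by (rule key[symmetric, OF cw[OF cs(1)] cw[OF cs(1)] cs(1) wop1_difference])
    show "a12 z = del_op 1 (\<lambda>z. \<i> * half.conv c z - dbar_op 2 h z) z - dbar_op 2 (\<lambda>z. \<i> * half.conv a11 z - del_op 1 h z) z"
      unfolding ww[OF cs(1)] ww[OF cs(6)]
      by (rule key[symmetric, OF cw[OF cs(6)] cw[OF cs(1)] cs(2)]) (simp add: wc n wop1_difference)
    show "a21 z = del_op 2 (\<lambda>z. \<i> * half.conv a11 z - dbar_op 1 h z) z - dbar_op 1 (\<lambda>z. \<i> * half.conv b z - del_op 2 h z) z"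
      unfolding ww[OF cs(1)] ww[OF cs(5)]
      by (rule key[symmetric, OF cw[OF cs(1)] cw[OF cs(5)] cs(3)]) (simp add: wb m wop1_difference)
    show "a22 z = del_op 2 (\<lambda>z. \<i> * half.conv c z - dbar_op 2 h z) z - dbar_op 2 (\<lambda>z. \<i> * half.conv b z - del_op 2 h z) z"
      unfolding ww[OF cs(6)] ww[OF cs(5)]
      by (rule key[symmetric, OF cw[OF cs(6)] cw[OF cs(5)] cs(4)]) (simp add: wb wc m n wop1_difference)
  qed
qed

section \<open>Linear algebra of quotients\<close>

definition is_subspace :: "('i \<Rightarrow> complex) set \<Rightarrow> bool" where
  "is_subspace V \<longleftrightarrow> 0 \<in> V \<and> (\<forall>x\<in>V. \<forall>y\<in>V. \<forall>c. x + fscale c y \<in> V)"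

lemma fscale_simps [simp]: "fscale 1 x = x" "fscale 0 x = 0" "fscale c 0 = 0"
  "fscale c (fscale d x) = fscale (c * d) x"
  by (auto simp: fscale_def fun_eq_iff)

lemma fscale_add: "fscale c (x + y) = fscale c x + fscale c y" "fscale (c + d) x = fscale c x + fscale d x"
  by (auto simp: fscale_def fun_eq_iff algebra_simps)

lemma subspace_add: "is_subspace V \<Longrightarrow> x \<in> V \<Longrightarrow> y \<in> V \<Longrightarrow> x + y \<in> V"
  unfolding is_subspace_def by (metis fscale_simps(1))

lemma subspace_zero: "is_subspace V \<Longrightarrow> 0 \<in> V"
  by (simp add: is_subspace_def)

lemma subspace_scale: "is_subspace V \<Longrightarrow> x \<in> V \<Longrightarrow> fscale c x \<in> V"
  unfolding is_subspace_def by (metis add_0)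

lemma coset_self: "is_subspace B \<Longrightarrow> x \<in> x +o B"
  using subspace_zero[of B] set_plus_intro2[of 0 B x]
  unfolding elt_set_plus_def by (metis (mono_tags, lifting) add.right_neutral mem_Collect_eq)

lemma coset_absorb:
  assumes B: "is_subspace B" and b: "b \<in> B"
  shows "(x + b) +o B = x +o B"
proof (intro set_eqI iffI)
  fix y assume "y \<in> (x + b) +o B"
  then obtain b' where "b' \<in> B" "y = x + (b + b')" by (auto simp: elt_set_plus_def add.assoc)
  then show "y \<in> x +o B" using subspace_add[OF B b] by (auto simp: elt_set_plus_def)
next
  fix y assume "y \<in> x +o B"
  then obtain b' where b': "b' \<in> B" "y = x + b'" by (auto simp: elt_set_plus_def)
  have "y = (x + b) + (b' + fscale (-1) b)"
    by (simp add: b' fun_eq_iff fscale_def)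
  moreover have "b' + fscale (-1) b \<in> B" using B b b' by (simp add: is_subspace_def)
  ultimately show "y \<in> (x + b) +o B" by (auto simp: elt_set_plus_def)
qed

lemma coset_zero: "0 +o B = (B :: ('i \<Rightarrow> complex) set)"
  by (auto simp: elt_set_plus_def)

lemma coset_eq_zero: "is_subspace B \<Longrightarrow> x +o B = B \<longleftrightarrow> x \<in> B"
  using coset_absorb[of B x 0] coset_self[of B x] coset_zero[of B] by auto

lemma coset_add:
  assumes B: "is_subspace B"
  shows "(x +o B) + (y +o B) = (x + y) +o B"
proof (intro set_eqI iffI)
  fix w assume "w \<in> (x +o B) + (y +o B)"
  then obtain b b' where "b \<in> B" "b' \<in> B" "w = (x + b) + (y + b')"
    by (auto simp: elt_set_plus_def set_plus_def)
  moreover have "(x + b) + (y + b') = (x + y) + (b + b')" by (simp add: algebra_simps)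
  ultimately show "w \<in> (x + y) +o B" using subspace_add[OF B] by (auto simp: elt_set_plus_def)
next
  fix w assume "w \<in> (x + y) +o B"
  then obtain b where "b \<in> B" "w = (x + y) + b" by (auto simp: elt_set_plus_def)
  then have "w = (x + b) + (y + 0)" "x + b \<in> x +o B" "y + 0 \<in> y +o B"
    using coset_self[OF B, of y] by (auto simp: elt_set_plus_def algebra_simps)
  then show "w \<in> (x +o B) + (y +o B)" using set_plus_intro by blast
qed

lemma coset_scale:
  assumes B: "is_subspace B"
  shows "fscale c ` (x +o B) + B = fscale c x +o B"
proof (intro set_eqI iffI)
  fix w assume "w \<in> fscale c ` (x +o B) + B"
  then obtain b b' where b: "b \<in> B" "b' \<in> B" "w = fscale c (x + b) + b'"
    by (auto simp: elt_set_plus_def set_plus_def)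
  then have "w = fscale c x + (fscale c b + b')" by (simp add: fscale_add(1) add.assoc)
  then show "w \<in> fscale c x +o B"
    using subspace_add[OF B subspace_scale[OF B b(1)] b(2)] by (auto simp: elt_set_plus_def)
next
  fix w assume "w \<in> fscale c x +o B"
  then obtain b where "b \<in> B" "w = fscale c x + b" by (auto simp: elt_set_plus_def)
  then show "w \<in> fscale c ` (x +o B) + B"
    using set_plus_intro[OF imageI[OF coset_self[OF B]]] by blast
qed

lemma quot_simps:
  "carr (quot_space Z B) = (\<lambda>x. x +o B) ` Z" "zer (quot_space Z B) = B"
  "add (quot_space Z B) = (+)" "scal (quot_space Z B) = (\<lambda>c A. fscale c ` A + B)"
  by (simp_all add: quot_space_def)

lemma lin_comb_quot:
  assumes B: "is_subspace B" and v: "\<And>i. i < n \<Longrightarrow> v i = x i +o B"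
  shows "lin_comb (quot_space Z B) c v n = (\<Sum>i<n. fscale (c i) (x i)) +o B"
  using v
proof (induction n)
  case 0
  then show ?case by (simp only: lin_comb.simps quot_simps lessThan_0 sum.empty coset_zero)
next
  case (Suc n)
  have "lin_comb (quot_space Z B) c v n = (\<Sum>i<n. fscale (c i) (x i)) +o B"
    by (rule Suc.IH) (use Suc.prems in simp)
  moreover have "v n = x n +o B" by (rule Suc.prems) simp
  ultimately show ?case
    by (simp only: lin_comb.simps quot_simps coset_scale[OF B] coset_add[OF B] sum.lessThan_Suc)
qed

lemma linear_map_lin_comb:
  assumes f: "linear_map V W f"
    and closed: "zer V \<in> carr V" "\<And>x y c. x \<in> carr V \<Longrightarrow> y \<in> carr V \<Longrightarrow> add V x (scal V c y) \<in> carr V"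
      "\<And>c x. x \<in> carr V \<Longrightarrow> scal V c x \<in> carr V"
    and zero: "f (zer V) = zer W"
    and v: "\<And>i. i < n \<Longrightarrow> v i \<in> carr V"
  shows "f (lin_comb V c v n) = lin_comb W c (\<lambda>i. f (v i)) n \<and> lin_comb V c v n \<in> carr V"
  using v
proof (induction n)
  case 0
  then show ?case using closed zero by simp
next
  case (Suc n)
  then show ?case using f closed unfolding linear_map_def by simp
qed

text \<open>
  The abstract form of a quotient of dimension at most one: a single linear equation suffices for
  membership in \<open>B\<close>.
\<close>

locale line_quotient =
  fixes Z B :: "('i \<Rightarrow> complex) set" and l :: "('i \<Rightarrow> complex) \<Rightarrow> complex"
  assumes Z: "is_subspace Z" and B: "is_subspace B"
    and l: "\<And>x y c. x \<in> Z \<Longrightarrow> y \<in> Z \<Longrightarrow> l (x + fscale c y) = l x + c * l y"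
    and inj: "\<And>x. x \<in> Z \<Longrightarrow> l x = 0 \<Longrightarrow> x \<in> B"
begin

text \<open>
  Any two vectors \<open>x\<close>, \<open>y\<close> satisfy the relation with coefficients \<open>l y\<close> and \<open>- l x\<close>.
\<close>

lemma lin_independent_le_1:
  assumes ind: "lin_independent (quot_space Z B) n v"
  shows "n \<le> 1"
proof (rule ccontr)
  assume "\<not> n \<le> 1"
  then have n: "{0, 1} \<subseteq> {..<n}" by auto
  have "\<forall>i<n. \<exists>x\<in>Z. v i = x +o B"
    using ind unfolding lin_independent_def quot_simps by blast
  then obtain x where x: "\<And>i. i < n \<Longrightarrow> x i \<in> Z" "\<And>i. i < n \<Longrightarrow> v i = x i +o B" by metis
  have xz: "x 0 \<in> Z" "x 1 \<in> Z" using x n by auto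
  define a where "a = (if l (x 0) = 0 \<and> l (x 1) = 0 then (1, 0) else (l (x 1), - l (x 0)))"
  define c where "c i = (if i = 0 then fst a else if i = Suc 0 then snd a else 0)" for i :: nat
  have "(\<Sum>i<n. fscale (c i) (x i)) = (\<Sum>i\<in>{0, 1}. fscale (c i) (x i))"
    by (rule sum.mono_neutral_right[OF _ n]) (auto simp: c_def)
  also have "\<dots> = fscale (fst a) (x 0) + fscale (snd a) (x 1)" by (simp add: c_def)
  also have "\<dots> \<in> B"
  proof (rule inj)
    have m: "fscale (fst a) (x 0) \<in> Z" using subspace_scale[OF Z xz(1)] .
    then show "fscale (fst a) (x 0) + fscale (snd a) (x 1) \<in> Z"
      using xz Z by (simp add: is_subspace_def)
    have "l (0 + fscale (fst a) (x 0)) = l (0 + fscale (-1) 0) + fst a * l (x 0)"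
      using l[OF subspace_zero[OF Z] xz(1)] by simp
    moreover have "l (0 + fscale (-1) 0) = 0" using l[of 0 0 "-1"] subspace_zero[OF Z] by simp
    ultimately show "l (fscale (fst a) (x 0) + fscale (snd a) (x 1)) = 0"
      unfolding l[OF m xz(2)] by (auto simp: a_def)
  qed
  finally have "(\<Sum>i<n. fscale (c i) (x i)) +o B = B" by (simp only: coset_eq_zero[OF B])
  moreover have "lin_comb (quot_space Z B) c v n = (\<Sum>i<n. fscale (c i) (x i)) +o B"
    by (rule lin_comb_quot[OF B x(2)])
  ultimately have "lin_comb (quot_space Z B) c v n = zer (quot_space Z B)" by (simp only: quot_simps)
  then have "c 0 = 0 \<and> c 1 = 0" using ind n unfolding lin_independent_def by auto
  then show False by (auto simp: c_def a_def split: if_splits)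
qed

lemma functional_multiple:
  assumes x0: "x0 \<in> Z" "l x0 \<noteq> 0" and x: "x \<in> Z"
    and w: "linear_map (quot_space Z B) complex_line w"
  shows "w (x +o B) = l x / l x0 * w (x0 +o B)"
proof -
  let ?t = "l x / l x0"
  have "x + fscale (- ?t) x0 \<in> B"
    using x0 x l[OF x x0(1), of "- ?t"] Z by (intro inj) (auto simp: is_subspace_def)
  then have "(fscale ?t x0 + (x + fscale (- ?t) x0)) +o B = fscale ?t x0 +o B" by (rule coset_absorb[OF B])
  also have "fscale ?t x0 + (x + fscale (- ?t) x0) = x" by (simp add: fun_eq_iff fscale_def)
  finally have "x +o B = scal (quot_space Z B) ?t (x0 +o B)"
    by (simp add: quot_simps coset_scale[OF B])
  moreover have "w (scal (quot_space Z B) ?t (x0 +o B)) = ?t * w (x0 +o B)"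
    using w x0(1) by (simp add: linear_map_def quot_simps complex_line_def)
  ultimately show ?thesis by simp
qed

lemma functionals_dependent:
  assumes w: "linear_map (quot_space Z B) complex_line w0" "linear_map (quot_space Z B) complex_line w1"
  shows "\<exists>a b. (a, b) \<noteq> (0, 0) \<and> (\<forall>A\<in>carr (quot_space Z B). a * w0 A + b * w1 A = 0)"
proof (cases "\<exists>x0\<in>Z. l x0 \<noteq> 0")
  case True
  then obtain x0 where x0: "x0 \<in> Z" "l x0 \<noteq> 0" by blast
  note f = functional_multiple[OF x0 _ w(1)] functional_multiple[OF x0 _ w(2)]
  let ?u = "w0 (x0 +o B)" and ?v = "w1 (x0 +o B)"
  show ?thesis
  proof (cases "?u = 0 \<and> ?v = 0")
    case True
    then show ?thesis using f by (intro exI[of _ 1] exI[of _ 0]) (auto simp: quot_simps)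
  next
    case False
    then show ?thesis using f by (intro exI[of _ ?v] exI[of _ "- ?u"]) (auto simp: quot_simps)
  qed
next
  case False
  then have "x +o B = B" if "x \<in> Z" for x using inj[OF that] that coset_eq_zero[OF B] by blast
  then have c: "carr (quot_space Z B) \<subseteq> {B}" by (auto simp: quot_simps)
  have "w0 B = 0"
  proof -
    have "fscale 0 ` (0 +o B) + B = fscale 0 0 +o B" by (rule coset_scale[OF B])
    then have "scal (quot_space Z B) 0 B = B" by (simp only: coset_zero quot_simps fscale_simps)
    moreover have "B \<in> carr (quot_space Z B)"
      using subspace_zero[OF Z] coset_zero[of B] by (force simp: quot_simps)
    then have "w0 (scal (quot_space Z B) 0 B) = 0 * w0 B"
      using w(1) by (simp add: linear_map_def complex_line_def)
    ultimately show ?thesis by simp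
  qed
  then show ?thesis using c by (intro exI[of _ 1] exI[of _ 0]) auto
qed

text \<open>
  Two linear forms on a space of dimension at most one are dependent, continuous or not; so no
  topology \<open>T\<close> can make the dual two-dimensional.
\<close>

lemma not_isomorphic_to_dual:
  assumes Z': "is_subspace Z'" and B': "is_subspace B'" and ind: "lin_independent (quot_space Z' B') n v" and n: "n \<ge> 2"
  shows "\<not> linearly_isomorphic (quot_space Z' B') (top_dual (quot_space Z B) T)"
proof
  let ?V = "quot_space Z' B'" and ?D = "top_dual (quot_space Z B) T"
  assume "linearly_isomorphic ?V ?D"
  then obtain f where f: "linear_map ?V ?D f" "bij_betw f (carr ?V) (carr ?D)"
    by (auto simp: linearly_isomorphic_def)
  have v: "v i \<in> carr ?V" if "i < n" for i using ind that by (simp add: lin_independent_def)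
  have D: "carr ?D = {l. linear_map (quot_space Z B) complex_line l \<and> continuous_map T euclidean l \<and>
                   (\<forall>x. x \<notin> carr (quot_space Z B) \<longrightarrow> l x = 0)}"
    "zer ?D = 0" "add ?D = (+)" "scal ?D = fscale"
    by (simp_all add: top_dual_def fun_space_def)
  have vD: "f (v i) \<in> carr ?D" if "i < n" for i using f(1) v[OF that] by (auto simp: linear_map_def)
  have "linear_map (quot_space Z B) complex_line (f (v 0))" "linear_map (quot_space Z B) complex_line (f (v 1))"
    using vD[of 0] vD[of 1] n D(1) by auto
  from functionals_dependent[OF this]
  obtain a b where ab: "(a, b) \<noteq> (0, 0)" "\<And>A. A \<in> carr (quot_space Z B) \<Longrightarrow> a * f (v 0) A + b * f (v 1) A = 0"
    by blast
  have zero: "fscale a (f (v 0)) + fscale b (f (v 1)) = 0"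
  proof
    fix A
    show "(fscale a (f (v 0)) + fscale b (f (v 1))) A = 0 A"
    proof (cases "A \<in> carr (quot_space Z B)")
      case True then show ?thesis using ab(2) by (simp add: fscale_def)
    next
      case False then show ?thesis using vD[of 0] vD[of 1] n D(1) by (simp add: fscale_def)
    qed
  qed
  have n2: "{0, 1} \<subseteq> {..<n}" using n by auto
  define c where "c i = (if i = 0 then a else if i = Suc 0 then b else 0)" for i :: nat
  have lcD: "lin_comb ?D c w m = (\<Sum>i<m. fscale (c i) (w i))" for w m
    by (induction m) (auto simp: D)
  have VB: "carr ?V = (\<lambda>x. x +o B') ` Z'" "zer ?V = B'" by (simp_all add: quot_simps)
  have zV: "zer ?V \<in> carr ?V" using subspace_zero[OF Z'] coset_zero[of B'] by (force simp: quot_simps)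
  have fz: "f (zer ?V) = zer ?D"
  proof -
    have "fscale 0 ` (0 +o B') + B' = fscale 0 0 +o B'" by (rule coset_scale[OF B'])
    then have "scal ?V 0 (zer ?V) = zer ?V" by (simp only: coset_zero quot_simps fscale_simps)
    moreover have "f (scal ?V 0 (zer ?V)) = scal ?D 0 (f (zer ?V))"
      using f(1) zV by (simp add: linear_map_def)
    ultimately show ?thesis by (simp add: D)
  qed
  have lc: "f (lin_comb ?V c v n) = lin_comb ?D c (\<lambda>i. f (v i)) n \<and> lin_comb ?V c v n \<in> carr ?V"
  proof (rule linear_map_lin_comb[OF f(1) zV _ _ fz v])
    show "scal ?V d A \<in> carr ?V" if "A \<in> carr ?V" for d A
      using that subspace_scale[OF Z'] by (auto simp: quot_simps coset_scale[OF B'])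
    then show "add ?V A (scal ?V d A') \<in> carr ?V" if "A \<in> carr ?V" "A' \<in> carr ?V" for d A A'
      using that subspace_add[OF Z' _ subspace_scale[OF Z']]
      by (auto simp: quot_simps coset_scale[OF B'] coset_add[OF B'])
  qed
  have "lin_comb ?D c (\<lambda>i. f (v i)) n = (\<Sum>i\<in>{0, 1}. fscale (c i) (f (v i)))"
    unfolding lcD by (rule sum.mono_neutral_right[OF _ n2]) (auto simp: c_def)
  also have "\<dots> = 0" using zero by (simp add: c_def)
  finally have "f (lin_comb ?V c v n) = f (zer ?V)" using lc fz D(2) by simp
  then have "lin_comb ?V c v n = zer ?V"
    using f(2) lc zV by (auto simp: bij_betw_def dest: inj_onD)
  then have "c 0 = 0 \<and> c 1 = 0" using ind n unfolding lin_independent_def by auto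
  then show False using ab(1) by (simp add: c_def)
qed

end

section \<open>Spaces of forms\<close>

definition smooth_form :: "(complex ^ 'n) set \<Rightarrow> 'n form \<Rightarrow> bool" where
  "smooth_form X \<omega> \<longleftrightarrow> (\<forall>I J. smooth_on X (\<lambda>z. \<omega> (z, I, J)))"

lemma smooth_form_coeff: "smooth_form X \<omega> \<Longrightarrow> smooth_on X (\<lambda>z. \<omega> (z, I, J))"
  by (simp add: smooth_form_def)

lemma forms_smooth: "\<omega> \<in> forms X p q \<Longrightarrow> smooth_form X \<omega>"
  by (simp add: forms_def smooth_form_def)

lemma forms_zero: "\<omega> \<in> forms X p q \<Longrightarrow> \<not> (z \<in> X \<and> card I = p \<and> card J = q) \<Longrightarrow> \<omega> (z, I, J) = 0"
  by (simp add: forms_def)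

lemma del_wop: "del X \<omega> (z, K, J) =
    (if z \<in> X then \<Sum>k\<in>K. shuffle_sign {k} (K - {k}) * wop (- \<i>) k (\<lambda>w. \<omega> (w, K - {k}, J)) z else 0)"
  by (simp add: del_def wirtinger_wop)

lemma delbar_wop: "delbar X \<omega> (z, I, M) =
    (if z \<in> X then (- 1) ^ card I *
       (\<Sum>k\<in>M. shuffle_sign {k} (M - {k}) * wop \<i> k (\<lambda>w. \<omega> (w, I, M - {k})) z) else 0)"
  by (simp add: delbar_def wirtinger_bar_wop)

lemma smooth_on_sum:
  "open X \<Longrightarrow> (\<And>k. k \<in> K \<Longrightarrow> smooth_on X (f k)) \<Longrightarrow> smooth_on X (\<lambda>x. \<Sum>k\<in>K. f k x)"
  by (induction K rule: infinite_finite_induct) auto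

lemma smooth_form_lincomb:
  "open X \<Longrightarrow> smooth_form X \<omega> \<Longrightarrow> smooth_form X \<eta> \<Longrightarrow> smooth_form X (\<omega> + fscale c \<eta>)"
  unfolding smooth_form_def fscale_def plus_fun_def
  by (intro allI smooth_on_add smooth_on_mult smooth_on_const) auto

lemma smooth_form_delbar:
  assumes X: "open X" and \<omega>: "smooth_form X \<omega>"
  shows "smooth_form X (delbar X \<omega>)"
  unfolding smooth_form_def
proof (intro allI)
  fix I J
  show "smooth_on X (\<lambda>z. delbar X \<omega> (z, I, J))"
    by (rule smooth_on_cong[OF X, rotated])
      (auto simp: delbar_wop intro!: X smooth_on_mult smooth_on_sum smooth_on_const smooth_wop smooth_form_coeff[OF \<omega>])
qed

lemma wop_lincomb:
  assumes X: "open X" "z \<in> X" and "smooth_form X \<omega>" "smooth_form X \<eta>"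
  shows "wop s k (\<lambda>w. (\<omega> + fscale c \<eta>) (w, I, J)) z = wop s k (\<lambda>w. \<omega> (w, I, J)) z + c * wop s k (\<lambda>w. \<eta> (w, I, J)) z"
proof -
  have d: "(\<lambda>w. \<omega> (w, I, J)) differentiable (at z)" "(\<lambda>w. \<eta> (w, I, J)) differentiable (at z)"
    using assms by (auto intro: smooth_on_differentiable smooth_form_coeff)
  have d2: "(\<lambda>w. c * \<eta> (w, I, J)) differentiable (at z)" using d(2) by (intro differentiable_mult) auto
  have "(\<lambda>w. (\<omega> + fscale c \<eta>) (w, I, J)) = (\<lambda>w. \<omega> (w, I, J) + c * \<eta> (w, I, J))"
    by (simp add: fscale_def)
  then show ?thesis by (simp only: wop_add[OF d(1) d2] wop_cmult[OF d(2)])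
qed

lemma del_lincomb:
  assumes "open X" "smooth_form X \<omega>" "smooth_form X \<eta>"
  shows "del X (\<omega> + fscale c \<eta>) = del X \<omega> + fscale c (del X \<eta>)"
proof
  fix i :: "(complex ^ ('a :: {finite,linorder})) \<times> 'a set \<times> 'a set"
  obtain z K J where i: "i = (z, K, J)" by (rule prod_cases3)
  show "del X (\<omega> + fscale c \<eta>) i = (del X \<omega> + fscale c (del X \<eta>)) i"
  proof (cases "z \<in> X")
    case True
    show ?thesis
      unfolding i plus_fun_apply[of "del X \<omega>" "fscale c (del X \<eta>)"] fscale_def[of c "del X \<eta>"] del_wop wop_lincomb[OF assms(1) True assms(2,3)]
      using True by (simp add: del_wop sum.distrib sum_distrib_left algebra_simps)
  qed (simp add: i del_wop fscale_def)
qed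

lemma delbar_lincomb:
  assumes "open X" "smooth_form X \<omega>" "smooth_form X \<eta>"
  shows "delbar X (\<omega> + fscale c \<eta>) = delbar X \<omega> + fscale c (delbar X \<eta>)"
proof
  fix i :: "(complex ^ ('a :: {finite,linorder})) \<times> 'a set \<times> 'a set"
  obtain z K J where i: "i = (z, K, J)" by (rule prod_cases3)
  show "delbar X (\<omega> + fscale c \<eta>) i = (delbar X \<omega> + fscale c (delbar X \<eta>)) i"
  proof (cases "z \<in> X")
    case True
    show ?thesis
      unfolding i plus_fun_apply[of "delbar X \<omega>" "fscale c (delbar X \<eta>)"] fscale_def[of c "delbar X \<eta>"] delbar_wop wop_lincomb[OF assms(1) True assms(2,3)]
      using True by (simp add: delbar_wop sum.distrib sum_distrib_left algebra_simps)
  qed (simp add: i delbar_wop fscale_def)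
qed

lemma wop_zero [simp]: "wop s k (\<lambda>z. 0) z = 0"
  by (simp add: wop_def)

lemma del_zero: "del X 0 = 0" and delbar_zero: "delbar X 0 = 0"
  by (auto simp: fun_eq_iff del_wop delbar_wop zero_fun_def)

lemma subspace_forms: "open X \<Longrightarrow> is_subspace (forms X p q)"
proof -
  assume X: "open X"
  have "0 \<in> forms X p q" using X by (simp add: forms_def)
  moreover have "\<omega> + fscale c \<eta> \<in> forms X p q" if "\<omega> \<in> forms X p q" "\<eta> \<in> forms X p q" for \<omega> \<eta> :: "'a form" and c
    using smooth_form_lincomb[OF X forms_smooth[OF that(1)] forms_smooth[OF that(2)], of c] that
    unfolding forms_def smooth_form_def by (auto simp: fscale_def)
  ultimately show ?thesis by (simp add: is_subspace_def)
qed

lemma subspace_compact_forms: "open X \<Longrightarrow> is_subspace (compact_forms X p q)"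
proof -
  assume X: "open X"
  have "0 \<in> compact_forms X p q"
    using subspace_zero[OF subspace_forms[OF X]] unfolding compact_forms_def
    by (auto intro!: exI[of _ "{}"])
  moreover have "\<omega> + fscale c \<eta> \<in> compact_forms X p q"
    if \<omega>: "\<omega> \<in> compact_forms X p q" and \<eta>: "\<eta> \<in> compact_forms X p q" for \<omega> \<eta> :: "'a form" and c
  proof -
    obtain K K' where "compact K" "K \<subseteq> X" "\<And>z I J. z \<notin> K \<Longrightarrow> \<omega> (z, I, J) = 0"
      "compact K'" "K' \<subseteq> X" "\<And>z I J. z \<notin> K' \<Longrightarrow> \<eta> (z, I, J) = 0"
      using \<omega> \<eta> unfolding compact_forms_def by blast
    then have "compact (K \<union> K') \<and> K \<union> K' \<subseteq> X \<and> (\<forall>z I J. z \<notin> K \<union> K' \<longrightarrow> (\<omega> + fscale c \<eta>) (z, I, J) = 0)"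
      by (auto simp: fscale_def)
    moreover have "\<omega> + fscale c \<eta> \<in> forms X p q"
      using subspace_forms[OF X, of p q] \<omega> \<eta> by (simp add: is_subspace_def compact_forms_def)
    ultimately show ?thesis unfolding compact_forms_def by blast
  qed
  ultimately show ?thesis by (simp add: is_subspace_def)
qed

lemma compact_forms_smooth: "\<omega> \<in> compact_forms X p q \<Longrightarrow> smooth_form X \<omega>"
  using forms_smooth by (auto simp: compact_forms_def)

lemma subspace_image:
  assumes V: "is_subspace V" and T: "T 0 = 0"
    "\<And>x y c. x \<in> V \<Longrightarrow> y \<in> V \<Longrightarrow> T (x + fscale c y) = T x + fscale c (T y)"
  shows "is_subspace (T ` V)"
  unfolding is_subspace_def
proof (intro conjI ballI allI)
  show "0 \<in> T ` V" using T(1) subspace_zero[OF V] by force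
  show "x + fscale c y \<in> T ` V" if "x \<in> T ` V" "y \<in> T ` V" for x y c
    using that V T(2) unfolding is_subspace_def by (smt (verit) imageE image_eqI)
qed

lemma subspace_plus:
  assumes V: "is_subspace V" and W: "is_subspace W"
  shows "is_subspace (V + W)"
  unfolding is_subspace_def
proof (intro conjI ballI allI)
  show "0 \<in> V + W" using set_plus_intro[OF subspace_zero[OF V] subspace_zero[OF W]] by simp
  fix x y c assume "x \<in> V + W" "y \<in> V + W"
  then obtain v w v' w' where "v \<in> V" "w \<in> W" "x = v + w" "v' \<in> V" "w' \<in> W" "y = v' + w'"
    by (auto simp: set_plus_def)
  moreover have "(v + w) + fscale c (v' + w') = (v + fscale c v') + (w + fscale c w')"
    by (simp add: fscale_add(1) algebra_simps)
  moreover have "v + fscale c v' \<in> V" "w + fscale c w' \<in> W" if "v \<in> V" "v' \<in> V" "w \<in> W" "w' \<in> W"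
    using V W that by (simp_all add: is_subspace_def)
  ultimately show "x + fscale c y \<in> V + W"
    using set_plus_intro[of "v + fscale c v'" V "w + fscale c w'" W] by metis
qed

lemma subspace_A_cocycles:
  assumes X: "open X" shows "is_subspace (A_cocycles X)"
proof -
  note V = subspace_compact_forms[OF X, of 1 1]
  have "del X (delbar X (\<omega> + fscale c \<eta>)) = 0"
    if "\<omega> \<in> A_cocycles X" "\<eta> \<in> A_cocycles X" for \<omega> \<eta> c
  proof -
    have s: "smooth_form X \<omega>" "smooth_form X \<eta>"
      using that compact_forms_smooth by (auto simp: A_cocycles_def)
    show ?thesis
      using that unfolding delbar_lincomb[OF X s] del_lincomb[OF X smooth_form_delbar[OF X s(1)] smooth_form_delbar[OF X s(2)]]
      by (simp add: A_cocycles_def)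
  qed
  then show ?thesis
    using V by (auto simp: is_subspace_def A_cocycles_def del_zero delbar_zero)
qed

lemma subspace_A_coboundaries:
  assumes X: "open X" shows "is_subspace (A_coboundaries X)"
  unfolding A_coboundaries_def
  by (intro subspace_plus subspace_image subspace_compact_forms X)
    (auto simp: del_zero delbar_zero del_lincomb delbar_lincomb X compact_forms_smooth)

lemma subspace_BC_coboundaries:
  assumes X: "open X" shows "is_subspace (BC_coboundaries X)"
  unfolding BC_coboundaries_def
proof (rule subspace_image[OF subspace_forms[OF X]])
  show "del X (delbar X (x + fscale c y)) = del X (delbar X x) + fscale c (del X (delbar X y))"
    if "x \<in> forms X 0 0" "y \<in> forms X 0 0" for x y c
    by (simp add: delbar_lincomb del_lincomb smooth_form_delbar X forms_smooth[OF that(1)] forms_smooth[OF that(2)])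
qed (simp add: del_zero delbar_zero)

lemma subspace_BC_cocycles:
  assumes X: "open X" shows "is_subspace (BC_cocycles X)"
  using subspace_forms[OF X, of 1 1]
  unfolding is_subspace_def BC_cocycles_def
  by (auto simp: del_zero delbar_zero del_lincomb delbar_lincomb X forms_smooth)

section \<open>Aeppli cohomology with compact support has dimension at most one\<close>

text \<open>
  In the two-element type \<open>2\<close> the numeral \<open>2\<close> denotes \<open>0\<close>, so that \<open>dz\<^sub>2\<close> precedes \<open>dz\<^sub>1\<close> in the
  ordered basis of forms.  The effect is a global sign in the formulas for top coefficients.
\<close>

lemma two_less_one: "(2 :: 2) < 1" "\<not> (1 :: 2) < 2"
  by (simp_all add: less_bit0_def bit0.Rep_0 bit0.Rep_1 bit0.Rep_numeral)

lemma shuffle_sign_2: "shuffle_sign {1 :: 2} {2} = -1" "shuffle_sign {2 :: 2} {1} = 1"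
  "shuffle_sign {k :: 2} {} = 1"
proof -
  have e: "{(a, b). a \<in> {1 :: 2} \<and> b \<in> {2 :: 2} \<and> b < a} = {(1, 2)}"
    "{(a, b). a \<in> {2 :: 2} \<and> b \<in> {1 :: 2} \<and> b < a} = {}"
    using two_less_one by auto
  show "shuffle_sign {1 :: 2} {2} = -1" "shuffle_sign {2 :: 2} {1} = 1"
    unfolding shuffle_sign_def e by simp_all
qed (simp add: shuffle_sign_def)

lemma UNIV_2_diff: "UNIV - {1 :: 2} = {2}" "UNIV - {2 :: 2} = {1}"
  by (auto simp: UNIV_2)

lemma sum_UNIV_2: "(\<Sum>k\<in>(UNIV :: 2 set). f k) = f 1 + f 2" for f :: "2 \<Rightarrow> complex"
  by (simp add: UNIV_2)

lemma delbar_1_top: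
  "z \<in> X \<Longrightarrow> delbar X \<alpha> (z, {j :: 2}, UNIV)
     = dbar_op 1 (\<lambda>w. \<alpha> (w, {j}, {2})) z - dbar_op 2 (\<lambda>w. \<alpha> (w, {j}, {1})) z"
  by (simp add: delbar_wop sum_UNIV_2 UNIV_2_diff shuffle_sign_2)

lemma del_top:
  "z \<in> X \<Longrightarrow> del X \<omega> (z, UNIV :: 2 set, J)
     = del_op 2 (\<lambda>w. \<omega> (w, {1}, J)) z - del_op 1 (\<lambda>w. \<omega> (w, {2}, J)) z"
  by (simp add: del_wop sum_UNIV_2 UNIV_2_diff shuffle_sign_2)

lemma wop_diff_on:
  assumes "open X" "z \<in> X" "smooth_on X f" "smooth_on X g"
  shows "wop s k (\<lambda>x. f x - g x) z = wop s k f z - wop s k g z"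
  using assms by (intro wop_diff smooth_on_differentiable)

lemma del_delbar_top:
  assumes X: "open X" and z: "z \<in> X" and \<alpha>: "smooth_form X \<alpha>"
  shows "del X (delbar X \<alpha>) (z, UNIV :: 2 set, UNIV) = - (
    del_op 2 (dbar_op 2 (\<lambda>w. \<alpha> (w, {1}, {1}))) z - del_op 2 (dbar_op 1 (\<lambda>w. \<alpha> (w, {1}, {2}))) z
    - del_op 1 (dbar_op 2 (\<lambda>w. \<alpha> (w, {2}, {1}))) z + del_op 1 (dbar_op 1 (\<lambda>w. \<alpha> (w, {2}, {2}))) z)"
proof -
  have "wop s k (\<lambda>w. delbar X \<alpha> (w, {j}, UNIV)) z
    = wop s k (dbar_op 1 (\<lambda>w. \<alpha> (w, {j}, {2}))) z - wop s k (dbar_op 2 (\<lambda>w. \<alpha> (w, {j}, {1}))) z" for s k j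
  proof -
    have "wop s k (\<lambda>w. delbar X \<alpha> (w, {j}, UNIV)) z
      = wop s k (\<lambda>z. dbar_op 1 (\<lambda>w. \<alpha> (w, {j}, {2})) z - dbar_op 2 (\<lambda>w. \<alpha> (w, {j}, {1})) z) z"
      by (rule wop_cong_open[OF X z delbar_1_top])
    also have "\<dots> = wop s k (dbar_op 1 (\<lambda>w. \<alpha> (w, {j}, {2}))) z - wop s k (dbar_op 2 (\<lambda>w. \<alpha> (w, {j}, {1}))) z"
      by (rule wop_diff_on[OF X z]) (intro smooth_wop X smooth_form_coeff[OF \<alpha>])+
    finally show ?thesis .
  qed
  then show ?thesis unfolding del_top[OF z] by simp
qed

lemma subsets_2: "(S :: 2 set) = {} \<or> S = {1} \<or> S = {2} \<or> S = UNIV"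
proof -
  have "S \<subseteq> {1, 2}" using UNIV_2 by auto
  then show ?thesis unfolding UNIV_2 by blast
qed

lemma UNIV_2_not_singleton: "(UNIV :: 2 set) \<noteq> {k}"
proof
  assume "UNIV = {k}"
  then have "(1 :: 2) = k" "(2 :: 2) = k" by auto
  then show False by simp
qed

definition form01 :: "(complex ^ 2 \<Rightarrow> complex) \<Rightarrow> (complex ^ 2 \<Rightarrow> complex) \<Rightarrow> 2 form" where
  "form01 f g = (\<lambda>(z, I, J). if I = {} \<and> J = {1} then f z else if I = {} \<and> J = {2} then g z else 0)"

definition form10 :: "(complex ^ 2 \<Rightarrow> complex) \<Rightarrow> (complex ^ 2 \<Rightarrow> complex) \<Rightarrow> 2 form" where
  "form10 f g = (\<lambda>(z, I, J). if I = {1} \<and> J = {} then f z else if I = {2} \<and> J = {} then g z else 0)"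

lemma smooth_on_if:
  "smooth_on X f \<Longrightarrow> smooth_on X g \<Longrightarrow> smooth_on X (\<lambda>z. if P then f z else g z)"
  by (cases P) simp_all

lemma compact_form01_form10:
  assumes f: "smooth_on UNIV f" "smooth_on UNIV g"
    and v: "\<And>z. z \<in> far R e \<Longrightarrow> f z = 0" "\<And>z. z \<in> far R e \<Longrightarrow> g z = 0" and X: "open X" "- far R e \<subseteq> X"
  shows "form01 f g \<in> compact_forms X 0 1" "form10 f g \<in> compact_forms X 1 0"
proof -
  have s: "smooth_on X f" "smooth_on X g" "smooth_on X (\<lambda>z. 0)"
    using f smooth_on_subset X smooth_on_const by blast+
  have z: "f z = 0" "g z = 0" if "z \<notin> X" for z using v that X by auto
  show "form01 f g \<in> compact_forms X 0 1"
    unfolding compact_forms_def forms_def form01_def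
    using s z v compact_not_far[of R e] X by (auto intro!: exI[of _ "- far R e"] smooth_on_if)
  show "form10 f g \<in> compact_forms X 1 0"
    unfolding compact_forms_def forms_def form10_def
    using s z v compact_not_far[of R e] X by (auto intro!: exI[of _ "- far R e"] smooth_on_if)
qed

lemma del_form01:
  "del X (form01 f g) (z, K, J) = (if z \<in> X \<and> (\<exists>k. K = {k}) then
     (if J = {1} then del_op (the_elem K) f z else if J = {2} then del_op (the_elem K) g z else 0) else 0)"
proof -
  consider "K = {}" | "K = {1}" | "K = {2}" | "K = UNIV" using subsets_2 by blast
  then show ?thesis
  proof cases
    case 4
    show ?thesis
      unfolding 4 del_wop sum_UNIV_2 UNIV_2_diff by (simp add: form01_def UNIV_2_not_singleton)
  qed (simp_all add: del_wop form01_def shuffle_sign_2)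
qed

lemma delbar_form10:
  "delbar X (form10 f g) (z, I, M) = (if z \<in> X \<and> (\<exists>k. M = {k}) then
     (if I = {1} then - dbar_op (the_elem M) f z else if I = {2} then - dbar_op (the_elem M) g z else 0) else 0)"
proof -
  consider "M = {}" | "M = {1}" | "M = {2}" | "M = UNIV" using subsets_2 by blast
  then show ?thesis
  proof cases
    case 4
    show ?thesis
      unfolding 4 delbar_wop sum_UNIV_2 UNIV_2_diff by (simp add: form10_def UNIV_2_not_singleton)
  qed (simp_all add: delbar_wop form10_def shuffle_sign_2)
qed

text \<open>
  Up to a constant factor, the integral of \<open>\<alpha>\<close> over the half-plane \<open>Re z\<^sub>1 < 0, z\<^sub>2 = 0\<close>.  This half-plane is bounded
  by the line, hence closed in \<open>X\<close>, and it generates the second homology of \<open>X\<close> with closed supports.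
\<close>

definition period :: "2 form \<Rightarrow> complex" where
  "period \<alpha> = hplane.conv (\<lambda>z. \<alpha> (z, {1}, {1})) 0"

lemma compact_forms_far:
  assumes L: "X = UNIV - {z. Re (z $ 1) = 0 \<and> z $ 2 = 0}" and \<alpha>: "\<alpha> \<in> compact_forms X p q"
  obtains R e where "R > 0" "e > 0" "\<And>z I J. z \<in> far R e \<Longrightarrow> \<alpha> (z, I, J) = 0"
proof -
  obtain K where K: "compact K" "K \<subseteq> X" "\<And>z I J. z \<notin> K \<Longrightarrow> \<alpha> (z, I, J) = 0"
    using \<alpha> unfolding compact_forms_def by blast
  have "K \<inter> {z. Re (z $ 1) = 0 \<and> z $ 2 = 0} = {}" using K(2) L by auto
  then obtain R e where "R > 0" "e > 0" "K \<inter> far R e = {}"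
    using compact_avoids_far[OF K(1)] by blast
  then show ?thesis using K(3) that by blast
qed

lemma compact_forms_smooth_UNIV:
  assumes X: "open X" and \<alpha>: "\<alpha> \<in> compact_forms X p q"
  shows "smooth_on UNIV (\<lambda>z. \<alpha> (z, I, J))"
proof (rule smooth_on_local[OF open_UNIV])
  obtain K where K: "compact K" "K \<subseteq> X" "\<And>z I J. z \<notin> K \<Longrightarrow> \<alpha> (z, I, J) = 0"
    using \<alpha> unfolding compact_forms_def by blast
  fix z
  show "\<exists>U. open U \<and> z \<in> U \<and> smooth_on U (\<lambda>z. \<alpha> (z, I, J))"
  proof (cases "z \<in> X")
    case True
    then show ?thesis using X smooth_form_coeff[OF compact_forms_smooth[OF \<alpha>]] by blast
  next
    case False
    have o: "open (- K)" using K(1) by (simp add: compact_imp_closed open_Compl)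
    have "smooth_on (- K) (\<lambda>z. \<alpha> (z, I, J))"
      by (rule smooth_on_cong[OF o, of "\<lambda>z. 0"]) (use K(3) o in auto)
    then show ?thesis using o False K(2) by blast
  qed
qed

lemma open_complement_line: "open (UNIV - {z :: complex ^ 2. Re (z $ 1) = 0 \<and> z $ 2 = 0})"
proof -
  have "closed {z :: complex ^ 2. Re (z $ 1) = 0}" "closed {z :: complex ^ 2. z $ 2 = 0}"
    by (intro closed_Collect_eq continuous_intros)+
  then have "closed ({z :: complex ^ 2. Re (z $ 1) = 0} \<inter> {z. z $ 2 = 0})" by (rule closed_Int)
  moreover have "UNIV - {z :: complex ^ 2. Re (z $ 1) = 0 \<and> z $ 2 = 0}
      = - ({z :: complex ^ 2. Re (z $ 1) = 0} \<inter> {z. z $ 2 = 0})" by auto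
  ultimately show ?thesis by (simp only: open_Compl)
qed

lemma A_exact_if_period_zero:
  assumes L: "X = UNIV - {z. Re (z $ 1) = 0 \<and> z $ 2 = 0}"
    and \<alpha>: "\<alpha> \<in> A_cocycles X" and per: "period \<alpha> = 0"
  shows "\<alpha> \<in> A_coboundaries X"
proof -
  have X: "open X" unfolding L by (rule open_complement_line)
  have \<alpha>c: "\<alpha> \<in> compact_forms X 1 1" and cl: "del X (delbar X \<alpha>) = 0" using \<alpha> by (auto simp: A_cocycles_def)
  then have \<alpha>f: "\<alpha> \<in> forms X 1 1" by (simp add: compact_forms_def)
  obtain R e where Re: "R > 0" "e > 0" "\<And>z I J. z \<in> far R e \<Longrightarrow> \<alpha> (z, I, J) = 0"
    using compact_forms_far[OF L \<alpha>c] by blast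
  have fX: "- far R e \<subseteq> X" using Re(2) by (auto simp: L far_def)
  note s = compact_forms_smooth_UNIV[OF X \<alpha>c]
  define a where "a j k = (\<lambda>z. \<alpha> (z, {j}, {k}))" for j k
  have sa: "smooth_on UNIV (a j k)" for j k unfolding a_def by (rule s)
  have closed: "del_op 2 (dbar_op 2 (a 1 1)) z - del_op 2 (dbar_op 1 (a 1 2)) z
      - del_op 1 (dbar_op 2 (a 2 1)) z + del_op 1 (dbar_op 1 (a 2 2)) z = 0" for z
  proof (cases "z \<in> X")
    case True
    show ?thesis
      using del_delbar_top[OF X True compact_forms_smooth[OF \<alpha>c]] cl by (simp add: a_def algebra_simps)
  next
    case False
    then have z: "z \<in> far R e" using fX by auto
    have "wop t j (wop t' k (a i l)) z = 0" for t j t' k i l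
      by (rule wop_zero_open[OF open_far z], rule wop_zero_open[OF open_far]) (auto simp: a_def Re(3))
    then show ?thesis by simp
  qed
  obtain p1 p2 q1 q2 where pq:
    "smooth_on UNIV p1" "smooth_on UNIV p2" "smooth_on UNIV q1" "smooth_on UNIV q2"
    "\<And>z. z \<in> far R e \<Longrightarrow> p1 z = 0 \<and> p2 z = 0 \<and> q1 z = 0 \<and> q2 z = 0"
    "\<And>z. a 1 1 z = del_op 1 q1 z - dbar_op 1 p1 z" "\<And>z. a 1 2 z = del_op 1 q2 z - dbar_op 2 p1 z"
    "\<And>z. a 2 1 z = del_op 2 q1 z - dbar_op 1 p2 z" "\<And>z. a 2 2 z = del_op 2 q2 z - dbar_op 2 p2 z"
  proof (rule aeppli_exact[OF sa[of 1 1] sa[of 1 2] sa[of 2 1] sa[of 2 2] _ Re(1,2) closed])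
    show "a 1 1 z = 0 \<and> a 1 2 z = 0 \<and> a 2 1 z = 0 \<and> a 2 2 z = 0" if "z \<in> far R e" for z
      by (simp add: a_def Re(3)[OF that])
    show "hplane.conv (a 1 1) 0 = 0" using per by (simp add: period_def a_def)
  qed blast
  have P: "form01 q1 q2 \<in> compact_forms X 0 1" "form10 p1 p2 \<in> compact_forms X 1 0"
    using compact_form01_form10[OF pq(3,4) _ _ X fX] compact_form01_form10[OF pq(1,2) _ _ X fX] pq(5) by auto
  have "\<alpha> = del X (form01 q1 q2) + delbar X (form10 p1 p2)"
  proof
    fix i :: "(complex ^ 2) \<times> 2 set \<times> 2 set"
    obtain z K J where i: "i = (z, K, J)" by (rule prod_cases3)
    have ne: "(1 :: 2) \<noteq> 2" by simp
    have zero: "\<alpha> (z, K, J) = 0" if "\<not> (z \<in> X \<and> card K = 1 \<and> card J = 1)"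
      by (rule forms_zero[OF \<alpha>f that])
    show "\<alpha> i = (del X (form01 q1 q2) + delbar X (form10 p1 p2)) i"
    proof (cases "z \<in> X \<and> card K = 1 \<and> card J = 1")
      case True
      then obtain j k where "K = {j}" "J = {k}" by (auto simp: card_1_singleton_iff)
      moreover have "j = 1 \<or> j = 2" "k = 1 \<or> k = 2" by (rule exhaust_2)+
      ultimately show ?thesis
        using True pq(6,7,8,9)[of z] ne by (auto simp: i del_form01 delbar_form10 a_def)
    next
      case False
      then show ?thesis
        using zero[OF False] ne by (auto simp: i del_form01 delbar_form10)
    qed
  qed
  then show ?thesis
    using set_plus_intro[OF imageI[OF P(1), of "del X"] imageI[OF P(2), of "delbar X"]]
    by (simp only: A_coboundaries_def)
qed

lemma period_lincomb:
  assumes L: "X = UNIV - {z. Re (z $ 1) = 0 \<and> z $ 2 = 0}"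
    and "\<alpha> \<in> A_cocycles X" "\<beta> \<in> A_cocycles X"
  shows "period (\<alpha> + fscale c \<beta>) = period \<alpha> + c * period \<beta>"
proof -
  have X: "open X" unfolding L by (rule open_complement_line)
  have cs: "csmooth (\<lambda>z. \<gamma> (z, I, J))" if "\<gamma> \<in> A_cocycles X" for \<gamma> I J
  proof -
    have \<gamma>: "\<gamma> \<in> compact_forms X 1 1" using that by (simp add: A_cocycles_def)
    obtain R e where "R > 0" "e > 0" "\<And>z I J. z \<in> far R e \<Longrightarrow> \<gamma> (z, I, J) = 0"
      by (rule compact_forms_far[OF L \<gamma>]) (rule that)
    then show ?thesis by (intro csmooth_far[OF compact_forms_smooth_UNIV[OF X \<gamma>]])
  qed
  have "period (\<alpha> + fscale c \<beta>) = hplane.conv (\<lambda>z. \<alpha> (z, {1}, {1}) + c * \<beta> (z, {1}, {1})) 0"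
    by (simp add: period_def fscale_def)
  also have "\<dots> = period \<alpha> + c * period \<beta>"
    unfolding period_def by (simp only: hplane.conv_add[OF cs[OF assms(2)] csmooth_cmult[OF cs[OF assms(3)]]] hplane.conv_cmult)
  finally show ?thesis .
qed

section \<open>Integration over slices\<close>

text \<open>
  The operator \<open>wop s\<close> for a single complex variable, in real coordinates.
\<close>

definition pw :: "complex \<Rightarrow> (real \<times> real \<Rightarrow> complex) \<Rightarrow> real \<times> real \<Rightarrow> complex" where
  "pw s g p = (Der (1, 0) g p + s * Der (0, 1) g p) / 2"

lemma csmooth_pw: "csmooth g \<Longrightarrow> csmooth (pw s g)"
proof -
  assume g: "csmooth g"
  have "csmooth (\<lambda>p. (1 / 2) * (Der (1, 0) g p + s * Der (0, 1) g p))"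
    by (intro csmooth_cmult csmooth_add csmooth_Der g)
  then show ?thesis by (simp add: pw_def[abs_def])
qed

lemma smooth_pw: "smooth_on UNIV g \<Longrightarrow> smooth_on UNIV (pw s g)"
  unfolding pw_def[abs_def]
  by (intro smooth_on_divide_const smooth_on_add smooth_on_mult smooth_on_const smooth_on_Der open_UNIV)

lemma pw_parts1:
  assumes G: "smooth_on UNIV G" and h: "csmooth h"
  shows "(\<integral>p. pw s G p * h p \<partial>lborel) = - (\<integral>p. G p * pw s h p \<partial>lborel)"
proof -
  have c: "csmooth (\<lambda>p. G p * h p)" by (rule csmooth_mult_right[OF h G])
  have d: "G differentiable (at p)" "h differentiable (at p)" for p
    using smooth_on_differentiable[OF G UNIV_I] csmooth_differentiable[OF h] .
  have i: "integrable lborel (\<lambda>p. pw s G p * h p)" "integrable lborel (\<lambda>p. G p * pw s h p)"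
    by (intro csmooth_integrable csmooth_mult_right csmooth_pw smooth_pw G h)+
  have "(\<integral>p. pw s G p * h p \<partial>lborel) + (\<integral>p. G p * pw s h p \<partial>lborel)
      = (\<integral>p. pw s G p * h p + G p * pw s h p \<partial>lborel)"
    by (rule Bochner_Integration.integral_add[symmetric, OF i])
  also have "\<dots> = (\<integral>p. (1/2) * (Der (1, 0) (\<lambda>p. G p * h p) p + s * Der (0, 1) (\<lambda>p. G p * h p) p) \<partial>lborel)"
    unfolding Der_mult[OF d] pw_def
    by (intro Bochner_Integration.integral_cong refl) (simp add: field_simps)
  also have "\<dots> = (1/2) * ((\<integral>p. Der (1, 0) (\<lambda>p. G p * h p) p \<partial>lborel) + s * (\<integral>p. Der (0, 1) (\<lambda>p. G p * h p) p \<partial>lborel))"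
    using csmooth_integrable[OF csmooth_Der[OF c]]
    by (simp add: Bochner_Integration.integral_add)
  also have "\<dots> = 0" by (simp add: integral_Der_zero[OF c])
  finally show ?thesis by (simp add: eq_neg_iff_add_eq_0)
qed

lemma pw_parts2:
  assumes G: "smooth_on UNIV G" and h: "csmooth h"
  shows "(\<integral>p. pw s (pw t G) p * h p \<partial>lborel) = (\<integral>p. G p * pw t (pw s h) p \<partial>lborel)"
  unfolding pw_parts1[OF smooth_pw[OF G] h] pw_parts1[OF G csmooth_pw[OF h]] by simp

definition plane2 :: "real \<times> real \<Rightarrow> complex ^ 2" where
  "plane2 p = fst p *\<^sub>R axis 2 1 + snd p *\<^sub>R axis 2 \<i>"

lemma plane2_nth: "plane2 p $ 1 = 0" "plane2 p $ 2 = plane p"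
  unfolding plane2_def plane_def by (simp_all add: axis_def complex_eq_iff)

lemma bounded_linear_plane2: "bounded_linear plane2"
  unfolding plane2_def[abs_def]
  by (intro bounded_linear_add bounded_linear_scaleR_const bounded_linear_fst bounded_linear_snd)

lemma pw_slice:
  assumes "smooth_on X F" "\<And>p. q + plane2 p \<in> X"
  shows "pw s (\<lambda>p. F (q + plane2 p)) p = wop s 2 F (q + plane2 p)"
proof -
  have "plane2 (1, 0) = axis 2 1" "plane2 (0, 1) = axis 2 \<i>" by (simp_all add: plane2_def)
  then show ?thesis
    unfolding pw_def wop_def smooth_on_affine_within(2)[OF assms(1) bounded_linear_plane2 assms(2)] by simp
qed

definition cutoff :: "real \<times> real \<Rightarrow> real" where
  "cutoff p = step (2 + fst p) * step (2 - fst p) * (step (2 + snd p) * step (2 - snd p))"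

text \<open>
  Near the origin the test function is \<open>z\<^sub>2\<close> and hence harmonic, so that its Laplacian is supported
  away from \<open>z\<^sub>2 = 0\<close>, where slices through the line leave \<open>X\<close>.  The factor \<open>z\<^sub>2\<close>, rather than \<open>1\<close>, is needed because the
  coefficient \<open>(2,2)\<close> of the forms below carries the angular factor \<open>cnj z\<^sub>2\<close>.
\<close>

definition test_fun :: "real \<times> real \<Rightarrow> complex" where
  "test_fun p = plane p * of_real (cutoff p)"

lemma cutoff_nonneg: "cutoff p \<ge> 0"
  by (simp add: cutoff_def step_nonneg)

lemma cutoff_1: "\<bar>fst p\<bar> \<le> 1 \<Longrightarrow> \<bar>snd p\<bar> \<le> 1 \<Longrightarrow> cutoff p = 1"
  by (simp add: cutoff_def step_1)

lemma cutoff_0: "2 < \<bar>fst p\<bar> \<or> 2 < \<bar>snd p\<bar> \<Longrightarrow> cutoff p = 0"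
  using step_0[of "2 + fst p"] step_0[of "2 - fst p"] step_0[of "2 + snd p"] step_0[of "2 - snd p"]
  by (auto simp: cutoff_def abs_if split: if_splits)

lemma norm_pair_le: "norm (p :: real \<times> real) \<le> \<bar>fst p\<bar> + \<bar>snd p\<bar>"
  using norm_Pair_le[of "fst p" "snd p"] by simp

lemma csmooth_test_fun: "csmooth test_fun"
proof -
  have s: "smooth_on UNIV (\<lambda>p. of_real (step (2 + L p)) :: complex)"
    if "bounded_linear L" for L :: "real \<times> real \<Rightarrow> real"
    by (rule smooth_on_affine(1)[OF smooth_step that])
  have "smooth_on UNIV (\<lambda>p. plane p * (of_real (step (2 + fst p)) * of_real (step (2 + - fst p)) *
      (of_real (step (2 + snd p)) * of_real (step (2 + - snd p)))))"
    by (intro smooth_on_mult open_UNIV smooth_plane s bounded_linear_minus bounded_linear_fst bounded_linear_snd)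
  then have "smooth_on UNIV test_fun" by (simp add: test_fun_def[abs_def] cutoff_def)
  moreover have "test_fun p = 0" if "4 < norm p" for p
  proof -
    have "2 < \<bar>fst p\<bar> \<or> 2 < \<bar>snd p\<bar>" using norm_pair_le[of p] that by linarith
    then show ?thesis by (simp add: test_fun_def cutoff_0)
  qed
  ultimately show ?thesis unfolding csmooth_def by blast
qed

definition test_lap :: "real \<times> real \<Rightarrow> complex" where
  "test_lap = pw \<i> (pw (- \<i>) test_fun)"

lemma csmooth_test_lap: "csmooth test_lap"
  unfolding test_lap_def by (intro csmooth_pw csmooth_test_fun)

lemma test_lap_zero:
  assumes "\<not> (\<bar>fst p\<bar> \<le> 2 \<and> \<bar>snd p\<bar> \<le> 2 \<and> (1 \<le> \<bar>fst p\<bar> \<or> 1 \<le> \<bar>snd p\<bar>))"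
  shows "test_lap p = 0"
proof -
  have pw_cong: "pw s f p = pw s g p" if "open U" "p \<in> U" "\<And>q. q \<in> U \<Longrightarrow> f q = g q" for s f g p U
    unfolding pw_def using Der_cong_open[OF that] by simp
  have pw_0: "pw s (\<lambda>p. c) p = 0" for s c p by (simp add: pw_def)
  have pw_plane: "pw s plane = (\<lambda>p. (1 + s * \<i>) / 2)" for s
    by (auto simp: pw_def Der_plane plane_def)
  let ?U = "{p :: real \<times> real. \<bar>fst p\<bar> < 1} \<inter> {p. \<bar>snd p\<bar> < 1}"
  let ?V = "{p :: real \<times> real. 2 < \<bar>fst p\<bar>} \<union> {p. 2 < \<bar>snd p\<bar>}"
  have o: "open ?U" "open ?V" by (intro open_Int open_Un open_Collect_less continuous_intros)+
  have U: "pw t (pw s test_fun) p = 0" if "p \<in> ?U" for s t p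
  proof -
    have "pw t (pw s test_fun) p = pw t (pw s plane) p"
      by (rule pw_cong[OF o(1) that], rule pw_cong[OF o(1)]) (auto simp: test_fun_def cutoff_1)
    then show ?thesis by (simp add: pw_plane pw_0)
  qed
  have V: "pw t (pw s test_fun) p = 0" if "p \<in> ?V" for s t p
  proof -
    have "pw t (pw s test_fun) p = pw t (pw s (\<lambda>p. 0)) p"
      by (rule pw_cong[OF o(2) that], rule pw_cong[OF o(2)]) (auto simp: test_fun_def cutoff_0)
    then show ?thesis by (simp add: pw_0[abs_def])
  qed
  have "p \<in> ?U \<or> p \<in> ?V" using assms by auto
  then show ?thesis unfolding test_lap_def using U V by blast
qed

section \<open>Bott-Chern cocycles of Bochner-Martinelli type\<close>

definition ctr :: "real \<Rightarrow> complex ^ 2" where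
  "ctr c = axis 1 (\<i> * of_real c)"

definition shifted :: "real \<Rightarrow> 2 \<Rightarrow> complex ^ 2 \<Rightarrow> complex" where
  "shifted c j z = z $ j - ctr c $ j"

definition rad :: "real \<Rightarrow> complex ^ 2 \<Rightarrow> complex" where
  "rad c z = shifted c 1 z * cnj (shifted c 1 z) + shifted c 2 z * cnj (shifted c 2 z)"

definition twist :: "real \<Rightarrow> 2 \<Rightarrow> complex ^ 2 \<Rightarrow> complex" where
  "twist c k z = (if k = 1 then cnj (shifted c 2 z) else - cnj (shifted c 1 z))"

text \<open>
  Up to a constant these are the coefficients of \<open>\<partial>\<beta>\<close> for the Bochner-Martinelli form
  \<open>\<beta> = (cnj z\<^sub>1 d(cnj z\<^sub>2) - cnj z\<^sub>2 d(cnj z\<^sub>1)) / |z|\<^sup>4\<close>, translated to a point of the line.  Since \<open>\<beta>\<close> is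
  \<open>\<partial>\<bar>\<close>-closed, \<open>\<partial>\<beta>\<close> is closed; it is singular at the chosen point only.
\<close>

definition bm_coeff :: "real \<Rightarrow> 2 \<Rightarrow> 2 \<Rightarrow> complex ^ 2 \<Rightarrow> complex" where
  "bm_coeff c j k z = cnj (shifted c j z) * twist c k z * inverse (rad c z) ^ 3"

definition bm_form :: "(complex ^ 2) set \<Rightarrow> real \<Rightarrow> 2 form" where
  "bm_form X c = (\<lambda>(z, I, J). if z \<in> X \<and> card I = 1 \<and> card J = 1 then bm_coeff c (the_elem I) (the_elem J) z else 0)"

lemma rad_real: "rad c z = of_real ((norm (shifted c 1 z))\<^sup>2 + (norm (shifted c 2 z))\<^sup>2)"
  using complex_norm_square[of "shifted c 1 z"] complex_norm_square[of "shifted c 2 z"]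
  by (simp add: rad_def)

lemma rad_nonzero:
  assumes "Re (z $ 1) \<noteq> 0 \<or> z $ 2 \<noteq> 0" shows "rad c z \<noteq> 0"
proof
  assume "rad c z = 0"
  then have "(norm (shifted c 1 z))\<^sup>2 + (norm (shifted c 2 z))\<^sup>2 = 0" unfolding rad_real of_real_eq_0_iff .
  then have "shifted c 1 z = 0" "shifted c 2 z = 0" by (simp_all add: sum_power2_eq_zero_iff)
  then have "z $ 1 = \<i> * of_real c" "z $ 2 = 0" by (simp_all add: shifted_def ctr_def axis_def)
  then show False using assms by simp
qed

lemma smooth_shifted: "open X \<Longrightarrow> smooth_on X (shifted c j)"
  unfolding shifted_def[abs_def]
  by (intro smooth_on_diff smooth_on_const smooth_on_linear bounded_linear_vec_nth)

lemma smooth_rad: "open X \<Longrightarrow> smooth_on X (rad c)"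
  unfolding rad_def[abs_def] by (intro smooth_on_add smooth_on_mult smooth_on_cnj smooth_shifted)

lemma smooth_twist: "open X \<Longrightarrow> smooth_on X (twist c k)"
  unfolding twist_def[abs_def] by (intro smooth_on_if smooth_on_minus smooth_on_cnj smooth_shifted)

lemma wop_shifted: "wop s k (shifted c j) z = (if j = k then (1 + s * \<i>) / 2 else 0)"
proof -
  have "Der v (shifted c j) z = v $ j" for v
  proof (rule Der_eqI)
    show "(shifted c j has_derivative (\<lambda>v. v $ j)) (at z)"
      unfolding shifted_def[abs_def]
      using bounded_linear_imp_has_derivative[OF bounded_linear_vec_nth[of j], of "at z"]
      by (auto intro!: derivative_eq_intros)
  qed
  then show ?thesis by (simp add: wop_def axis_def)
qed

lemma diff_shifted: "shifted c j differentiable (at z)"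
  using smooth_on_differentiable[OF smooth_shifted[OF open_UNIV] UNIV_I] .

lemma wop_cnj_shifted: "wop s k (\<lambda>z. cnj (shifted c j z)) z = (if j = k then (1 - s * \<i>) / 2 else 0)"
  unfolding wop_cnj[OF diff_shifted] wop_shifted by simp

lemma wop_rad: "wop s k (rad c) z = shifted c k z * ((1 - s * \<i>) / 2) + ((1 + s * \<i>) / 2) * cnj (shifted c k z)"
proof -
  have d: "(\<lambda>z. cnj (shifted c j z)) differentiable (at z)" for j
    by (rule differentiable_cnj[OF diff_shifted])
  have d2: "(\<lambda>z. shifted c j z * cnj (shifted c j z)) differentiable (at z)" for j
    by (intro differentiable_mult d diff_shifted)
  have "k = 1 \<or> k = 2" by (rule exhaust_2)
  then show ?thesis
    unfolding rad_def[abs_def] wop_add[OF d2 d2] wop_mult[OF diff_shifted d] wop_shifted wop_cnj_shifted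
    by auto
qed

lemma wop_inverse:
  "f differentiable (at z) \<Longrightarrow> f z \<noteq> 0 \<Longrightarrow> wop s k (\<lambda>z. inverse (f z)) z = - (inverse (f z) * inverse (f z) * wop s k f z)"
proof -
  assume d: "f differentiable (at z)" "f z \<noteq> 0"
  show ?thesis unfolding wop_def Der_inverse[OF d] by (simp add: algebra_simps add_divide_distrib diff_divide_distrib)
qed

lemma wop_inverse_rad3:
  assumes "rad c z \<noteq> 0"
  shows "wop s k (\<lambda>z. inverse (rad c z) ^ 3) z = - 3 * inverse (rad c z) ^ 4 * wop s k (rad c) z"
proof -
  have d: "rad c differentiable (at z)"
    using smooth_on_differentiable[OF smooth_rad[OF open_UNIV] UNIV_I] .
  have di: "(\<lambda>z. inverse (rad c z)) differentiable (at z)" using d assms by (rule differentiable_inverse)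
  have di2: "(\<lambda>z. inverse (rad c z) * inverse (rad c z)) differentiable (at z)"
    by (intro differentiable_mult di)
  have "(\<lambda>z. inverse (rad c z) ^ 3) = (\<lambda>z. inverse (rad c z) * (inverse (rad c z) * inverse (rad c z)))"
    by (simp add: power3_eq_cube mult.assoc)
  then show ?thesis
    unfolding wop_mult[OF di di2] wop_mult[OF di di] wop_inverse[OF d assms]
    by (simp add: wop_mult[OF di di2] wop_mult[OF di di] wop_inverse[OF d assms] power4_eq_xxxx algebra_simps)
qed

lemma wop_bm_coeff:
  assumes "rad c z \<noteq> 0"
  shows "wop s l (bm_coeff c j k) z =
    (cnj (shifted c j z) * wop s l (twist c k) z + wop s l (\<lambda>z. cnj (shifted c j z)) z * twist c k z) * inverse (rad c z) ^ 3
    - 3 * (cnj (shifted c j z) * twist c k z) * inverse (rad c z) ^ 4 * wop s l (rad c) z"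
proof -
  have d1: "(\<lambda>z. cnj (shifted c j z)) differentiable (at z)" by (rule differentiable_cnj[OF diff_shifted])
  have d2: "twist c k differentiable (at z)"
    using smooth_on_differentiable[OF smooth_twist[OF open_UNIV] UNIV_I] .
  have d: "rad c differentiable (at z)"
    using smooth_on_differentiable[OF smooth_rad[OF open_UNIV] UNIV_I] .
  have d3: "(\<lambda>z. inverse (rad c z) ^ 3) differentiable (at z)"
    by (intro differentiable_power differentiable_inverse d assms)
  show ?thesis
    unfolding bm_coeff_def[abs_def] wop_mult[OF differentiable_mult[OF d1 d2] d3] wop_mult[OF d1 d2] wop_inverse_rad3[OF assms]
    by (simp add: algebra_simps)
qed

lemma wop_twist: "wop s l (twist c k) z = (if k = 1 then if l = 2 then (1 - s * \<i>) / 2 else 0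
   else if l = 1 then - ((1 - s * \<i>) / 2) else 0)"
proof (cases "k = 1")
  case True
  then show ?thesis using wop_cnj_shifted[of s l c 2 z] by (auto simp: twist_def[abs_def])
next
  case False
  have "wop s l (\<lambda>z. (-1) * cnj (shifted c 1 z)) z = (-1) * wop s l (\<lambda>z. cnj (shifted c 1 z)) z"
    by (rule wop_cmult[OF differentiable_cnj[OF diff_shifted]])
  then show ?thesis using False wop_cnj_shifted[of s l c 1 z] by (auto simp: twist_def[abs_def])
qed

lemma bm_del: "rad c z \<noteq> 0 \<Longrightarrow> del_op 2 (bm_coeff c 1 k) z = del_op 1 (bm_coeff c 2 k) z"
  by (simp add: wop_bm_coeff wop_twist wop_cnj_shifted wop_rad)

lemma bm_dbar:
  assumes r: "rad c z \<noteq> 0"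
  shows "dbar_op 1 (bm_coeff c j 2) z = dbar_op 2 (bm_coeff c j 1) z"
proof -
  have e: "inverse (rad c z) ^ 3 = rad c z * inverse (rad c z) ^ 4"
    using r by (simp add: power3_eq_cube power4_eq_xxxx)
  have "j = 1 \<or> j = 2" by (rule exhaust_2)
  then show ?thesis
    unfolding wop_bm_coeff[OF r] wop_twist wop_cnj_shifted wop_rad e
    by (auto simp: twist_def rad_def algebra_simps)
qed

lemma bm_cocycle:
  assumes L: "X = UNIV - {z. Re (z $ 1) = 0 \<and> z $ 2 = 0}"
  shows "bm_form X c \<in> BC_cocycles X"
proof -
  have X: "open X" unfolding L by (rule open_complement_line)
  have r: "rad c z \<noteq> 0" if "z \<in> X" for z using that by (intro rad_nonzero) (auto simp: L)
  have s: "smooth_on X (bm_coeff c j k)" for j k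
    unfolding bm_coeff_def[abs_def]
    by (intro smooth_on_mult smooth_on_power smooth_on_inverse smooth_on_cnj smooth_shifted smooth_twist smooth_rad X r)
  have f: "bm_form X c \<in> forms X 1 1"
    unfolding forms_def
  proof (intro CollectI conjI allI impI)
    fix I J
    have "smooth_on X (\<lambda>z. if card I = 1 \<and> card J = 1 then bm_coeff c (the_elem I) (the_elem J) z else 0)"
      by (intro smooth_on_if s smooth_on_const X)
    then show "smooth_on X (\<lambda>z. bm_form X c (z, I, J))"
      by (rule smooth_on_cong[OF X, rotated]) (simp add: bm_form_def)
  qed (auto simp: bm_form_def)
  have sing: "wop s l (\<lambda>z. bm_form X c (z, {j}, {k})) z = wop s l (bm_coeff c j k) z" if "z \<in> X" for s l j k z
    by (rule wop_cong_open[OF X that]) (simp add: bm_form_def)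
  have zero: "wop s l (\<lambda>z. bm_form X c (z, I, J)) z = 0" if "\<not> (card I = 1 \<and> card J = 1)" for s l I J z
  proof -
    have "(\<lambda>z. bm_form X c (z, I, J)) = (\<lambda>z. 0)" using that by (auto simp: bm_form_def)
    then show ?thesis by simp
  qed
  have "del X (bm_form X c) (z, K, J) = 0" for z K J
  proof (cases "z \<in> X")
    case True
    consider k where "J = {k}" "K = UNIV" | "K = UNIV" "card J \<noteq> 1" | "K = {}" | "K = {1}" | "K = {2}"
      using subsets_2[of K] by (auto simp: card_1_singleton_iff)
    then show ?thesis
    proof cases
      case 1 then show ?thesis using del_top[OF True] bm_del[OF r[OF True]] by (simp add: sing[OF True])
    next
      case 2 then show ?thesis using del_top[OF True] by (simp add: zero)
    qed (simp_all add: del_wop zero)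
  qed (simp add: del_wop)
  moreover have "delbar X (bm_form X c) (z, I, M) = 0" for z I M
  proof (cases "z \<in> X")
    case True
    consider j where "I = {j}" "M = UNIV" | "M = UNIV" "card I \<noteq> 1" | "M = {}" | "M = {1}" | "M = {2}"
      using subsets_2[of M] by (auto simp: card_1_singleton_iff)
    then show ?thesis
    proof cases
      case 1 then show ?thesis using delbar_1_top[OF True] bm_dbar[OF r[OF True]] by (simp add: sing[OF True])
    next
      case 2 then show ?thesis by (simp add: delbar_wop zero)
    qed (simp_all add: delbar_wop zero)
  qed (simp add: delbar_wop)
  ultimately show ?thesis using f by (auto simp: BC_cocycles_def fun_eq_iff)
qed

section \<open>Independence of the Bott-Chern classes\<close>

lemma sum_fun_apply: "(\<Sum>i\<in>A. f i) x = (\<Sum>i\<in>A. f i x)" for f :: "'k \<Rightarrow> 'i \<Rightarrow> complex"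
  by (induction A rule: infinite_finite_induct) auto

text \<open>
  A point at distance \<open>\<bar>e\<bar>\<close> from the singularity of the \<open>m\<close>-th form, approached in the direction \<open>Re z\<^sub>1\<close>.
\<close>

definition base_pt :: "nat \<Rightarrow> real \<Rightarrow> complex ^ 2" where
  "base_pt m e = axis 1 (of_real e + \<i> * of_nat m)"

lemma base_pt_nth: "(base_pt m e + plane2 p) $ 1 = of_real e + \<i> * of_nat m" "(base_pt m e + plane2 p) $ 2 = plane p"
  by (simp_all add: base_pt_def plane2_nth) (simp_all add: axis_def)

lemma bm_coeff_slice:
  "bm_coeff (real i) 2 2 (base_pt m e + plane2 p) =
     - (cnj (plane p) * cnj (of_real e + \<i> * (of_nat m - of_nat i)) *
        inverse (of_real ((norm (of_real e + \<i> * (of_nat m - of_nat i) :: complex))\<^sup>2 + (norm p)\<^sup>2)) ^ 3)"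
proof -
  define u where "u = (of_real e + \<i> * (of_nat m - of_nat i) :: complex)"
  have s: "shifted (real i) 1 (base_pt m e + plane2 p) = u"
    "shifted (real i) 2 (base_pt m e + plane2 p) = plane p"
    unfolding shifted_def base_pt_nth by (simp_all add: u_def ctr_def axis_def algebra_simps)
  show ?thesis
    unfolding bm_coeff_def twist_def rad_real s norm_plane u_def[symmetric] by simp
qed

lemma bm_coeff_bounded:
  assumes "i \<noteq> m"
  shows "norm (bm_coeff (real i) 2 2 (base_pt m e + plane2 p)) \<le> 1"
proof -
  define u where "u = (of_real e + \<i> * (of_nat m - of_nat i) :: complex)"
  define S where "S = (norm u)\<^sup>2 + (norm p)\<^sup>2"
  have "1 \<le> \<bar>real m - real i\<bar>" using assms by linarith
  also have "\<dots> = \<bar>Im u\<bar>" by (simp add: u_def)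
  also have "\<dots> \<le> norm u" by (rule abs_Im_le_cmod)
  finally have "1 \<le> (norm u)\<^sup>2" by (simp add: one_le_power)
  then have S: "1 \<le> S" by (simp add: S_def add_increasing2)
  have "2 * (norm p * norm u) \<le> S"
    using sum_squares_bound[of "norm p" "norm u"] by (simp add: S_def algebra_simps)
  then have pu: "norm p * norm u \<le> S" using mult_nonneg_nonneg[OF norm_ge_zero[of p] norm_ge_zero[of u]] by linarith
  have "norm (bm_coeff (real i) 2 2 (base_pt m e + plane2 p)) = (norm p * norm u) * inverse S ^ 3"
    unfolding bm_coeff_slice u_def[symmetric] S_def[symmetric]
    using S by (simp add: norm_mult norm_power norm_inverse norm_plane)
  also have "\<dots> \<le> S * inverse S ^ 3" using pu S by (intro mult_right_mono) auto
  also have "\<dots> = inverse S ^ 2" using S by (simp add: power3_eq_cube power2_eq_square)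
  also have "\<dots> \<le> 1" using S by (intro power_le_one) (auto simp: inverse_le_1_iff)
  finally show ?thesis .
qed

text \<open>
  The integrand of the pairing of the \<open>m\<close>-th form with the test function near its own singularity,
  up to sign.
\<close>

definition blowup :: "real \<Rightarrow> real \<times> real \<Rightarrow> real" where
  "blowup e p = e * (norm p)\<^sup>2 * inverse (e\<^sup>2 + (norm p)\<^sup>2) ^ 3 * cutoff p"

lemma bm_coeff_diag:
  "bm_coeff (real m) 2 2 (base_pt m e + plane2 p) * test_fun p = - of_real (blowup e p)"
proof -
  have "bm_coeff (real m) 2 2 (base_pt m e + plane2 p) * test_fun p
    = - (of_real e * (plane p * cnj (plane p)) * inverse (of_real (e\<^sup>2 + (norm p)\<^sup>2)) ^ 3 * of_real (cutoff p))"
    unfolding bm_coeff_slice test_fun_def by simp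
  also have "\<dots> = - of_real (blowup e p)"
    unfolding plane_cnj blowup_def by simp
  finally show ?thesis .
qed

lemma blowup_nonneg: "e > 0 \<Longrightarrow> blowup e p \<ge> 0"
  unfolding blowup_def by (intro mult_nonneg_nonneg cutoff_nonneg zero_le_power) (auto intro: add_nonneg_nonneg)

text \<open>
  On a square of side \<open>e / 2\<close> at distance of order \<open>e\<close> from the origin the integrand is of order
  \<open>1 / e ^ 3\<close>, and the square has area \<open>e\<^sup>2 / 4\<close>.
\<close>

lemma blowup_integral:
  assumes e: "0 < e" "e \<le> 1" and i: "integrable lborel (blowup e)"
  shows "1 / (216 * e) \<le> (\<integral>p. blowup e p \<partial>lborel)"
proof -
  let ?Q = "cbox (e / 2, e / 2) (e, e) :: (real \<times> real) set"
  have "measure lborel ?Q = (e / 2) * (e / 2)"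
    using content_Pair[of "e/2" "e/2" e e] e by simp
  then have "1 / (216 * e) = (\<integral>p. indicator ?Q p * (1 / (54 * e ^ 3)) \<partial>lborel)"
    using e by (simp add: power3_eq_cube field_simps)
  also have "\<dots> \<le> (\<integral>p. blowup e p \<partial>lborel)"
  proof (rule integral_mono[OF _ i])
    show "integrable lborel (\<lambda>p. indicator ?Q p * (1 / (54 * e ^ 3)))"
      by (intro integrable_mult_left integrable_real_indicator) (auto simp: emeasure_lborel_cbox_eq)
    fix p
    show "indicator ?Q p * (1 / (54 * e ^ 3)) \<le> blowup e p"
    proof (cases "p \<in> ?Q")
      case True
      obtain x y where p: "p = (x, y)" by force
      have xy: "e / 2 \<le> x" "x \<le> e" "e / 2 \<le> y" "y \<le> e" using True by (auto simp: p cbox_Pair_eq)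
      have n: "(norm p)\<^sup>2 = x\<^sup>2 + y\<^sup>2" by (simp add: p norm_prod_def)
      have sq: "(e / 2)\<^sup>2 \<le> x\<^sup>2" "x\<^sup>2 \<le> e\<^sup>2" "(e / 2)\<^sup>2 \<le> y\<^sup>2" "y\<^sup>2 \<le> e\<^sup>2"
        using xy e by (auto intro!: power_mono)
      have lo: "e\<^sup>2 / 2 \<le> (norm p)\<^sup>2" using sq by (simp add: n power_divide)
      have hi: "e\<^sup>2 + (norm p)\<^sup>2 \<le> 3 * e\<^sup>2" using sq by (simp add: n)
      have pos: "0 < e\<^sup>2 + (norm p)\<^sup>2" using e by (simp add: add_pos_nonneg)
      have c: "cutoff p = 1" using xy e by (intro cutoff_1) (auto simp: p)
      have "1 / (54 * e ^ 3) = e * (e\<^sup>2 / 2) * inverse (3 * e\<^sup>2) ^ 3"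
        using e by (simp add: power2_eq_square power3_eq_cube field_simps)
      also have "\<dots> \<le> e * (norm p)\<^sup>2 * inverse (e\<^sup>2 + (norm p)\<^sup>2) ^ 3"
        using e lo hi pos by (intro mult_mono mult_left_mono power_mono le_imp_inverse_le) auto
      finally show ?thesis using True by (simp add: blowup_def c)
    qed (use blowup_nonneg e in simp)
  qed
  finally show ?thesis .
qed

text \<open>
  Suppose the combination is \<open>\<partial>\<partial>\<bar>F\<close>.  On the slice \<open>z\<^sub>1 = e + \<i> m\<close>, which for \<open>e > 0\<close> lies in \<open>X\<close>,
  integrating its \<open>(2,2)\<close>-coefficient against the test function is the same as integrating \<open>F\<close> against
  the Laplacian of the test function.  As \<open>e \<rightarrow> 0\<close> the latter stays bounded, because \<open>F\<close> is continuous where the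
  Laplacian is supported, including \<open>e = 0\<close>.  On the left, the forms with other singularities contribute
  bounded terms, whereas the \<open>m\<close>-th one grows like \<open>1 / e\<close>.
\<close>

lemma bm_combination_not_exact:
  assumes L: "X = UNIV - {z. Re (z $ 1) = 0 \<and> z $ 2 = 0}"
    and ex: "(\<Sum>i<n. fscale (c i) (bm_form X (real i))) \<in> BC_coboundaries X" and m: "m < n"
  shows "c m = 0"
proof (rule ccontr)
  assume cm: "c m \<noteq> 0"
  have X: "open X" unfolding L by (rule open_complement_line)
  have r: "rad t z \<noteq> 0" if "z \<in> X" for t z using that by (intro rad_nonzero) (auto simp: L)
  obtain f where f: "f \<in> forms X 0 0" "(\<Sum>i<n. fscale (c i) (bm_form X (real i))) = del X (delbar X f)"
    using ex unfolding BC_coboundaries_def by blast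
  define F where "F z = f (z, {}, {})" for z
  have sF: "smooth_on X F" unfolding F_def by (rule smooth_form_coeff[OF forms_smooth[OF f(1)]])
  have eq: "(\<Sum>i<n. c i * bm_coeff (real i) 2 2 z) = del_op 2 (dbar_op 2 F) z" if z: "z \<in> X" for z
  proof -
    have "(\<Sum>i<n. c i * bm_coeff (real i) 2 2 z) = (\<Sum>i<n. fscale (c i) (bm_form X (real i))) (z, {2}, {2})"
      using z by (simp add: sum_fun_apply fscale_def bm_form_def)
    also have "\<dots> = del_op 2 (\<lambda>w. delbar X f (w, {}, {2})) z"
      unfolding f(2) using z by (simp add: del_wop shuffle_sign_2)
    also have "\<dots> = del_op 2 (dbar_op 2 F) z"
      by (rule wop_cong_open[OF X z]) (simp add: delbar_wop shuffle_sign_2 F_def[abs_def])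
    finally show ?thesis .
  qed

  \<comment> \<open>A compact set of points \<open>(e, p)\<close>, including \<open>e = 0\<close>, whose images stay off the line.\<close>
  define K where "K = cbox (-2, -2) (2, 2) \<inter> ({p :: real \<times> real. 1 \<le> \<bar>fst p\<bar>} \<union> {p. 1 \<le> \<bar>snd p\<bar>})"
  have K: "compact K" unfolding K_def
    by (intro compact_Int_closed compact_cbox closed_Un closed_Collect_le continuous_intros)
  define g where "g ep = base_pt m (fst ep) + plane2 (snd ep)" for ep :: "real \<times> (real \<times> real)"
  have "continuous_on UNIV g"
  proof -
    have "g = (\<lambda>ep. fst ep *\<^sub>R E1 + base_pt m 0 + plane2 (snd ep))"
      by (auto simp: g_def base_pt_def fun_eq_iff vec_eq_iff axis_def complex_eq_iff)
    then show ?thesis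
      by (simp only:) (intro continuous_intros linear_continuous_on_compose[OF _ bounded_linear.linear[OF bounded_linear_plane2]])
  qed
  then have gc: "compact (g ` ({0..1} \<times> K))"
    by (intro compact_continuous_image compact_Times compact_Icc K) (rule continuous_on_subset, auto)
  have gX: "g ` ({0..1} \<times> K) \<subseteq> X"
  proof (clarify)
    fix e :: real and x y :: real assume "(x, y) \<in> K"
    then have "plane (x, y) \<noteq> 0" by (auto simp: K_def plane_def complex_eq_iff)
    then show "g (e, x, y) \<in> X" using base_pt_nth(2)[of m e "(x, y)"] by (simp add: L g_def)
  qed
  have "compact (F ` g ` ({0..1} \<times> K))"
    by (rule compact_continuous_image[OF continuous_on_subset[OF smooth_on_continuous_on[OF sF] gX] gc])
  then have "bounded (F ` g ` ({0..1} \<times> K))" by (rule compact_imp_bounded)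
  then obtain B0 where B0: "\<And>w. w \<in> F ` g ` ({0..1} \<times> K) \<Longrightarrow> norm w \<le> B0"
    unfolding bounded_iff by blast
  have B: "norm (F (base_pt m e + plane2 p)) \<le> B0" if "0 \<le> e" "e \<le> 1" "p \<in> K" for e p
  proof -
    have "(e, p) \<in> {0..1} \<times> K" using that by simp
    from B0[OF imageI[OF imageI[OF this]]] show ?thesis by (simp add: g_def)
  qed
  define M where "M = \<bar>B0\<bar> * (\<integral>p. norm (test_lap p) \<partial>lborel) + (\<Sum>i<n. norm (c i)) * (\<integral>p. norm (test_fun p) \<partial>lborel)"
  have iT: "integrable lborel test_fun" "integrable lborel test_lap"
    by (intro csmooth_integrable csmooth_test_fun csmooth_test_lap)+
  have M0: "M \<ge> 0" unfolding M_def
    by (intro add_nonneg_nonneg mult_nonneg_nonneg sum_nonneg integral_nonneg_AE) auto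

  have bound: "norm (c m) * (1 / (216 * e)) \<le> M" if e: "0 < e" "e \<le> 1" for e
  proof -
    have inX: "base_pt m e + plane2 p \<in> X" for p
      using base_pt_nth(1)[of m e p] e unfolding L by (simp del: vector_add_component)
    define A where "A i = (\<integral>p. bm_coeff (real i) 2 2 (base_pt m e + plane2 p) * test_fun p \<partial>lborel)" for i
    have sb: "smooth_on X (bm_coeff t j k)" for t j k
      unfolding bm_coeff_def[abs_def]
      by (intro smooth_on_mult smooth_on_power smooth_on_inverse smooth_on_cnj smooth_shifted smooth_twist smooth_rad X r)
    note slice = smooth_on_affine_within(1)[OF _ bounded_linear_plane2 inX]
    have iA: "integrable lborel (\<lambda>p. bm_coeff (real i) 2 2 (base_pt m e + plane2 p) * test_fun p)" for i
      by (intro csmooth_integrable csmooth_mult_right csmooth_test_fun slice sb)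
    have "(\<Sum>i<n. c i * A i) = (\<integral>p. (\<Sum>i<n. c i * bm_coeff (real i) 2 2 (base_pt m e + plane2 p)) * test_fun p \<partial>lborel)"
    proof -
      have "(\<integral>p. (\<Sum>i<n. c i * bm_coeff (real i) 2 2 (base_pt m e + plane2 p)) * test_fun p \<partial>lborel)
        = (\<integral>p. (\<Sum>i<n. c i * (bm_coeff (real i) 2 2 (base_pt m e + plane2 p) * test_fun p)) \<partial>lborel)"
        by (simp add: sum_distrib_right mult.assoc)
      also have "\<dots> = (\<Sum>i<n. (\<integral>p. c i * (bm_coeff (real i) 2 2 (base_pt m e + plane2 p) * test_fun p) \<partial>lborel))"
        by (intro Bochner_Integration.integral_sum integrable_mult_right iA)
      finally show ?thesis by (simp add: A_def)
    qed
    also have "\<dots> = (\<integral>p. pw (- \<i>) (pw \<i> (\<lambda>p. F (base_pt m e + plane2 p))) p * test_fun p \<partial>lborel)"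
    proof (intro Bochner_Integration.integral_cong refl)
      fix p
      have "pw \<i> (\<lambda>p. F (base_pt m e + plane2 p)) = (\<lambda>p. dbar_op 2 F (base_pt m e + plane2 p))"
        using pw_slice[OF sF inX] by auto
      then have "pw (- \<i>) (pw \<i> (\<lambda>p. F (base_pt m e + plane2 p))) p = del_op 2 (dbar_op 2 F) (base_pt m e + plane2 p)"
        using pw_slice[OF smooth_wop[OF X sF] inX] by simp
      then show "(\<Sum>i<n. c i * bm_coeff (real i) 2 2 (base_pt m e + plane2 p)) * test_fun p
          = pw (- \<i>) (pw \<i> (\<lambda>p. F (base_pt m e + plane2 p))) p * test_fun p"
        by (simp only: eq[OF inX])
    qed
    also have "\<dots> = (\<integral>p. F (base_pt m e + plane2 p) * test_lap p \<partial>lborel)"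
      unfolding test_lap_def by (rule pw_parts2[OF slice[OF sF] csmooth_test_fun])
    finally have main: "(\<Sum>i<n. c i * A i) = (\<integral>p. F (base_pt m e + plane2 p) * test_lap p \<partial>lborel)" .
    have "norm (\<integral>p. F (base_pt m e + plane2 p) * test_lap p \<partial>lborel) \<le> (\<integral>p. \<bar>B0\<bar> * norm (test_lap p) \<partial>lborel)"
    proof (rule Bochner_Integration.integral_norm_bound_integral)
      show "integrable lborel (\<lambda>p. F (base_pt m e + plane2 p) * test_lap p)"
        by (intro csmooth_integrable csmooth_mult_right csmooth_test_lap slice sF)
      show "integrable lborel (\<lambda>p. \<bar>B0\<bar> * norm (test_lap p))" using iT(2) by simp
      fix p
      show "norm (F (base_pt m e + plane2 p) * test_lap p) \<le> \<bar>B0\<bar> * norm (test_lap p)"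
      proof (cases "p \<in> K")
        case True
        then have "norm (F (base_pt m e + plane2 p)) \<le> \<bar>B0\<bar>" using B[of e p] e by simp
        then show ?thesis by (simp add: norm_mult mult_right_mono)
      next
        case False
        then have "test_lap p = 0"
          by (intro test_lap_zero) (auto simp: K_def cbox_Pair_eq abs_le_iff mem_Times_iff)
        then show ?thesis by simp
      qed
    qed
    then have 1: "norm (\<Sum>i<n. c i * A i) \<le> \<bar>B0\<bar> * (\<integral>p. norm (test_lap p) \<partial>lborel)"
      unfolding main by simp
    have 2: "norm (A i) \<le> (\<integral>p. norm (test_fun p) \<partial>lborel)" if "i \<noteq> m" for i
      unfolding A_def
    proof (rule Bochner_Integration.integral_norm_bound_integral[OF iA])
      show "integrable lborel (\<lambda>p. norm (test_fun p))" using iT(1) by simp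
      show "norm (bm_coeff (real i) 2 2 (base_pt m e + plane2 p) * test_fun p) \<le> norm (test_fun p)" for p
        using mult_right_mono[OF bm_coeff_bounded[OF that, of e p], of "norm (test_fun p)"] by (simp add: norm_mult)
    qed
    have "norm (\<Sum>i\<in>{..<n} - {m}. c i * A i) \<le> (\<Sum>i\<in>{..<n} - {m}. norm (c i) * (\<integral>p. norm (test_fun p) \<partial>lborel))"
      by (intro sum_norm_le) (auto simp: norm_mult intro!: mult_left_mono 2)
    also have "\<dots> \<le> (\<Sum>i<n. norm (c i) * (\<integral>p. norm (test_fun p) \<partial>lborel))"
      by (intro sum_mono2 mult_nonneg_nonneg integral_nonneg_AE) auto
    also have "\<dots> = (\<Sum>i<n. norm (c i)) * (\<integral>p. norm (test_fun p) \<partial>lborel)" by (simp add: sum_distrib_right)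
    finally have 3: "norm (\<Sum>i\<in>{..<n} - {m}. c i * A i) \<le> (\<Sum>i<n. norm (c i)) * (\<integral>p. norm (test_fun p) \<partial>lborel)" .
    have "c m * A m = (\<Sum>i<n. c i * A i) - (\<Sum>i\<in>{..<n} - {m}. c i * A i)"
      using m by (simp add: sum.remove[of "{..<n}" m])
    then have 4: "norm (c m * A m) \<le> M"
      using 1 3 norm_triangle_ineq4[of "\<Sum>i<n. c i * A i" "\<Sum>i\<in>{..<n} - {m}. c i * A i"] by (simp add: M_def)
    have Am: "A m = - of_real (\<integral>p. blowup e p \<partial>lborel)"
      unfolding A_def bm_coeff_diag by simp
    have "integrable lborel (\<lambda>p. - complex_of_real (blowup e p))"
      using iA[of m] unfolding bm_coeff_diag .
    then have ib: "integrable lborel (blowup e)"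
      by (simp add: complex_of_real_integrable_eq)
    have "norm (c m) * (1 / (216 * e)) \<le> norm (c m) * (\<integral>p. blowup e p \<partial>lborel)"
      by (intro mult_left_mono blowup_integral[OF e ib]) auto
    also have "\<dots> = norm (c m * A m)"
      using integral_nonneg_AE[of "blowup e" lborel] blowup_nonneg[OF e(1)] by (simp add: Am norm_mult)
    finally show ?thesis using 4 by simp
  qed
  \<comment> \<open>Small enough that the lower bound \<open>norm (c m) / (216 e)\<close> exceeds \<open>M\<close>.\<close>
  define e where "e = min 1 (norm (c m) / (216 * (M + 1)))"
  have e: "0 < e" "e \<le> 1" using cm M0 by (auto simp: e_def)
  have "e \<le> norm (c m) / (216 * (M + 1))" by (simp add: e_def)
  then have "(M + 1) * (216 * e) \<le> norm (c m)" using M0 by (simp add: field_simps)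
  then have "M + 1 \<le> norm (c m) * (1 / (216 * e))" using e by (simp add: field_simps)
  then show False using bound[OF e] by simp
qed

section \<open>The failure of duality\<close>

theorem mainTheorem3:
  fixes L X :: "(complex ^ 2) set"
  assumes L: "L = {z. Re (z $ 1) = 0 \<and> z $ 2 = 0}"
    and X: "X = UNIV - L"
  shows "cdim (H_BC X) \<ge> 3 \<and>
         cdim (H_A_c X) \<le> 2 \<and>
         \<not> (linearly_isomorphic (H_A_c X) (top_dual (H_BC X) (H_BC_topology X)) \<and>
            linearly_isomorphic (H_BC X) (top_dual (H_A_c X) (H_A_c_topology X)))"
proof (intro conjI)
  have XL: "X = UNIV - {z. Re (z $ 1) = 0 \<and> z $ 2 = 0}" using L X by simp
  have oX: "open X" unfolding XL by (rule open_complement_line)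
  interpret A: line_quotient "A_cocycles X" "A_coboundaries X" period
    by unfold_locales (auto intro: subspace_A_cocycles subspace_A_coboundaries oX
        period_lincomb[OF XL] A_exact_if_period_zero[OF XL])
  note subBC = subspace_BC_coboundaries[OF oX]
  define v where "v i = bm_form X (real i) +o BC_coboundaries X" for i
  have ind: "lin_independent (H_BC X) 3 v"
    unfolding lin_independent_def H_BC_def
  proof (intro conjI allI impI)
    show "v i \<in> carr (quot_space (BC_cocycles X) (BC_coboundaries X))" for i
      using bm_cocycle[OF XL] by (simp add: quot_simps v_def)
    fix c i assume z: "lin_comb (quot_space (BC_cocycles X) (BC_coboundaries X)) c v 3
      = zer (quot_space (BC_cocycles X) (BC_coboundaries X))" and i: "i < (3 :: nat)"
    have e: "lin_comb (quot_space (BC_cocycles X) (BC_coboundaries X)) c v 3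
      = (\<Sum>i<3. fscale (c i) (bm_form X (real i))) +o BC_coboundaries X"
      by (rule lin_comb_quot[OF subBC]) (rule v_def)
    have "(\<Sum>i<3. fscale (c i) (bm_form X (real i))) +o BC_coboundaries X = BC_coboundaries X"
      using z unfolding e quot_simps .
    then have "(\<Sum>i<3. fscale (c i) (bm_form X (real i))) \<in> BC_coboundaries X"
      unfolding coset_eq_zero[OF subBC] .
    then show "c i = 0" using bm_combination_not_exact[OF XL] i by blast
  qed
  then show "3 \<le> cdim (H_BC X)"
    unfolding cdim_def by (intro Sup_upper) (auto simp: numeral_eq_enat)
  show "cdim (H_A_c X) \<le> 2"
    unfolding cdim_def
  proof (rule Sup_least, clarify)
    fix n w assume "lin_independent (H_A_c X) n w"
    then have "n \<le> 1" unfolding H_A_c_def by (rule A.lin_independent_le_1)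
    then show "enat n \<le> 2" by (simp add: numeral_eq_enat)
  qed
  show "\<not> (linearly_isomorphic (H_A_c X) (top_dual (H_BC X) (H_BC_topology X)) \<and>
            linearly_isomorphic (H_BC X) (top_dual (H_A_c X) (H_A_c_topology X)))"
    using A.not_isomorphic_to_dual[OF subspace_BC_cocycles[OF oX] subBC ind[unfolded H_BC_def]]
    unfolding H_BC_def H_A_c_def by auto
qed

end
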